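(* Let $\alpha\in(0,1)$ be any irrational number and let $\beta\in[0,1)$. Then the cocycle $\Psi_2:\mathbb T\to\mathbb R^2$, $\Psi_2(x)=(\psi(x),\psi(x+\beta))$ with $\psi(x)=\{x\}-\frac12$, is regular over the rotation $Tx=x+\alpha$.
   Context: $\mathbb T=[0,1)$ is the additive circle (addition mod $1$) with Lebesgue measure $\mu$; $\{x\}$ is the fractional part; $Tx=x+\alpha$ mod $1$. A measurable function $\Phi:\mathbb T\to\mathbb R^m$ is called a cocycle over $T$. Two cocycles $\Phi,\Psi:\mathbb T\to\mathbb R^m$ are cohomologous if $\Phi-\Psi=f-f\circ T$ a.e. for some measurable $f:\mathbb T\to\mathbb R^m$. A cocycle $\Phi:\mathbb T\to\mathbb R^m$ is regular if it is cohomologous to a cocycle $\Psi$ taking values in a closed subgroup $H\subset\mathbb R^m$ such that $T_\Psi(x,h)=(Tx,h+\Psi(x))$ is ergodic on $\mathbb T\times H$ for the product of $\mu$ and Haar measure on $H$. *)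

theory Defs
  imports "HOL-Analysis.Analysis"
begin

definition circle :: "real measure" where
  "circle = restrict_space lborel {0..<1}"

definition rotation :: "real \<Rightarrow> real \<Rightarrow> real" where
  "rotation \<alpha> x = frac (x + \<alpha>)"

(* Only the values on [0,1) of a function on real matter. *)
definition cocycle :: "(real \<Rightarrow> real ^ 'm) \<Rightarrow> bool" where
  "cocycle \<Phi> \<longleftrightarrow> \<Phi> \<in> borel_measurable circle"

definition cohomologous ::
    "(real \<Rightarrow> real) \<Rightarrow> (real \<Rightarrow> real ^ 'm) \<Rightarrow> (real \<Rightarrow> real ^ 'm) \<Rightarrow> bool" where
  "cohomologous T \<Phi> \<Psi> \<longleftrightarrow> cocycle \<Phi> \<and> cocycle \<Psi> \<and>
     (\<exists>f \<in> borel_measurable circle. AE x in circle. \<Phi> x - \<Psi> x = f x - f (T x))"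

definition closed_subgroup :: "(real ^ 'm) set \<Rightarrow> bool" where
  "closed_subgroup H \<longleftrightarrow> closed H \<and> 0 \<in> H \<and>
     (\<forall>g\<in>H. \<forall>h\<in>H. g + h \<in> H) \<and> (\<forall>h\<in>H. - h \<in> H)"

(* A nonzero translation-invariant Borel measure on H that is finite on compact sets.
   Inner and outer regularity are automatic, as H is locally compact and second countable. *)
definition haar_measure_on :: "(real ^ 'm) set \<Rightarrow> (real ^ 'm) measure \<Rightarrow> bool" where
  "haar_measure_on H N \<longleftrightarrow>
     space N = H \<and> sets N = sets (restrict_space borel H) \<and>
     (\<forall>h\<in>H. \<forall>A\<in>sets N. emeasure N ((\<lambda>y. h + y) ` A) = emeasure N A) \<and>
     (\<forall>K. compact K \<and> K \<subseteq> H \<longrightarrow> emeasure N K < \<infinity>) \<and>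
     emeasure N H \<noteq> 0"

(* The measure M may be infinite. *)
definition ergodic :: "'a measure \<Rightarrow> ('a \<Rightarrow> 'a) \<Rightarrow> bool" where
  "ergodic M S \<longleftrightarrow>
     S \<in> measurable M M \<and> distr M M S = M \<and>
     (\<forall>A\<in>sets M. S -` A \<inter> space M = A \<longrightarrow>
        emeasure M A = 0 \<or> emeasure M (space M - A) = 0)"

definition skew_product ::
    "(real \<Rightarrow> real) \<Rightarrow> (real \<Rightarrow> real ^ 'm) \<Rightarrow> real \<times> (real ^ 'm) \<Rightarrow> real \<times> (real ^ 'm)" where
  "skew_product T \<Psi> = (\<lambda>(x, h). (T x, h + \<Psi> x))"

(* Haar measure is unique up to a positive factor, which does not affect ergodicity, so the
   choice of N is immaterial. *)
definition regular_cocycle :: "(real \<Rightarrow> real) \<Rightarrow> (real \<Rightarrow> real ^ 'm) \<Rightarrow> bool" where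
  "regular_cocycle T \<Phi> \<longleftrightarrow>
     (\<exists>\<Psi> H N. cohomologous T \<Phi> \<Psi> \<and> closed_subgroup H \<and> (\<forall>x\<in>{0..<1}. \<Psi> x \<in> H) \<and>
        haar_measure_on H N \<and> ergodic (circle \<Otimes>\<^sub>M N) (skew_product T \<Psi>))"

definition psi :: "real \<Rightarrow> real" where
  "psi x = frac x - 1 / 2"

(* As psi has period 1, addition of reals stands for addition mod 1 in its argument. *)
definition Psi2 :: "real \<Rightarrow> real \<Rightarrow> real ^ 2" where
  "Psi2 \<beta> x = vector [psi x, psi (x + \<beta>)]"

end

(* Smoothing the indicator of an invariant set A of T x H along H gives functions g on the
   line x R^2, periodic in x and Lipschitz in the second argument, with
   g (x + alpha) (w + Phi x) = g x w. The vectors v with g x (w + v) = g x w for almost all x form a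
   group, and if this group always contains H, then the fibres of A are null or conull, so that A
   is, since the rotation is ergodic.

   Periods come from Birkhoff sums Phi_n, which by Denjoy-Koksma are bounded when n = q is a
   denominator of alpha. Shifting x by s/q away from the discontinuities changes Phi_q by (s, s),
   hence every (s, s) is a period, and only psi(x + beta) - psi(x) matters, whose jumps are +1 and -1.
   If infinitely often the two kinds of jumps of the q-th sum are separated by a multiple of 1/q,
   crossing a single jump gives the period (0, 1). Otherwise beta is so close to multiples k alpha
   with |k| <= 3q/4 that at times l q the sum is constant outside a small set. Unless beta lies in
   Z alpha + Z these constants can be steered to any small number, which is then a period.
   Finally, modulo 1 the n-th sum of psi(x + beta) - psi(x) is n beta, so every limit of n beta
   along n alpha -> 0 gives a further period. The group H is the diagonal if beta is in
   Z alpha + Z, the diagonal plus (0, Z/j) if j is the least positive integer with j beta in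
   Z alpha + Z and j > 1, and R^2 otherwise. *)

theory Submission imports Defs begin

section \<open>Lebesgue measure on the circle\<close>

text \<open>Because the failure set of a candidate period is invariant under the rotation, testing
  the period on sets of measure at least a fixed positive constant is enough. There are two tests.
  Comparing two nearby starting points needs sums in a fixed ball, hence is applied at denominators.
  Comparing a starting point with its near return tolerates unbounded sums, provided that they are
  close to a fixed vector modulo periods already known; once all diagonal vectors are periods, only
  the difference of the two coordinates has to be controlled. The fraction 3/4 serves both
  alternatives about beta. Indices i in the middle half of [0, q) satisfy |i - j| <= 3q/4 for every
  j < q, and still account for a positive proportion of the jumps. On the other hand 3/4 is below 1
  by a margin, so that two different good approximations k at neighbouring levels would differ by
  too little; hence k recurs, and beta lies in Z alpha + Z, unless at some late level the drift per
  q steps is comparable to q times the distance of q alpha from the integers. The observables belong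
  to Phi itself, so the same periods serve every choice of H.\<close>

definition periodic_set :: "real set \<Rightarrow> bool" where
  "periodic_set S \<longleftrightarrow> (\<forall>x. x + 1 \<in> S \<longleftrightarrow> x \<in> S)"

text \<open>The circle is modelled by 1-periodic subsets of the line, so that rotations are plain
  additions without reduction mod 1. The measure is real-valued to allow ordinary
  arithmetic.\<close>

definition mu :: "real set \<Rightarrow> real" where
  "mu S = measure lborel (S \<inter> {0..<1})"

lemma periodic_set_int:
  assumes "periodic_set S" shows "x + of_int n \<in> S \<longleftrightarrow> x \<in> S"
proof -
  have nat: "x + of_nat k \<in> S \<longleftrightarrow> x \<in> S" for x and k :: nat
  proof (induction k)
    case (Suc k)
    have "(x + of_nat k) + 1 \<in> S \<longleftrightarrow> x + of_nat k \<in> S"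
      using assms unfolding periodic_set_def by blast
    then show ?case using Suc by (simp add: add_ac)
  qed simp
  show ?thesis
  proof (cases "n \<ge> 0")
    case True
    then show ?thesis using nat[of x "nat n"] by simp
  next
    case False
    then show ?thesis using nat[of "x + of_int n" "nat (- n)"] by simp
  qed
qed

lemma periodic_set_frac:
  assumes "periodic_set S" shows "frac x \<in> S \<longleftrightarrow> x \<in> S"
  using periodic_set_int[OF assms, of "frac x" "\<lfloor>x\<rfloor>"] by (simp add: frac_def)

lemma emeasure_lborel_translate:
  fixes S :: "real set"
  assumes "S \<in> sets borel"
  shows "emeasure lborel ((\<lambda>x. x + t) -` S) = emeasure lborel S"
proof -
  have "emeasure lborel S = emeasure (distr lborel borel ((+) t)) S"
    by (simp add: lborel_distr_plus)
  also have "\<dots> = emeasure lborel ((+) t -` S)"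
    using assms by (subst emeasure_distr) auto
  finally show ?thesis by (simp add: add.commute vimage_def)
qed

text \<open>The window [t, t+1) is cut at the integer that follows the integer part of t; moving the
  two pieces by integers reassembles [0, 1).\<close>

lemma emeasure_periodic_translate:
  assumes S: "S \<in> sets borel" and p: "periodic_set S"
  shows "emeasure lborel ((\<lambda>x. x + t) -` S \<inter> {0..<1}) = emeasure lborel (S \<inter> {0..<1})"
proof -
  have shift: "emeasure lborel (S \<inter> {a + of_int n..<b + of_int n}) = emeasure lborel (S \<inter> {a..<b})" for a b n
  proof -
    have "(\<lambda>x. x + of_int n) -` (S \<inter> {a + of_int n..<b + of_int n}) = S \<inter> {a..<b}"
      using periodic_set_int[OF p] by auto
    then show ?thesis
      using emeasure_lborel_translate[of "S \<inter> {a + of_int n..<b + of_int n}" "of_int n"] S by auto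
  qed
  define n where "n = \<lfloor>t\<rfloor>"
  have n: "of_int n \<le> t" "t < of_int n + 1" unfolding n_def by linarith+
  have "(\<lambda>x. x + t) -` (S \<inter> {t..<t+1}) = (\<lambda>x. x + t) -` S \<inter> {0..<1}" by auto
  then have "emeasure lborel ((\<lambda>x. x + t) -` S \<inter> {0..<1}) = emeasure lborel (S \<inter> {t..<t+1})"
    using emeasure_lborel_translate[of "S \<inter> {t..<t+1}" t] S by auto
  also have "S \<inter> {t..<t+1} = (S \<inter> {t..<of_int n + 1}) \<union> (S \<inter> {of_int n + 1..<t + 1})"
    using n by auto
  also have "emeasure lborel \<dots> = emeasure lborel (S \<inter> {t..<of_int n + 1})
      + emeasure lborel (S \<inter> {of_int n + 1..<t + 1})"
    using S by (intro plus_emeasure[symmetric]) auto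
  also have "emeasure lborel (S \<inter> {t..<of_int n + 1}) = emeasure lborel (S \<inter> {t - of_int n..<1})"
    using shift[of "t - of_int n" n 1] by (simp add: add.commute)
  also have "emeasure lborel (S \<inter> {of_int n + 1..<t + 1}) = emeasure lborel (S \<inter> {0..<t - of_int n})"
    using shift[of 0 "n + 1" "t - of_int n"] by (simp add: add.commute)
  also have "emeasure lborel (S \<inter> {t - of_int n..<1}) + emeasure lborel (S \<inter> {0..<t - of_int n})
     = emeasure lborel ((S \<inter> {t - of_int n..<1}) \<union> (S \<inter> {0..<t - of_int n}))"
    using S by (intro plus_emeasure) auto
  also have "(S \<inter> {t - of_int n..<1}) \<union> (S \<inter> {0..<t - of_int n}) = S \<inter> {0..<1}"
    using n by auto
  finally show ?thesis .
qed

lemma mu_translate: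
  assumes "S \<in> sets borel" "periodic_set S"
  shows "mu ((\<lambda>x. x + t) -` S) = mu S"
  unfolding mu_def measure_def using emeasure_periodic_translate[OF assms] by simp

lemma unit_fmeasurable: "S \<in> sets borel \<Longrightarrow> S \<inter> {0..<1::real} \<in> fmeasurable lborel"
  by (rule fmeasurableI2[where A = "{0..<1::real}"]) (auto intro: fmeasurableI)

lemma emeasure_unit: "S \<in> sets borel \<Longrightarrow> emeasure lborel (S \<inter> {0..<1}) = ennreal (mu S)"
  unfolding mu_def using unit_fmeasurable[of S]
  by (metis emeasure_eq_measure2)

lemma mu_nonneg: "0 \<le> mu S"
  unfolding mu_def by simp

lemma mu_UNIV [simp]: "mu UNIV = 1"
  unfolding mu_def by simp

lemma mu_empty [simp]: "mu {} = 0"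
  unfolding mu_def by simp

lemma mu_mono:
  assumes "S \<subseteq> T" "T \<in> sets borel" "S \<in> sets borel" shows "mu S \<le> mu T"
  unfolding mu_def
  by (rule measure_mono_fmeasurable) (use assms unit_fmeasurable[of T] in auto)

lemma mu_le_1: "S \<in> sets borel \<Longrightarrow> mu S \<le> 1"
  using mu_mono[of S UNIV] by simp

lemma mu_Un_le:
  assumes "S \<in> sets borel" "T \<in> sets borel" shows "mu (S \<union> T) \<le> mu S + mu T"
  unfolding mu_def Int_Un_distrib2
  by (rule measure_Un_le) (use assms in auto)

lemma mu_UN_le:
  assumes "finite I" "\<And>i. i \<in> I \<Longrightarrow> S i \<in> sets borel"
  shows "mu (\<Union>i\<in>I. S i) \<le> (\<Sum>i\<in>I. mu (S i))"
proof -
  have "(\<Union>i\<in>I. S i) \<inter> {0..<1} = (\<Union>i\<in>I. S i \<inter> {0..<1})" by auto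
  moreover have "measure lborel (\<Union>i\<in>I. S i \<inter> {0..<1}) \<le> (\<Sum>i\<in>I. measure lborel (S i \<inter> {0..<1}))"
    by (rule measure_UNION_le) (use assms in auto)
  ultimately show ?thesis unfolding mu_def by simp
qed

lemma mu_Compl:
  assumes "S \<in> sets borel" shows "mu (- S) = 1 - mu S"
proof -
  have "- S \<inter> {0..<1} = {0..<1} - (S \<inter> {0..<1})" by auto
  moreover have "measure lborel ({0..<1} - (S \<inter> {0..<1::real}))
      = measure lborel {0..<1::real} - measure lborel (S \<inter> {0..<1})"
    by (rule measurable_measure_Diff) (use assms unit_fmeasurable[of UNIV] in auto)
  ultimately show ?thesis unfolding mu_def by simp
qed

lemma mu_disjoint_Un:
  assumes "S \<in> sets borel" "T \<in> sets borel" "S \<inter> T = {}"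
  shows "mu (S \<union> T) = mu S + mu T"
  unfolding mu_def Int_Un_distrib2
  by (rule measure_Union) (use assms unit_fmeasurable fmeasurableD2 in auto)

lemma mu_Int_pos:
  assumes "S \<in> sets borel" "T \<in> sets borel" "mu S + mu T > 1"
  shows "S \<inter> T \<noteq> {}"
  using mu_disjoint_Un[OF assms(1,2)] mu_le_1[of "S \<union> T"] assms by force

lemma mu_Diff_ge:
  assumes "S \<in> sets borel" "T \<in> sets borel"
  shows "mu (S - T) \<ge> mu S - mu T"
proof -
  have "mu S \<le> mu ((S - T) \<union> T)" by (rule mu_mono) (use assms in auto)
  also have "\<dots> \<le> mu (S - T) + mu T" by (rule mu_Un_le) (use assms in auto)
  finally show ?thesis by simp
qed

lemma mu_disjoint_UN:
  assumes "finite I" "\<And>i. i \<in> I \<Longrightarrow> S i \<in> sets borel" "disjoint_family_on S I"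
  shows "mu (\<Union>i\<in>I. S i) = (\<Sum>i\<in>I. mu (S i))"
  using assms
proof (induction I rule: finite_induct)
  case (insert i I)
  have "mu (\<Union> (S ` insert i I)) = mu (S i \<union> (\<Union>i\<in>I. S i))" by simp
  also have "\<dots> = mu (S i) + mu (\<Union>i\<in>I. S i)"
    using insert by (intro mu_disjoint_Un) (auto simp: disjoint_family_on_def)
  also have "mu (\<Union>i\<in>I. S i) = (\<Sum>i\<in>I. mu (S i))"
    using insert by (intro insert.IH) (auto simp: disjoint_family_on_def)
  finally show ?case using insert by simp
qed simp

lemma borel_measurable_frac [measurable]: "(frac :: real \<Rightarrow> real) \<in> borel_measurable borel"
  unfolding frac_def by measurable

lemma mu_frac_less:
  assumes "0 \<le> r" "r \<le> 1" shows "mu {x. frac (x + b) < r} = r"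
proof -
  have "mu {x. frac x < r} = r"
  proof -
    have "{x. frac x < r} \<inter> {0..<1} = {0..<r}" using assms by (auto simp: frac_eq)
    then show ?thesis unfolding mu_def using assms by simp
  qed
  moreover have "mu ((\<lambda>x. x + b) -` {x. frac x < r}) = mu {x. frac x < r}"
    by (rule mu_translate) (auto simp: periodic_set_def frac_1_eq)
  ultimately show ?thesis by (simp add: vimage_def)
qed

text \<open>A move of \<open>x\<close> by at most \<open>a\<close> does not cross an integer, where
  \<open>frac\<close> jumps. The right end is excluded because \<open>frac\<close> stays strictly
  below 1.\<close>

definition safe :: "real \<Rightarrow> real \<Rightarrow> bool" where
  "safe a x \<longleftrightarrow> a \<le> frac x \<and> frac x < 1 - a"

lemma frac_add_safe:
  assumes "safe a x" "\<bar>u\<bar> \<le> a" shows "frac (x + u) = frac x + u"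
  using assms unfolding safe_def by (subst frac_unique_iff) (auto simp: frac_def)

lemma mu_not_safe:
  assumes "0 \<le> a" shows "mu {x. \<not> safe a (x + b)} \<le> 2 * a"
proof (cases "a \<le> 1")
  case True
  have "mu {x. \<not> safe a x} \<le> 2 * a"
  proof -
    have "{x. \<not> safe a x} \<inter> {0..<1} \<subseteq> {0..<a} \<union> {1-a..<1}" by (auto simp: safe_def)
    moreover have F: "{0..<a} \<in> fmeasurable lborel" "{1-a..<1} \<in> fmeasurable lborel"
      using assms True by (auto intro!: fmeasurableI)
    ultimately have "mu {x. \<not> safe a x} \<le> measure lborel ({0..<a} \<union> {1-a..<1})"
      unfolding mu_def safe_def by (intro measure_mono_fmeasurable) (use F in \<open>auto intro: fmeasurable.Un\<close>)
    also have "\<dots> \<le> measure lborel {0..<a} + measure lborel {1-a..<1}"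
      by (rule measure_Un_le) auto
    finally show ?thesis using assms True by simp
  qed
  moreover have "mu ((\<lambda>x. x + b) -` {x. \<not> safe a x}) = mu {x. \<not> safe a x}"
    unfolding safe_def by (rule mu_translate) (auto simp: periodic_set_def frac_1_eq)
  ultimately show ?thesis by (simp add: vimage_def)
next
  case False
  have "mu {x. \<not> safe a (x + b)} \<le> 1" unfolding safe_def by (rule mu_le_1) measurable
  then show ?thesis using False by simp
qed

lemma AE_periodic:
  assumes S: "S \<in> sets borel" and p: "periodic_set S" and 0: "mu S = 0"
  shows "AE x in lborel. x \<notin> S"
proof (rule AE_I')
  have null: "S \<inter> {of_int n..<of_int n + 1} \<in> null_sets lborel" for n :: int
  proof -
    have "(\<lambda>x. x + of_int n) -` (S \<inter> {of_int n..<of_int n + 1}) = S \<inter> {0..<1}"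
      using periodic_set_int[OF p] by auto
    then have "emeasure lborel (S \<inter> {of_int n..<of_int n + 1}) = emeasure lborel (S \<inter> {0..<1})"
      using emeasure_lborel_translate[of "S \<inter> {of_int n..<of_int n + 1}" "of_int n"] S by auto
    then show ?thesis using emeasure_unit[OF S] 0 S by auto
  qed
  show "(\<Union>n::int. S \<inter> {of_int n..<of_int n + 1}) \<in> null_sets lborel"
    by (rule null_sets_UN) (use null in auto)
  have "x \<in> (\<Union>n::int. S \<inter> {of_int n..<of_int n + 1})" if "x \<in> S" for x
    by (rule UN_I[of "\<lfloor>x\<rfloor>"]) (use that in auto)
  then show "{x \<in> space lborel. \<not> x \<notin> S} \<subseteq> (\<Union>n::int. S \<inter> {of_int n..<of_int n + 1})"
    by blast
qed

section \<open>Continuity of translations in measure and ergodicity of the rotation\<close>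

lemma borel_vimage:
  assumes "f \<in> borel_measurable borel" "S \<in> sets borel" shows "f -` S \<in> sets borel"
  using measurable_sets_borel[OF assms] by simp

lemma borel_translate_out:
  fixes t :: real assumes "S \<in> sets borel" shows "{x \<in> S. x + t \<notin> S} \<in> sets borel"
proof -
  have "{x \<in> S. x + t \<notin> S} = S - (\<lambda>x. x + t) -` S" by auto
  then show ?thesis using borel_vimage[of "\<lambda>x. x + t" S] assms by auto
qed

text \<open>Regularity of Lebesgue measure: a compact subset of \<open>S\<close> stays inside an open
  superset of \<open>S\<close> under small translations.\<close>
lemma mu_small_translate:
  assumes S: "S \<in> sets borel" and e: "e > 0"
  shows "\<exists>\<tau>>0. \<forall>t. \<bar>t\<bar> < \<tau> \<longrightarrow> mu {x \<in> S. x + t \<notin> S} < e"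
proof -
  let ?S0 = "S \<inter> {0..<1}" and ?S1 = "S \<inter> {-1..2}"
  obtain K where K: "closed K" "K \<subseteq> ?S0" "?S0 - K \<in> lmeasurable" "emeasure lebesgue (?S0 - K) < ennreal (e/2)"
    using sets_lebesgue_inner_closed[of ?S0 "e/2"] S e by auto
  obtain U where U: "open U" "?S1 \<subseteq> U" "U - ?S1 \<in> lmeasurable" "emeasure lebesgue (U - ?S1) < ennreal (e/2)"
    using sets_lebesgue_outer_open[of ?S1 "e/2"] S e by auto
  have bK: "K \<in> sets borel" "U \<in> sets borel" using K U by auto
  have "K \<subseteq> {0..1}" using K(2) by auto
  then have "bounded K" using bounded_subset[of "{0..1::real}" K] by simp
  then have "compact K" using K(1) compact_eq_bounded_closed by blast
  moreover have "K \<subseteq> U"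
  proof -
    have "?S0 \<subseteq> ?S1" by auto
    then show ?thesis using K(2) U(2) by blast
  qed
  ultimately obtain d where d0: "d > 0" "(\<Union>x\<in>K. ball x d) \<subseteq> U"
    using compact_subset_open_imp_ball_epsilon_subset[of K U] U(1) by blast
  have d: "d > 0" "y \<in> U" if "x \<in> K" "dist x y < d" for x y
    using d0(1) subsetD[OF d0(2), of y] that by (auto intro: UN_I)
  have main: "mu {x \<in> S. x + t \<notin> S} < e" if t: "\<bar>t\<bar> < min d 1" for t
  proof -
    let ?V = "(\<lambda>x. x + t) -` (U - ?S1)"
    have "{x \<in> S. x + t \<notin> S} \<inter> {0..<1} \<subseteq> (?S0 - K) \<union> ?V"
    proof
      fix x assume x: "x \<in> {x \<in> S. x + t \<notin> S} \<inter> {0..<1}"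
      have "x + t \<in> U" if "x \<in> K" using d(2)[OF that, of "x + t"] t by (simp add: dist_real_def)
      then show "x \<in> (?S0 - K) \<union> ?V" using x by blast
    qed
    moreover have bV: "?V \<in> sets borel" "{x \<in> S. x + t \<notin> S} \<in> sets borel"
      using bK S by (auto intro!: borel_vimage borel_translate_out)
    ultimately have "emeasure lborel ({x \<in> S. x + t \<notin> S} \<inter> {0..<1}) \<le> emeasure lborel ((?S0 - K) \<union> ?V)"
      by (intro emeasure_mono) (use S bK in auto)
    also have "\<dots> \<le> emeasure lborel (?S0 - K) + emeasure lborel ?V"
      using S bK bV by (intro emeasure_subadditive) auto
    also have "emeasure lborel ?V = emeasure lborel (U - ?S1)"
      using S bK by (intro emeasure_lborel_translate) auto
    also have "emeasure lborel (?S0 - K) + emeasure lborel (U - ?S1) < ennreal (e/2) + ennreal (e/2)"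
      using K(4) U(4) S bK by (intro add_strict_mono) auto
    also have "\<dots> = ennreal e" using e by (simp flip: ennreal_plus)
    finally show ?thesis using emeasure_unit[OF bV(2)] e by (simp add: ennreal_less_iff mu_nonneg)
  qed
  show ?thesis using main d0(1) by (intro exI[of _ "min d 1"]) auto
qed

lemma mu_large_values:
  fixes f :: "real \<Rightarrow> real"
  assumes f [measurable]: "f \<in> borel_measurable borel" and e: "e > 0"
  shows "\<exists>n::nat. mu {x. \<bar>f x\<bar> \<ge> real n} < e"
proof -
  let ?A = "\<lambda>n::nat. {x. \<bar>f x\<bar> \<ge> real n} \<inter> {0..<1}"
  have "(\<lambda>n. measure lborel (?A n)) \<longlonglongrightarrow> measure lborel (\<Inter>n. ?A n)"
  proof (rule Lim_measure_decseq)
    show "range ?A \<subseteq> sets lborel" by auto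
    show "decseq ?A" by (auto simp: decseq_def)
    show "emeasure lborel (?A n) \<noteq> \<infinity>" for n
      using emeasure_unit[of "{x. \<bar>f x\<bar> \<ge> real n}"] by simp
  qed
  moreover have "(\<Inter>n. ?A n) = {}"
  proof -
    have "\<exists>n::nat. \<bar>f x\<bar> < real n" for x by (rule reals_Archimedean2)
    then have "\<exists>n::nat. x \<notin> ?A n" for x by (metis (mono_tags, lifting) Int_iff mem_Collect_eq not_le)
    then show ?thesis by blast
  qed
  ultimately have "(\<lambda>n. measure lborel (?A n)) \<longlonglongrightarrow> 0" by simp
  then have "eventually (\<lambda>n. measure lborel (?A n) < e) sequentially"
    using e by (rule order_tendstoD)
  then show ?thesis unfolding mu_def by (auto simp: eventually_sequentially)
qed

text \<open>A change of \<open>f\<close> by more than \<open>r\<close> changes the integer part of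
  \<open>f x / r\<close>. Outside a small set of large values only finitely many integer parts
  occur, and each of their level sets is almost preserved by small translations.\<close>

lemma mu_small_translate_fun:
  fixes f :: "real \<Rightarrow> real"
  assumes f [measurable]: "f \<in> borel_measurable borel" and e: "e > 0" and r: "r > 0"
  shows "\<exists>\<tau>>0. \<forall>t. \<bar>t\<bar> < \<tau> \<longrightarrow> mu {x. \<bar>f (x + t) - f x\<bar> > r} < e"
proof -
  obtain n :: nat where n: "mu {x. \<bar>f x / r\<bar> \<ge> real n} < e / 2"
    using mu_large_values[of "\<lambda>x. f x / r" "e/2"] e by auto
  define I where "I = {- int n - 1..int n}"
  define S where "S k = {x. \<lfloor>f x / r\<rfloor> = k}" for k
  have S [measurable]: "S k \<in> sets borel" for k unfolding S_def by measurable
  define c where "c = e / (2 * real (card I))"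
  have I: "finite I" "card I > 0" unfolding I_def by auto
  have c: "c > 0" using e I unfolding c_def by simp
  have "\<exists>\<tau>>0. \<forall>t. \<bar>t\<bar> < \<tau> \<longrightarrow> mu {x \<in> S k. x + t \<notin> S k} < c" for k
    using mu_small_translate[OF S c] by blast
  then obtain \<tau> where \<tau>: "\<And>k. \<tau> k > 0" "\<And>k t. \<bar>t\<bar> < \<tau> k \<Longrightarrow> mu {x \<in> S k. x + t \<notin> S k} < c"
    by metis
  have "mu {x. \<bar>f (x + t) - f x\<bar> > r} < e" if t: "\<bar>t\<bar> < Min (\<tau> ` I)" for t
  proof -
    have [measurable]: "{x \<in> S k. x + t \<notin> S k} \<in> sets borel" for k by (rule borel_translate_out[OF S])
    have sub: "{x. \<bar>f (x + t) - f x\<bar> > r} \<subseteq> {x. \<bar>f x / r\<bar> \<ge> real n} \<union> (\<Union>k\<in>I. {x \<in> S k. x + t \<notin> S k})"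
    proof
      fix x assume x: "x \<in> {x. \<bar>f (x + t) - f x\<bar> > r}"
      show "x \<in> {x. \<bar>f x / r\<bar> \<ge> real n} \<union> (\<Union>k\<in>I. {x \<in> S k. x + t \<notin> S k})"
      proof (cases "\<bar>f x / r\<bar> \<ge> real n")
        case False
        then have "\<lfloor>f x / r\<rfloor> \<in> I" unfolding I_def atLeastAtMost_iff
          by (intro conjI) linarith+
        moreover have "\<lfloor>f (x + t) / r\<rfloor> \<noteq> \<lfloor>f x / r\<rfloor>"
        proof
          assume "\<lfloor>f (x + t) / r\<rfloor> = \<lfloor>f x / r\<rfloor>"
          then have "\<bar>f (x + t) / r - f x / r\<bar> < 1" by linarith
          then have "\<bar>f (x + t) - f x\<bar> < r" using r by (simp add: diff_divide_distrib[symmetric] field_simps)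
          then show False using x by simp
        qed
        ultimately show ?thesis unfolding S_def by auto
      qed auto
    qed
    have "mu {x. \<bar>f (x + t) - f x\<bar> > r}
        \<le> mu ({x. \<bar>f x / r\<bar> \<ge> real n} \<union> (\<Union>k\<in>I. {x \<in> S k. x + t \<notin> S k}))"
      by (rule mu_mono[OF sub]) (use I in measurable)
    also have "\<dots> \<le> mu {x. \<bar>f x / r\<bar> \<ge> real n} + mu (\<Union>k\<in>I. {x \<in> S k. x + t \<notin> S k})"
      by (rule mu_Un_le) (use I in measurable)
    also have "mu (\<Union>k\<in>I. {x \<in> S k. x + t \<notin> S k}) \<le> (\<Sum>k\<in>I. mu {x \<in> S k. x + t \<notin> S k})"
      by (rule mu_UN_le) (use I in auto)
    also have "\<dots> \<le> (\<Sum>k\<in>I. c)"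
    proof (rule sum_mono)
      fix k assume "k \<in> I"
      then have "Min (\<tau> ` I) \<le> \<tau> k" using I by simp
      then show "mu {x \<in> S k. x + t \<notin> S k} \<le> c" using \<tau>(2)[of t k] t by linarith
    qed
    also have "\<dots> = e / 2" using I(2) unfolding c_def by (auto simp: field_simps card_gt_0_iff)
    finally show ?thesis using n by simp
  qed
  moreover have "Min (\<tau> ` I) > 0" using I \<tau>(1) by (auto simp: card_gt_0_iff)
  ultimately show ?thesis by blast
qed

text \<open>Fubini for the indicator of the pairs (x, t) with x in \<open>S\<close> and x + t
  outside \<open>S\<close>: integrating over x first gives 0, integrating over t first gives the
  product of the measures of \<open>S\<close> and of its complement.\<close>

lemma mu_zero_one_if_translates:
  assumes S [measurable]: "S \<in> sets borel" and p: "periodic_set S"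
    and 0: "\<And>t. mu {x \<in> S. x + t \<notin> S} = 0"
  shows "mu S = 0 \<or> mu S = 1"
proof -
  let ?U = "restrict_space lborel {0..<1::real}"
  have sp: "space ?U = {0..<1}" by (simp add: space_restrict_space)
  have em: "emeasure ?U (A \<inter> {0..<1}) = emeasure lborel (A \<inter> {0..<1})" for A
    by (subst emeasure_restrict_space) auto
  have sU: "A \<inter> {0..<1} \<in> sets ?U" if "A \<in> sets borel" for A
    using that by (simp add: sets_restrict_space_iff)
  interpret U: finite_measure ?U
    by (rule finite_measureI) (simp add: emeasure_restrict_space space_restrict_space)
  interpret UU: pair_sigma_finite ?U ?U ..
  have [measurable]: "(\<lambda>x. x) \<in> ?U \<rightarrow>\<^sub>M borel" by (rule measurable_restrict_space1) simp
  let ?f = "\<lambda>(x, t). indicator S x * indicator (- S) (x + t) :: ennreal"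
  have [measurable]: "fst \<in> ?U \<Otimes>\<^sub>M ?U \<rightarrow>\<^sub>M borel" "snd \<in> ?U \<Otimes>\<^sub>M ?U \<rightarrow>\<^sub>M borel"
    using measurable_compose[OF measurable_fst, of "\<lambda>x. x" ?U borel ?U]
      measurable_compose[OF measurable_snd, of "\<lambda>x. x" ?U borel ?U] by simp_all
  have fm: "?f \<in> borel_measurable (?U \<Otimes>\<^sub>M ?U)"
    unfolding case_prod_beta' by measurable
  have mS: "{x \<in> S. x + t \<notin> S} \<in> sets borel" for t by (rule borel_translate_out[OF S])
  have 1: "(\<integral>\<^sup>+ x. ?f (x, t) \<partial>?U) = 0" for t
  proof -
    have "(\<integral>\<^sup>+ x. ?f (x, t) \<partial>?U) = (\<integral>\<^sup>+ x. indicator {x \<in> S. x + t \<notin> S} x \<partial>?U)"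
      by (rule nn_integral_cong) (auto split: split_indicator)
    also have "\<dots> = (\<integral>\<^sup>+ x. indicator ({x \<in> S. x + t \<notin> S} \<inter> {0..<1}) x \<partial>?U)"
      by (rule nn_integral_cong) (auto simp: sp split: split_indicator)
    also have "\<dots> = emeasure ?U ({x \<in> S. x + t \<notin> S} \<inter> {0..<1})"
      by (rule nn_integral_indicator[OF sU[OF mS]])
    also have "\<dots> = 0" unfolding em using emeasure_unit[OF mS] 0 by simp
    finally show ?thesis .
  qed
  have 2: "(\<integral>\<^sup>+ t. ?f (x, t) \<partial>?U) = indicator S x * emeasure lborel (- S \<inter> {0..<1})" for x
  proof -
    have "(\<integral>\<^sup>+ t. ?f (x, t) \<partial>?U) = (\<integral>\<^sup>+ t. indicator S x * indicator ((\<lambda>t. t + x) -` (- S) \<inter> {0..<1}) t \<partial>?U)"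
      by (rule nn_integral_cong) (auto simp: sp add.commute split: split_indicator)
    also have "\<dots> = indicator S x * emeasure ?U ((\<lambda>t. t + x) -` (- S) \<inter> {0..<1})"
      by (intro nn_integral_cmult_indicator sU borel_vimage) auto
    also have "emeasure ?U ((\<lambda>t. t + x) -` (- S) \<inter> {0..<1}) = emeasure lborel (- S \<inter> {0..<1})"
      unfolding em using p by (intro emeasure_periodic_translate) (auto simp: periodic_set_def)
    finally show ?thesis .
  qed
  have "(\<integral>\<^sup>+ x. \<integral>\<^sup>+ t. ?f (x, t) \<partial>?U \<partial>?U) = (\<integral>\<^sup>+ t. \<integral>\<^sup>+ x. ?f (x, t) \<partial>?U \<partial>?U)"
    using UU.Fubini[OF fm] by simp
  then have "(\<integral>\<^sup>+ x. indicator S x * emeasure lborel (- S \<inter> {0..<1}) \<partial>?U) = 0"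
    unfolding 1 2 by simp
  moreover have "(\<integral>\<^sup>+ x. indicator S x * emeasure lborel (- S \<inter> {0..<1}) \<partial>?U)
    = (\<integral>\<^sup>+ x. emeasure lborel (- S \<inter> {0..<1}) * indicator (S \<inter> {0..<1}) x \<partial>?U)"
    by (rule nn_integral_cong) (auto simp: sp split: split_indicator)
  moreover have "\<dots> = emeasure lborel (- S \<inter> {0..<1}) * emeasure ?U (S \<inter> {0..<1})"
    by (intro nn_integral_cmult_indicator sU S)
  ultimately have "emeasure lborel (- S \<inter> {0..<1}) = 0 \<or> emeasure lborel (S \<inter> {0..<1}) = 0"
    unfolding em by auto
  then have "mu (- S) = 0 \<or> mu S = 0"
    unfolding mu_def measure_def by auto
  then show ?thesis using mu_Compl[OF S] by auto
qed

text \<open>Multiples of \<open>\<alpha>\<close> are dense mod 1, so every translation equals an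
  invariant one followed by an arbitrarily small one; small translations hardly move
  \<open>S\<close>.\<close>

lemma rotation_zero_one:
  assumes S [measurable]: "S \<in> sets borel" and p: "periodic_set S" and \<alpha>: "\<alpha> \<notin> \<rat>"
    and inv: "\<And>x. x + \<alpha> \<in> S \<longleftrightarrow> x \<in> S"
  shows "mu S = 0 \<or> mu S = 1"
proof (rule mu_zero_one_if_translates[OF S p])
  fix t
  have invk: "x + of_nat k * \<alpha> \<in> S \<longleftrightarrow> x \<in> S" for x and k :: nat
  proof (induction k)
    case (Suc k)
    then show ?case using inv[of "x + of_nat k * \<alpha>"] by (simp add: algebra_simps)
  qed simp
  have "mu {x \<in> S. x + t \<notin> S} < e" if e: "e > 0" for e
  proof -
    obtain \<tau> where \<tau>: "\<tau> > 0" "\<And>s. \<bar>s\<bar> < \<tau> \<Longrightarrow> mu {x \<in> S. x + s \<notin> S} < e"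
      using mu_small_translate[OF S e] by blast
    obtain h :: int and k :: int where k: "k > 0" "\<bar>of_int k * \<alpha> - of_int h - t\<bar> < \<tau>"
      using sequence_of_fractional_parts_is_dense[OF \<alpha> \<tau>(1)] by blast
    define s where "s = t - (of_int k * \<alpha> - of_int h)"
    have "x + t \<in> S \<longleftrightarrow> x + s \<in> S" for x
    proof -
      have "x + t = (x + s) + of_nat (nat k) * \<alpha> + of_int (- h)" using k(1) unfolding s_def by simp
      then show ?thesis using periodic_set_int[OF p] invk by metis
    qed
    then show ?thesis using \<tau>(2)[of s] k(2) unfolding s_def by (simp add: abs_minus_commute)
  qed
  then show "mu {x \<in> S. x + t \<notin> S} = 0"
    using mu_nonneg[of "{x \<in> S. x + t \<notin> S}"] by (metis less_irrefl order_less_le)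
qed

section \<open>Periods of invariant observables\<close>

definition birkhoff_sum :: "(real \<Rightarrow> 'v::comm_monoid_add) \<Rightarrow> real \<Rightarrow> nat \<Rightarrow> real \<Rightarrow> 'v" where
  "birkhoff_sum \<Phi> \<alpha> n x = (\<Sum>i<n. \<Phi> (x + real i * \<alpha>))"

abbreviation psi_sum :: "real \<Rightarrow> nat \<Rightarrow> real \<Rightarrow> real" where
  "psi_sum \<equiv> birkhoff_sum psi"

lemma birkhoff_sum_Suc:
  "birkhoff_sum \<Phi> \<alpha> (Suc n) x = birkhoff_sum \<Phi> \<alpha> n x + \<Phi> (x + real n * \<alpha>)"
  by (simp add: birkhoff_sum_def)

lemma dense_sequence:
  obtains d :: "nat \<Rightarrow> 'v::euclidean_space" where "\<And>w e. e > 0 \<Longrightarrow> \<exists>i. dist w (d i) < e"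
proof -
  obtain D :: "'v set" where D: "countable D" "\<And>X. open X \<Longrightarrow> X \<noteq> {} \<Longrightarrow> \<exists>d\<in>D. d \<in> X"
    using countable_dense_setE by blast
  have "D \<noteq> {}" using D(2)[of UNIV] by auto
  have "\<exists>i. dist w (from_nat_into D i) < e" if "e > 0" for w e
  proof -
    have "ball w e \<noteq> {}" using that by simp
    then obtain x where "x \<in> D" "x \<in> ball w e" using D(2)[OF open_ball] by blast
    then show ?thesis using from_nat_into_surj[OF D(1)] by (metis mem_ball)
  qed
  then show ?thesis using that by blast
qed

text \<open>Invariance is required at every \<open>x\<close>, so that it iterates along orbits
  without exceptional sets. The Lipschitz constant does not depend on \<open>x\<close>; it reduces
  questions about all \<open>w\<close> to a dense sequence or a finite net.\<close>

locale invariant_observable =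
  fixes \<alpha> :: real and \<Phi> :: "real \<Rightarrow> 'v::euclidean_space" and g :: "real \<Rightarrow> 'v \<Rightarrow> real" and L :: real
  assumes irrational: "\<alpha> \<notin> \<rat>"
    and periodic: "g (x + 1) w = g x w"
    and invariant: "g (x + \<alpha>) (w + \<Phi> x) = g x w"
    and measurable_g: "(\<lambda>x. g x w) \<in> borel_measurable borel"
    and L_pos: "L > 0"
    and lipschitz: "\<bar>g x w - g x w'\<bar> \<le> L * dist w w'"
begin

lemmas [measurable] = measurable_g

definition period :: "'v \<Rightarrow> bool" where
  "period v \<longleftrightarrow> (AE x in lborel. \<forall>w. g x (w + v) = g x w)"

lemma periodic_int: "g (x + of_int n) w = g x w"
proof -
  have "periodic_set {x. g x w = c}" for c unfolding periodic_set_def by (simp add: periodic)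
  from periodic_set_int[OF this, of x n "g x w"] show ?thesis by simp
qed

lemma invariant_iterate: "g (x + real n * \<alpha>) (w + birkhoff_sum \<Phi> \<alpha> n x) = g x w"
proof (induction n)
  case 0
  then show ?case by (simp add: birkhoff_sum_def)
next
  case (Suc n)
  have "g (x + real n * \<alpha> + \<alpha>) (w + birkhoff_sum \<Phi> \<alpha> n x + \<Phi> (x + real n * \<alpha>)) = g x w"
    using Suc invariant by simp
  then show ?case by (simp add: birkhoff_sum_Suc algebra_simps)
qed

lemma invariant_iterate': "g (x + real n * \<alpha>) w = g x (w - birkhoff_sum \<Phi> \<alpha> n x)"
  using invariant_iterate[of x n "w - birkhoff_sum \<Phi> \<alpha> n x"] by simp

lemma period_0: "period 0"
  unfolding period_def by simp

lemma period_add: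
  assumes "period v" "period v'" shows "period (v + v')"
  using assms unfolding period_def by eventually_elim (simp flip: add.assoc)

lemma period_minus:
  assumes "period v" shows "period (- v)"
  using assms unfolding period_def
proof eventually_elim
  case (elim x)
  show ?case
  proof
    fix w show "g x (w + - v) = g x w" using spec[OF elim, of "w - v"] by simp
  qed
qed

lemma period_diff: "period v \<Longrightarrow> period v' \<Longrightarrow> period (v - v')"
  using period_add[OF _ period_minus] by simp

lemma period_scale_nat: "period v \<Longrightarrow> period (real n *\<^sub>R v)"
  by (induction n) (auto simp: period_0 period_add scaleR_add_left)

lemma period_scale_int: "period v \<Longrightarrow> period (of_int n *\<^sub>R v)"
  by (cases n) (auto simp: period_scale_nat simp del: of_nat_Suc intro: period_minus)

lemma dense_imp_all:
  assumes d: "\<And>w e. e > 0 \<Longrightarrow> \<exists>i. dist w (d i) < e" and eq: "\<And>i::nat. g x (d i + v) = g x (d i)"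
  shows "g x (w + v) = g x w"
proof (rule ccontr)
  assume "g x (w + v) \<noteq> g x w"
  then have e: "\<bar>g x (w + v) - g x w\<bar> / (2 * L) > 0" using L_pos by simp
  obtain i where i: "dist w (d i) < \<bar>g x (w + v) - g x w\<bar> / (2 * L)" using d[OF e] by blast
  have "\<bar>g x (w + v) - g x w\<bar> \<le> L * dist (w + v) (d i + v) + L * dist w (d i)"
    using lipschitz[of x "w + v" "d i + v"] lipschitz[of x w "d i"] eq[of i] by linarith
  also have "\<dots> = 2 * L * dist w (d i)" by (simp add: dist_norm)
  also have "\<dots> < \<bar>g x (w + v) - g x w\<bar>" using i L_pos by (simp add: field_simps)
  finally show False by simp
qed

text \<open>The set of \<open>x\<close> at which \<open>v\<close> fails to be a period of \<open>g x\<close> is invariant under the rotation, so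
  it suffices to refute its having full measure.\<close>
lemma period_if_approx:
  assumes c: "c > 0"
    and approx: "\<And>M \<eta>. \<eta> > 0 \<Longrightarrow> \<exists>Y. Y \<in> sets borel \<and> mu Y \<ge> c \<and>
       (\<forall>x\<in>Y. \<forall>w. norm w \<le> M \<longrightarrow> \<bar>g x (w + v) - g x w\<bar> \<le> \<eta>)"
  shows "period v"
proof -
  obtain d :: "nat \<Rightarrow> 'v" where d: "\<And>w e. e > 0 \<Longrightarrow> \<exists>i. dist w (d i) < e"
    using dense_sequence by blast
  define X where "X = {x. \<exists>w. g x (w + v) \<noteq> g x w}"
  have X_eq: "X = (\<Union>i. {x. g x (d i + v) \<noteq> g x (d i)})"
    unfolding X_def using dense_imp_all[OF d] by blast
  have X [measurable]: "X \<in> sets borel" unfolding X_eq by measurable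
  have pX: "periodic_set X" unfolding periodic_set_def X_def by (simp add: periodic)
  have "x + \<alpha> \<in> X \<longleftrightarrow> x \<in> X" for x
  proof -
    have "g (x + \<alpha>) (w + v) \<noteq> g (x + \<alpha>) w \<longleftrightarrow> g x (w - \<Phi> x + v) \<noteq> g x (w - \<Phi> x)" for w
      using invariant[of x "w - \<Phi> x"] invariant[of x "w - \<Phi> x + v"] by (simp add: algebra_simps)
    then show ?thesis unfolding X_def mem_Collect_eq by (metis add_diff_cancel_right')
  qed
  then have "mu X = 0 \<or> mu X = 1"
    using rotation_zero_one[OF X pX irrational] by blast
  moreover have "mu X \<noteq> 1"
  proof
    assume X1: "mu X = 1"
    \<comment> \<open>Approximate periodicity on \<open>Y\<close> contradicts only a failure by a
      definite amount at one of finitely many points. \<open>X\<close> is exhausted by such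
      failures, so one of these sets has measure above \<open>1 - c\<close> and must meet
      \<open>Y\<close>.\<close>
    define XN where "XN n = {x. \<exists>i<Suc n. \<bar>g x (d i + v) - g x (d i)\<bar> > 1 / real (Suc n)}" for n
    have XN [measurable]: "XN n \<in> sets borel" for n unfolding XN_def by measurable
    have "incseq XN"
    proof (rule incseq_SucI, rule subsetI)
      fix n x assume "x \<in> XN n"
      then obtain i where i: "i < Suc n" "\<bar>g x (d i + v) - g x (d i)\<bar> > 1 / real (Suc n)"
        unfolding XN_def by blast
      have "1 / real (Suc (Suc n)) \<le> 1 / real (Suc n)" by (simp add: field_simps)
      then show "x \<in> XN (Suc n)" using i unfolding XN_def by (auto intro!: exI[of _ i])
    qed
    moreover have "(\<Union>n. XN n) = X"
    proof -
      have "x \<in> (\<Union>n. XN n)" if "g x (d i + v) \<noteq> g x (d i)" for x i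
      proof -
        have "\<bar>g x (d i + v) - g x (d i)\<bar> > 0" using that by simp
        then obtain m where m: "1 / real (Suc m) < \<bar>g x (d i + v) - g x (d i)\<bar>"
          using reals_Archimedean by (metis inverse_eq_divide)
        have "1 / real (Suc (max m i)) \<le> 1 / real (Suc m)" by (simp add: field_simps)
        then have "x \<in> XN (max m i)" using m unfolding XN_def by (auto intro!: exI[of _ i])
        then show ?thesis by blast
      qed
      moreover have "x \<in> X" if "x \<in> XN n" for x n
      proof -
        obtain i where "1 / real (Suc n) < \<bar>g x (d i + v) - g x (d i)\<bar>"
          using \<open>x \<in> XN n\<close> unfolding XN_def by blast
        moreover have "0 < 1 / real (Suc n)" by simp
        ultimately have "g x (d i + v) \<noteq> g x (d i)" by fastforce
        then show ?thesis unfolding X_def by blast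
      qed
      ultimately show ?thesis unfolding X_eq by blast
    qed
    ultimately have "(\<lambda>n. measure lborel (XN n \<inter> {0..<1})) \<longlonglongrightarrow> measure lborel (X \<inter> {0..<1})"
    proof -
      assume 1: "incseq XN" and 2: "(\<Union>n. XN n) = X"
      have "(\<Union>n. XN n \<inter> {0..<1}) = X \<inter> {0..<1}" using 2 by auto
      moreover have "(\<lambda>n. measure lborel (XN n \<inter> {0..<1})) \<longlonglongrightarrow> measure lborel (\<Union>n. XN n \<inter> {0..<1})"
      proof (rule Lim_measure_incseq)
        show "incseq (\<lambda>n. XN n \<inter> {0..<1})" using 1 by (auto simp: incseq_def)
        show "emeasure lborel (\<Union>n. XN n \<inter> {0..<1}) \<noteq> \<infinity>"
          using emeasure_unit[OF X] calculation by simp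
      qed auto
      ultimately show ?thesis by simp
    qed
    then have "eventually (\<lambda>n. measure lborel (XN n \<inter> {0..<1}) > 1 - c) sequentially"
      using X1 c unfolding mu_def by (intro order_tendstoD) auto
    then obtain n where n: "mu (XN n) > 1 - c"
      unfolding mu_def by (auto simp: eventually_sequentially)
    define M where "M = Max ((\<lambda>i. norm (d i)) ` {..n})"
    have M: "norm (d i) \<le> M" if "i < Suc n" for i
      unfolding M_def using that by (intro Max_ge) auto
    obtain Y where Y: "Y \<in> sets borel" "mu Y \<ge> c"
      "\<And>x w. x \<in> Y \<Longrightarrow> norm w \<le> M \<Longrightarrow> \<bar>g x (w + v) - g x w\<bar> \<le> 1 / real (Suc n)"
      using approx[of "1 / real (Suc n)" M] by auto
    have "XN n \<inter> Y \<noteq> {}" by (rule mu_Int_pos) (use Y n in auto)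
    then obtain x where "x \<in> XN n" "x \<in> Y" by blast
    then show False using Y(3) M unfolding XN_def by fastforce
  qed
  ultimately have "AE x in lborel. x \<notin> X" using AE_periodic[OF X pX] by blast
  then show ?thesis unfolding period_def X_def by simp
qed

text \<open>A finite net of the ball reduces uniformity in \<open>w\<close> to finitely many
  functions of \<open>x\<close>; the bound \<open>\<eta>\<close> is shared by the variation at a net
  point and the two Lipschitz errors.\<close>

lemma small_translate_uniform:
  assumes \<eta>: "\<eta> > 0" and c: "c > 0"
  shows "\<exists>\<tau>>0. \<forall>t. \<bar>t\<bar> < \<tau> \<longrightarrow> (\<exists>B. B \<in> sets borel \<and> periodic_set B \<and> mu B < c \<and>
    (\<forall>x. x \<notin> B \<longrightarrow> (\<forall>w. norm w \<le> M \<longrightarrow> \<bar>g (x + t) w - g x w\<bar> \<le> \<eta>)))"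
proof -
  have "0 < \<eta> / (3 * L)" using \<eta> L_pos by simp
  then have "cball (0::'v) M \<subseteq> (\<Union>x\<in>UNIV. ball x (\<eta> / (3 * L)))"
    by (intro subsetI) (rule UN_I[OF UNIV_I], rule centre_in_ball[THEN iffD2])
  then obtain k where "k \<subseteq> UNIV" and k: "finite k" "cball (0::'v) M \<subseteq> (\<Union>x\<in>k. ball x (\<eta> / (3 * L)))"
    by (rule compactE_image[OF compact_cball open_ball])
  \<comment> \<open>The summand 1 keeps \<open>c'\<close> positive when the net is empty, as it may
    be for negative \<open>M\<close>.\<close>
  define c' where "c' = c / (2 * (real (card k) + 1))"
  have c': "c' > 0" using c unfolding c'_def by simp
  have "\<exists>\<tau>>0. \<forall>t. \<bar>t\<bar> < \<tau> \<longrightarrow> mu {x. \<bar>g (x + t) w - g x w\<bar> > \<eta> / 3} < c'" for w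
    using mu_small_translate_fun[OF measurable_g c', of "\<eta>/3" w] \<eta> by simp
  then obtain \<tau> where \<tau>: "\<And>w. \<tau> w > 0"
    "\<And>w t. \<bar>t\<bar> < \<tau> w \<Longrightarrow> mu {x. \<bar>g (x + t) w - g x w\<bar> > \<eta> / 3} < c'" by metis
  define \<tau>' where "\<tau>' = Min (insert 1 (\<tau> ` k))"
  have "\<tau>' > 0" unfolding \<tau>'_def using k(1) \<tau>(1) by auto
  moreover have "\<exists>B. B \<in> sets borel \<and> periodic_set B \<and> mu B < c \<and>
    (\<forall>x. x \<notin> B \<longrightarrow> (\<forall>w. norm w \<le> M \<longrightarrow> \<bar>g (x + t) w - g x w\<bar> \<le> \<eta>))" if t: "\<bar>t\<bar> < \<tau>'" for t
  proof (intro exI conjI allI impI)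
    let ?B = "\<Union>w\<in>k. {x. \<bar>g (x + t) w - g x w\<bar> > \<eta> / 3}"
    show "?B \<in> sets borel" using k(1) by (intro sets.finite_UN) auto
    show "periodic_set ?B"
    proof -
      have "g (x + 1 + t) w = g (x + t) w" for x w
        using periodic[of "x + t" w] by (simp add: add_ac)
      then show ?thesis unfolding periodic_set_def by (simp add: periodic)
    qed
    have "mu ?B \<le> (\<Sum>w\<in>k. mu {x. \<bar>g (x + t) w - g x w\<bar> > \<eta> / 3})"
      using k(1) by (intro mu_UN_le) auto
    also have "\<dots> \<le> (\<Sum>w\<in>k. c')"
    proof (rule sum_mono)
      fix w assume "w \<in> k"
      then have "\<tau>' \<le> \<tau> w" unfolding \<tau>'_def using k(1) by simp
      then show "mu {x. \<bar>g (x + t) w - g x w\<bar> > \<eta> / 3} \<le> c'" using \<tau>(2)[of t w] t by linarith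
    qed
    also have "\<dots> < c"
    proof -
      have "real (card k) * c < c * (2 * (real (card k) + 1))" using c by (simp add: algebra_simps add_nonneg_pos)
      then show ?thesis unfolding c'_def by (simp add: field_simps)
    qed
    finally show "mu ?B < c" .
    fix x and w :: 'v assume x: "x \<notin> ?B" and w: "norm w \<le> M"
    have "w \<in> cball 0 M" using w by simp
    then obtain u where u: "u \<in> k" "dist u w < \<eta> / (3 * L)" using k(2) by auto
    have "L * dist w u \<le> \<eta> / 3" using u(2) L_pos by (simp add: field_simps dist_commute)
    moreover have "\<bar>g (x + t) u - g x u\<bar> \<le> \<eta> / 3" using x u(1) by auto
    ultimately show "\<bar>g (x + t) w - g x w\<bar> \<le> \<eta>"
      using lipschitz[of "x + t" w u] lipschitz[of x w u] by linarith
  qed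
  ultimately show ?thesis by blast
qed

text \<open>The points \<open>x\<close> and \<open>x + \<rho>\<close> are close at time 0 and still
  close at time \<open>n\<close>, while their sums differ by \<open>v\<close>. Pulling the value at
  time \<open>n\<close> and second argument w + (sum at x) back to time 0 yields
  \<open>g x w\<close> along the first orbit and \<open>g (x + \<rho>) (w + v)\<close> along the
  second. The bound \<open>C\<close> keeps the comparison at time \<open>n\<close> inside a fixed
  ball.\<close>

lemma period_if_difference:
  assumes c: "c > 0"
    and diff: "\<And>\<tau>. \<tau> > 0 \<Longrightarrow> \<exists>n \<rho> Y. \<bar>\<rho>\<bar> < \<tau> \<and> Y \<in> sets borel \<and> mu Y \<ge> c \<and>
      (\<forall>x\<in>Y. norm (birkhoff_sum \<Phi> \<alpha> n x) \<le> C \<and>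
         birkhoff_sum \<Phi> \<alpha> n x - birkhoff_sum \<Phi> \<alpha> n (x + \<rho>) = v)"
  shows "period v"
proof (rule period_if_approx[of "c/2"], goal_cases)
  case (2 M \<eta>)
  note \<eta> = this
  have "\<eta> / 2 > 0" "c / 4 > 0" using \<eta> c by auto
  from small_translate_uniform[OF this, of "M + C + norm v"] obtain \<tau> where \<tau>: "\<tau> > 0" and
    *: "\<And>t. \<bar>t\<bar> < \<tau> \<Longrightarrow> \<exists>B. B \<in> sets borel \<and> periodic_set B \<and> mu B < c / 4 \<and>
      (\<forall>x. x \<notin> B \<longrightarrow> (\<forall>w. norm w \<le> M + C + norm v \<longrightarrow> \<bar>g (x + t) w - g x w\<bar> \<le> \<eta> / 2))"
    by blast
  obtain n \<rho> Y where Y: "\<bar>\<rho>\<bar> < \<tau>" "Y \<in> sets borel" "mu Y \<ge> c"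
    "\<And>x. x \<in> Y \<Longrightarrow> norm (birkhoff_sum \<Phi> \<alpha> n x) \<le> C"
    "\<And>x. x \<in> Y \<Longrightarrow> birkhoff_sum \<Phi> \<alpha> n x - birkhoff_sum \<Phi> \<alpha> n (x + \<rho>) = v"
    using diff[OF \<tau>] by blast
  obtain B where B: "B \<in> sets borel" "periodic_set B" "mu B < c / 4"
    "\<And>x w. x \<notin> B \<Longrightarrow> norm w \<le> M + C + norm v \<Longrightarrow> \<bar>g (x + \<rho>) w - g x w\<bar> \<le> \<eta> / 2"
    using *[OF Y(1)] by blast
  \<comment> \<open>Translation by \<open>\<rho>\<close> has to be harmless both at \<open>x\<close>
    and at \<open>x + n * \<alpha>\<close>, hence a loss of \<open>c / 4\<close> for each.\<close>
  let ?B' = "(\<lambda>x. x + real n * \<alpha>) -` B"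
  have B': "?B' \<in> sets borel" "mu ?B' < c / 4"
    using borel_vimage[of "\<lambda>x. x + real n * \<alpha>" B] B mu_translate[OF B(1,2)] by auto
  show ?case
  proof (intro exI conjI ballI allI impI)
    show "Y - (B \<union> ?B') \<in> sets borel" using Y B B' by auto
    have "mu (B \<union> ?B') \<le> c / 2" using mu_Un_le[OF B(1) B'(1)] B(3) B'(2) by linarith
    then show "c / 2 \<le> mu (Y - (B \<union> ?B'))"
      using mu_Diff_ge[of Y "B \<union> ?B'"] Y B B' by fastforce
    fix x and w :: 'v assume x: "x \<in> Y - (B \<union> ?B')" and w: "norm w \<le> M"
    let ?S = "birkhoff_sum \<Phi> \<alpha> n x"
    have S': "birkhoff_sum \<Phi> \<alpha> n (x + \<rho>) = ?S - v" using Y(5)[of x] x by (simp add: algebra_simps)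
    have S: "norm ?S \<le> C" using Y(4) x by blast
    have "norm (w + ?S) \<le> M + C + norm v" using norm_triangle_ineq[of w ?S] w S by (smt (verit) norm_ge_zero)
    then have "\<bar>g (x + real n * \<alpha> + \<rho>) (w + ?S) - g (x + real n * \<alpha>) (w + ?S)\<bar> \<le> \<eta> / 2"
      using B(4)[of "x + real n * \<alpha>" "w + ?S"] x by auto
    moreover have "g (x + real n * \<alpha>) (w + ?S) = g x w" by (rule invariant_iterate)
    moreover have "g (x + real n * \<alpha> + \<rho>) (w + ?S) = g (x + \<rho>) (w + v)"
    proof -
      have "w + ?S - birkhoff_sum \<Phi> \<alpha> n (x + \<rho>) = w + v" using S' by simp
      moreover have "x + \<rho> + real n * \<alpha> = x + real n * \<alpha> + \<rho>" by simp
      ultimately show ?thesis using invariant_iterate'[of "x + \<rho>" n "w + ?S"] by metis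
    qed
    moreover have "norm (w + v) \<le> M + C + norm v"
      using norm_triangle_ineq[of w v] w S by (smt (verit) norm_ge_zero)
    then have "\<bar>g (x + \<rho>) (w + v) - g x (w + v)\<bar> \<le> \<eta> / 2"
      using B(4)[of x "w + v"] x by auto
    ultimately show "\<bar>g x (w + v) - g x w\<bar> \<le> \<eta>" by linarith
  qed
qed (use c in auto)

text \<open>At a near return the base point has hardly moved, so the sum itself acts as an
  approximate period. Known periods in \<open>P\<close> may be subtracted however large they are;
  countability gives them a common null set. The sign of \<open>v\<close> may vary with
  \<open>\<tau>\<close>, since an approximate period -v read at \<open>w + v\<close> is one for
  \<open>v\<close>.\<close>

lemma period_if_value:
  assumes c: "c > 0" and P: "countable P" "\<And>p. p \<in> P \<Longrightarrow> period p"
    and val: "\<And>\<tau>. \<tau> > 0 \<Longrightarrow> \<exists>n (m::int) Y. \<bar>real n * \<alpha> - of_int m\<bar> < \<tau> \<and> Y \<in> sets borel \<and> mu Y \<ge> c \<and>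
      ((\<forall>x\<in>Y. \<exists>p\<in>P. dist (birkhoff_sum \<Phi> \<alpha> n x) (v + p) < \<tau>) \<or>
       (\<forall>x\<in>Y. \<exists>p\<in>P. dist (birkhoff_sum \<Phi> \<alpha> n x) (- v + p) < \<tau>))"
  shows "period v"
proof (rule period_if_approx[of "c/2"], goal_cases)
  case (2 M \<eta>)
  note \<eta> = this
  have "AE x in lborel. \<forall>p\<in>P. \<forall>w. g x (w + p) = g x w"
    using P unfolding period_def by (simp add: AE_ball_countable)
  then obtain N where N: "N \<in> null_sets lborel" "\<And>x p w. x \<notin> N \<Longrightarrow> p \<in> P \<Longrightarrow> g x (w + p) = g x w"
    unfolding eventually_ae_filter by auto
  have "\<eta> / 2 > 0" "c / 2 > 0" using \<eta> c by auto
  from small_translate_uniform[OF this, of "M + norm v"] obtain \<tau> where \<tau>: "\<tau> > 0" and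
    *: "\<And>t. \<bar>t\<bar> < \<tau> \<Longrightarrow> \<exists>B. B \<in> sets borel \<and> periodic_set B \<and> mu B < c / 2 \<and>
      (\<forall>x. x \<notin> B \<longrightarrow> (\<forall>w. norm w \<le> M + norm v \<longrightarrow> \<bar>g (x + t) w - g x w\<bar> \<le> \<eta> / 2))"
    by blast
  define \<tau>' where "\<tau>' = min \<tau> (\<eta> / (2 * L))"
  have "\<tau>' > 0" using \<tau> \<eta> L_pos unfolding \<tau>'_def by simp
  from val[OF this] obtain n Y v' and m :: int where Y: "\<bar>real n * \<alpha> - of_int m\<bar> < \<tau>'" "Y \<in> sets borel"
    "mu Y \<ge> c" "v' = v \<or> v' = - v"
    "\<And>x. x \<in> Y \<Longrightarrow> \<exists>p\<in>P. dist (birkhoff_sum \<Phi> \<alpha> n x) (v' + p) < \<tau>'" by metis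
  obtain B where B: "B \<in> sets borel" "mu B < c / 2"
    "\<And>x w. x \<notin> B \<Longrightarrow> norm w \<le> M + norm v \<Longrightarrow> \<bar>g (x + (real n * \<alpha> - of_int m)) w - g x w\<bar> \<le> \<eta> / 2"
    using *[of "real n * \<alpha> - of_int m"] Y(1) unfolding \<tau>'_def by auto
  have Nb: "N \<in> sets borel" "mu N = 0"
  proof -
    show "N \<in> sets borel" using N(1) by auto
    have "N \<inter> {0..<1} \<in> null_sets lborel" using N(1) by (intro null_set_Int2) auto
    then show "mu N = 0" unfolding mu_def measure_def by auto
  qed
  have key: "\<bar>g x (w + v') - g x w\<bar> \<le> \<eta>" if x: "x \<in> Y - (B \<union> N)" and w: "norm (w + v') \<le> M + norm v" for x w
  proof -
    let ?S = "birkhoff_sum \<Phi> \<alpha> n x"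
    let ?y = "x + real n * \<alpha>"
    obtain p where p: "p \<in> P" "dist ?S (v' + p) < \<tau>'" using Y(5) x by blast
    have "g x w = g ?y (w + ?S)" by (rule invariant_iterate[symmetric])
    moreover have "\<bar>g ?y (w + ?S) - g ?y (w + v' + p)\<bar> \<le> L * dist (w + ?S) (w + v' + p)" by (rule lipschitz)
    moreover have "L * dist (w + ?S) (w + v' + p) \<le> \<eta> / 2"
    proof -
      have "dist (w + ?S) (w + v' + p) = dist ?S (v' + p)" by (simp add: dist_norm algebra_simps)
      also have "\<dots> \<le> \<eta> / (2 * L)" using p(2) unfolding \<tau>'_def by simp
      finally show ?thesis using L_pos by (simp add: field_simps)
    qed
    moreover have "g ?y (w + v' + p) = g ?y (w + v')"
      using N(2)[of x p "w + v' - ?S"] x p(1) unfolding invariant_iterate' by (simp add: algebra_simps)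
    moreover have "g ?y (w + v') = g (x + (real n * \<alpha> - of_int m)) (w + v')"
      using periodic_int[of "x + (real n * \<alpha> - of_int m)" m] by (simp add: algebra_simps)
    moreover have "\<bar>g (x + (real n * \<alpha> - of_int m)) (w + v') - g x (w + v')\<bar> \<le> \<eta> / 2"
      using B(3)[of x "w + v'"] x w by auto
    ultimately show ?thesis by linarith
  qed
  show ?case
  proof (intro exI conjI ballI allI impI)
    show "Y - (B \<union> N) \<in> sets borel" using Y B Nb by auto
    have "mu (B \<union> N) \<le> c / 2" using mu_Un_le[OF B(1) Nb(1)] B(2) Nb(2) by linarith
    then show "c / 2 \<le> mu (Y - (B \<union> N))"
      using mu_Diff_ge[of Y "B \<union> N"] Y B Nb by fastforce
    fix x and w :: 'v assume x: "x \<in> Y - (B \<union> N)" and w: "norm w \<le> M"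
    show "\<bar>g x (w + v) - g x w\<bar> \<le> \<eta>"
    proof (cases "v' = v")
      case True
      then show ?thesis using key[OF x, of w] w norm_triangle_ineq[of w v] by simp
    next
      case False
      then have "v' = - v" using Y(4) by blast
      moreover have "norm w \<le> M + norm v" using w norm_ge_zero[of v] by linarith
      ultimately show ?thesis using key[OF x, of "w + v"] by (simp add: abs_minus_commute)
    qed
  qed
qed (use c in auto)

end

section \<open>Record denominators\<close>

definition idist :: "real \<Rightarrow> real" where
  "idist x = \<bar>x - of_int (round x)\<bar>"

lemma idist_le: "idist x \<le> \<bar>x - of_int m\<bar>"
  unfolding idist_def by (rule round_diff_minimal)

lemma idist_nonneg [simp]: "idist x \<ge> 0"
  unfolding idist_def by simp

lemma idist_add_le: "idist (x + y) \<le> idist x + idist y"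
  using idist_le[of "x + y" "round x + round y"] unfolding idist_def by simp

lemma idist_minus [simp]: "idist (- x) = idist x"
  using idist_le[of "- x" "- round x"] idist_le[of x "- round (- x)"] unfolding idist_def by simp

lemma idist_diff_le: "idist (x - y) \<le> idist x + idist y"
  using idist_add_le[of x "- y"] by simp

lemma idist_eq_0: "idist x = 0 \<longleftrightarrow> x \<in> \<int>"
  unfolding idist_def by (metis Ints_of_int abs_0_eq cancel_comm_monoid_add_class.diff_cancel eq_iff_diff_eq_0 Ints_cases round_of_int)

lemma safe_if_less_idist: "a < idist x \<Longrightarrow> safe a x"
  using idist_le[of x "\<lfloor>x\<rfloor>"] idist_le[of x "\<lfloor>x\<rfloor> + 1"] frac_lt_1[of x] frac_ge_0[of x]
  unfolding safe_def frac_def by auto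

text \<open>The sum has period 1/q in \<open>x\<close>. For 0 <= y < 1/q no term wraps around, and
  it equals q y + (q - 1)/2.\<close>

lemma sum_frac_grid:
  fixes q :: nat assumes q: "q > 0"
  shows "\<bar>(\<Sum>j<q. frac (x + real j / real q)) - real q / 2\<bar> \<le> 1"
proof -
  define h where "h x = (\<Sum>j<q. frac (x + real j / real q))" for x
  have "h ((t + 1) / real q) = h (t / real q)" for t
  proof -
    have "h ((t + 1) / real q) = (\<Sum>j<q. frac (t / real q + real (Suc j) / real q))"
      unfolding h_def by (intro sum.cong refl arg_cong[of _ _ frac]) (simp add: add_divide_distrib)
    also have "\<dots> = (\<Sum>j<Suc q. frac (t / real q + real j / real q)) - frac (t / real q)"
      by (subst sum.lessThan_Suc_shift) simp
    also have "\<dots> = h (t / real q)" unfolding h_def using q by (simp add: frac_1_eq)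
    finally show ?thesis .
  qed
  then have "periodic_set {t. h (t / real q) = h x}" unfolding periodic_set_def by simp
  then have "frac (x * real q) \<in> {t. h (t / real q) = h x}" using q by (subst periodic_set_frac) auto
  then have 1: "h x = h (frac (x * real q) / real q)" by simp
  define y where "y = frac (x * real q) / real q"
  have y: "0 \<le> y" "y < 1 / real q"
    unfolding y_def using q frac_lt_1[of "x * real q"] by (auto intro: divide_strict_right_mono)
  have "h y = (\<Sum>j<q. y + real j / real q)" unfolding h_def
  proof (rule sum.cong[OF refl])
    fix j assume "j \<in> {..<q}"
    then have "real j / real q \<le> (real q - 1) / real q" using q by (intro divide_right_mono) auto
    also have "\<dots> = 1 - 1 / real q" using q by (simp add: field_simps)
    finally show "frac (y + real j / real q) = y + real j / real q"
      unfolding frac_eq using y by auto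
  qed
  also have "\<dots> = real q * y + (\<Sum>j<q. real j) / real q"
    by (simp add: sum.distrib sum_divide_distrib)
  also have "(\<Sum>j<q. real j) = real q * (real q - 1) / 2"
    by (induction q) (auto simp: field_simps)
  finally have "h y = real q * y + (real q - 1) / 2" using q by simp
  moreover have "0 \<le> real q * y" "real q * y < 1" using y q by (auto simp: field_simps)
  moreover have "h x = h y" using 1 unfolding y_def .
  moreover have "real q * y + (real q - 1) / 2 - real q / 2 = real q * y - 1 / 2" by (simp add: field_simps)
  ultimately have "\<bar>h x - real q / 2\<bar> \<le> 1" by simp
  then show ?thesis unfolding h_def .
qed

text \<open>Multiplication by \<open>p\<close> permutes the residues mod \<open>q\<close>, so both
  sums run over the same points mod 1.\<close>

lemma sum_frac_coprime_grid:
  fixes q :: nat and p :: int assumes q: "q > 0" and cop: "coprime p (int q)"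
  shows "(\<Sum>i<q. frac (x + real i * of_int p / real q)) = (\<Sum>j<q. frac (x + real j / real q))"
proof -
  define s where "s i = nat ((int i * p) mod int q)" for i
  have s_lt: "s i < q" for i unfolding s_def using q by (simp add: nat_less_iff)
  have "inj_on s {..<q}"
  proof (rule inj_onI)
    fix i j assume ij: "i \<in> {..<q}" "j \<in> {..<q}" and eq: "s i = s j"
    have "(int i * p) mod int q = (int j * p) mod int q" using eq q unfolding s_def
      by (metis Euclidean_Rings.pos_mod_sign int_nat_eq of_nat_0_less_iff)
    then have "int q dvd (int i - int j) * p"
      by (simp add: mod_eq_dvd_iff left_diff_distrib)
    then have "int q dvd int i - int j" using cop
      by (metis coprime_commute coprime_dvd_mult_left_iff)
    then show "i = j" using dvd_imp_le_int[of "int i - int j" "int q"] ij by force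
  qed
  then have "bij_betw s {..<q} {..<q}"
    using s_lt by (intro bij_betw_imageI endo_inj_surj) auto
  then have "(\<Sum>j<q. frac (x + real j / real q)) = (\<Sum>i<q. frac (x + real (s i) / real q))"
    by (rule sum.reindex_bij_betw[symmetric])
  also have "\<dots> = (\<Sum>i<q. frac (x + real i * of_int p / real q))"
  proof (rule sum.cong[OF refl])
    fix i
    have "real (s i) = of_int ((int i * p) mod int q)" unfolding s_def using q by simp
    moreover have "int i * p = int q * (int i * p div int q) + (int i * p) mod int q" by simp
    then have "real i * of_int p = real q * of_int (int i * p div int q) + of_int ((int i * p) mod int q)"
      by (metis of_int_add of_int_mult of_int_of_nat_eq)
    ultimately have "x + real i * of_int p / real q = x + real (s i) / real q + of_int (int i * p div int q)"
      using q by (simp add: field_simps)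
    then show "frac (x + real (s i) / real q) = frac (x + real i * of_int p / real q)"
      using frac_add_of_int_right by metis
  qed
  finally show ?thesis by simp
qed

lemma frac_add_le: "e \<ge> 0 \<Longrightarrow> frac (x + e) \<le> frac x + e"
  unfolding frac_def using floor_mono[of x "x + e"] by simp

text \<open>The determinant \<open>z\<close> of the two nearest fractions is an integer. It is
  nonzero because its two contributions have different sizes, and it is smaller than
  \<open>2 * q * idist (k * \<alpha>)\<close> in absolute value.\<close>

lemma idist_gt_if_worse:
  assumes k: "0 < k" "k < q" and less: "idist (real q * \<alpha>) < idist (real k * \<alpha>)"
  shows "idist (real k * \<alpha>) > 1 / (2 * real q)"
proof -
  let ?p = "\<lambda>k. round (real k * \<alpha>)" and ?d = "\<lambda>k. real k * \<alpha> - of_int (round (real k * \<alpha>))"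
  define z where "z = int k * ?p q - int q * ?p k"
  have z: "of_int z = real q * ?d k - real k * ?d q"
    unfolding z_def by (simp add: algebra_simps)
  have le: "real k * \<bar>?d q\<bar> < real q * \<bar>?d k\<bar>"
  proof -
    have "real k * \<bar>?d q\<bar> \<le> real q * \<bar>?d q\<bar>" using k by (intro mult_right_mono) auto
    also have "\<dots> < real q * \<bar>?d k\<bar>" using less k unfolding idist_def by simp
    finally show ?thesis .
  qed
  have "z \<noteq> 0"
  proof
    assume "z = 0"
    then have "real q * ?d k = real k * ?d q" using z by simp
    then have "\<bar>real q * ?d k\<bar> = \<bar>real k * ?d q\<bar>" by simp
    then have "real q * \<bar>?d k\<bar> = real k * \<bar>?d q\<bar>" by (simp add: abs_mult)
    then show False using le by linarith
  qed
  then have "1 \<le> \<bar>of_int z :: real\<bar>" by linarith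
  also have "\<dots> \<le> \<bar>real q * ?d k\<bar> + \<bar>real k * ?d q\<bar>" unfolding z by linarith
  also have "\<dots> = real q * \<bar>?d k\<bar> + real k * \<bar>?d q\<bar>" by (simp add: abs_mult)
  also have "\<dots> < 2 * (real q * \<bar>?d k\<bar>)" using le by linarith
  finally show ?thesis using k unfolding idist_def by (simp add: field_simps)
qed

locale irrational_rotation =
  fixes \<alpha> :: real
  assumes irrational: "\<alpha> \<notin> \<rat>"
begin

lemma idist_pos:
  assumes "k \<noteq> 0" shows "idist (of_int k * \<alpha>) > 0"
proof -
  have "of_int k * \<alpha> \<notin> \<int>"
  proof
    assume "of_int k * \<alpha> \<in> \<int>"
    then obtain m where "of_int k * \<alpha> = of_int m" by (auto elim: Ints_cases)
    then have "\<alpha> = of_int m / of_int k" using assms by (simp add: field_simps)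
    then show False using irrational by auto
  qed
  then show ?thesis using idist_eq_0[of "of_int k * \<alpha>"] idist_nonneg[of "of_int k * \<alpha>"] by linarith
qed

lemma idist_pos_nat: "k > 0 \<Longrightarrow> idist (real k * \<alpha>) > 0"
  using idist_pos[of "int k"] by simp

lemma dirichlet_idist:
  assumes "N > 0" obtains k :: nat where "0 < k" "k \<le> N" "idist (real k * \<alpha>) < 1 / real N"
proof -
  obtain h k where hk: "0 < k" "k \<le> int N" "\<bar>of_int k * \<alpha> - of_int h\<bar> < 1 / real N"
    using Dirichlet_approx[OF assms, of \<alpha>] by blast
  have "idist (real (nat k) * \<alpha>) < 1 / real N"
    using idist_le[of "real (nat k) * \<alpha>" h] hk by simp
  then show thesis using that[of "nat k"] hk by auto
qed

text \<open>The successive record minima of the distance from \<open>k\<alpha>\<close> to the integers: up to indexing, the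
  denominators of the continued fraction convergents of \<open>\<alpha>\<close>.\<close>
primrec den :: "nat \<Rightarrow> nat" where
  "den 0 = 1"
| "den (Suc n) = (LEAST k. 0 < k \<and> idist (real k * \<alpha>) < idist (real (den n) * \<alpha>))"

abbreviation "rden n \<equiv> real (den n)"

lemma den_Suc_aux:
  assumes "den n > 0"
  shows "den (Suc n) > 0" "idist (rden (Suc n) * \<alpha>) < idist (rden n * \<alpha>)"
proof -
  obtain N where N: "N \<noteq> 0" "inverse (real N) < idist (rden n * \<alpha>)"
    using real_arch_inverse idist_pos_nat[OF assms] by (metis of_nat_0_less_iff)
  then obtain k where "0 < k" "idist (real k * \<alpha>) < 1 / real N"
    using dirichlet_idist[of N] by auto
  then have "0 < k \<and> idist (real k * \<alpha>) < idist (rden n * \<alpha>)" using N by (simp add: inverse_eq_divide)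
  then have "0 < den (Suc n) \<and> idist (rden (Suc n) * \<alpha>) < idist (rden n * \<alpha>)"
    unfolding den.simps by (rule LeastI)
  then show "den (Suc n) > 0" "idist (rden (Suc n) * \<alpha>) < idist (rden n * \<alpha>)" by auto
qed

lemma den_pos: "den n > 0"
  by (induction n) (use den_Suc_aux in auto)

declare den.simps(2) [simp del]

lemma idist_den_decreasing: "idist (rden (Suc n) * \<alpha>) < idist (rden n * \<alpha>)"
  using den_Suc_aux(2)[OF den_pos] .

lemma idist_ge_den:
  assumes "0 < k" "k < den (Suc n)" shows "idist (real k * \<alpha>) \<ge> idist (rden n * \<alpha>)"
  using not_less_Least[OF assms(2)[unfolded den.simps]] assms(1) by auto

lemma idist_gt_den:
  assumes "0 < k" "k < den n" shows "idist (real k * \<alpha>) > idist (rden n * \<alpha>)"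
  using assms idist_ge_den[of k] idist_den_decreasing by (cases n) (auto intro: less_le_trans)

lemma den_less_Suc: "den n < den (Suc n)"
proof (rule ccontr)
  assume "\<not> den n < den (Suc n)"
  then consider "den (Suc n) = den n" | "den (Suc n) < den n" by linarith
  then show False
    using idist_den_decreasing[of n] idist_gt_den[OF den_pos, of "Suc n" n] by cases (auto)
qed

lemma den_less: "m < n \<Longrightarrow> den m < den n"
  using lift_Suc_mono_less[of den] den_less_Suc by blast

lemma den_mono: "m \<le> n \<Longrightarrow> den m \<le> den n"
  using den_less[of m n] by (cases "m = n") auto

lemma den_ge: "n < den n"
proof (induction n)
  case (Suc n)
  then show ?case using den_less_Suc[of n] by linarith
qed simp

lemma idist_den_le: "idist (rden n * \<alpha>) \<le> 1 / rden n"
proof -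
  obtain k where k: "0 < k" "k \<le> den n" "idist (real k * \<alpha>) < 1 / rden n"
    using dirichlet_idist[OF den_pos] by blast
  then show ?thesis using idist_gt_den[of k n] by (cases "k = den n") auto
qed

text \<open>Dirichlet's theorem below \<open>den (Suc n)\<close> produces a multiplier that cannot
  beat the record \<open>den n\<close>; the factor 2 absorbs the step from
  \<open>den (Suc n) - 1\<close> to \<open>den (Suc n)\<close>.\<close>

lemma idist_den_le_Suc: "idist (rden n * \<alpha>) \<le> 2 / rden (Suc n)"
proof -
  have N: "den (Suc n) \<ge> 2" using den_less_Suc[of n] den_pos[of n] by linarith
  then obtain k where k: "0 < k" "k \<le> den (Suc n) - 1" "idist (real k * \<alpha>) < 1 / real (den (Suc n) - 1)"
    using dirichlet_idist[of "den (Suc n) - 1"] by auto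
  have "idist (rden n * \<alpha>) \<le> idist (real k * \<alpha>)" using k N by (intro idist_ge_den) linarith+
  also have "\<dots> \<le> 1 / (rden (Suc n) - 1)" using k(3) N by (simp add: of_nat_diff)
  also have "\<dots> \<le> 2 / rden (Suc n)" using N by (simp add: field_simps)
  finally show ?thesis .
qed

lemma idist_den_gt: "idist (rden n * \<alpha>) > 1 / (2 * rden (Suc n))"
  by (rule idist_gt_if_worse[OF den_pos den_less_Suc idist_den_decreasing])

lemma idist_gt_half_inverse:
  assumes "0 < k" "k < den n" shows "idist (real k * \<alpha>) > 1 / (2 * rden n)"
  using idist_gt_if_worse[OF assms idist_gt_den[OF assms]] .

lemma idist_gt_half_inverse_int:
  assumes "k \<noteq> 0" "\<bar>k\<bar> < int (den n)" shows "idist (of_int k * \<alpha>) > 1 / (2 * rden n)"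
proof -
  have "idist (of_int k * \<alpha>) = idist (real (nat \<bar>k\<bar>) * \<alpha>)"
    using idist_minus[of "of_int k * \<alpha>"] by (cases "k \<ge> 0") auto
  then show ?thesis using idist_gt_half_inverse[of "nat \<bar>k\<bar>" n] assms by auto
qed

lemma idist_ge_den_int:
  assumes "k \<noteq> 0" "\<bar>k\<bar> < int (den (Suc n))" shows "idist (of_int k * \<alpha>) \<ge> idist (rden n * \<alpha>)"
proof -
  have "idist (of_int k * \<alpha>) = idist (real (nat \<bar>k\<bar>) * \<alpha>)"
    using idist_minus[of "of_int k * \<alpha>"] by (cases "k \<ge> 0") auto
  moreover have "nat \<bar>k\<bar> < den (Suc n)" using assms(2) by linarith
  ultimately show ?thesis using idist_ge_den[of "nat \<bar>k\<bar>" n] assms(1) by simp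
qed

text \<open>Of three consecutive signed errors two have the same sign, and their difference is smaller
  than the larger one.\<close>
lemma den_double: "2 * den n \<le> den (Suc (Suc n))"
proof -
  define e where "e i = rden i * \<alpha> - of_int (round (rden i * \<alpha>))" for i
  have abs_e: "\<bar>e i\<bar> = idist (rden i * \<alpha>)" for i unfolding e_def idist_def by simp
  have key: "den j \<ge> 2 * den i" if ij: "i < j" and sgn: "(e i \<ge> 0 \<and> e j \<ge> 0) \<or> (e i \<le> 0 \<and> e j \<le> 0)" for i j
  proof -
    have dlt: "den i < den j" by (rule den_less[OF ij])
    have "\<bar>e j\<bar> < \<bar>e i\<bar>" unfolding abs_e by (rule idist_gt_den[OF den_pos dlt])
    moreover have "e j \<noteq> 0" using idist_pos_nat[OF den_pos, of j] abs_e[of j] by auto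
    ultimately have "\<bar>e j - e i\<bar> < \<bar>e i\<bar>" using sgn by linarith
    moreover have "idist (real (den j - den i) * \<alpha>) \<le> \<bar>e j - e i\<bar>"
      using idist_le[of "real (den j - den i) * \<alpha>" "round (rden j * \<alpha>) - round (rden i * \<alpha>)"] dlt
      unfolding e_def by (simp add: of_nat_diff algebra_simps)
    ultimately have "idist (real (den j - den i) * \<alpha>) < idist (rden i * \<alpha>)" unfolding abs_e by linarith
    then have "den j - den i \<ge> den (Suc i)" using idist_ge_den[of "den j - den i" i] dlt by (meson leI leD zero_less_diff)
    then show ?thesis using den_less_Suc[of i] by linarith
  qed
  consider "e n \<ge> 0 \<and> e (Suc n) \<ge> 0 \<or> e n \<le> 0 \<and> e (Suc n) \<le> 0"
    | "e n \<ge> 0 \<and> e (Suc (Suc n)) \<ge> 0 \<or> e n \<le> 0 \<and> e (Suc (Suc n)) \<le> 0"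
    | "e (Suc n) \<ge> 0 \<and> e (Suc (Suc n)) \<ge> 0 \<or> e (Suc n) \<le> 0 \<and> e (Suc (Suc n)) \<le> 0" by linarith
  then show ?thesis
  proof cases
    case 1
    then show ?thesis using key[of n "Suc n"] den_less_Suc[of "Suc n"] by linarith
  next
    case 2
    then show ?thesis using key[of n "Suc (Suc n)"] by linarith
  next
    case 3
    then show ?thesis using key[of "Suc n" "Suc (Suc n)"] den_less_Suc[of n] by linarith
  qed
qed

text \<open>Dividing numerator and denominator by a common factor would give a smaller multiplier
  with an error no larger than the record.\<close>

lemma den_coprime: "coprime (round (rden n * \<alpha>)) (int (den n))"
proof (rule ccontr)
  let ?q = "den n" and ?r = "rden n" and ?p = "round (rden n * \<alpha>)"
  define d where "d = gcd ?p (int ?q)"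
  assume "\<not> coprime ?p (int ?q)"
  then have "d \<noteq> 1" unfolding d_def by (simp add: coprime_iff_gcd_eq_1)
  moreover have "d > 0" unfolding d_def using den_pos[of n] by simp
  ultimately have d: "d > 1" by linarith
  obtain p' where p': "?p = d * p'" unfolding d_def by (metis dvdE gcd_dvd1)
  obtain q' where q': "int ?q = d * q'" unfolding d_def by (metis dvdE gcd_dvd2)
  have q'0: "q' > 0" using q' den_pos[of n] d by (smt (verit) mult_nonneg_nonpos of_nat_0_less_iff)
  have q'q: "q' < int ?q" unfolding q' using d q'0 by simp
  have rq: "?r = of_int d * of_int q'" using q' by (metis of_int_mult of_int_of_nat_eq)
  have "idist (real (nat q') * \<alpha>) \<le> \<bar>of_int q' * \<alpha> - of_int p'\<bar>" using idist_le[of _ p'] q'0 by simp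
  also have "\<dots> \<le> of_int d * \<bar>of_int q' * \<alpha> - of_int p'\<bar>" using d by (simp add: mult_le_cancel_right1)
  also have "\<dots> = \<bar>of_int d * (of_int q' * \<alpha> - of_int p')\<bar>" using d by (simp add: abs_mult)
  also have "of_int d * (of_int q' * \<alpha> - of_int p') = ?r * \<alpha> - of_int ?p"
  proof -
    have "real_of_int ?p = of_int d * of_int p'" by (subst p') simp
    then show ?thesis unfolding rq[symmetric] by (simp add: rq right_diff_distrib)
  qed
  also have "\<bar>\<dots>\<bar> = idist (?r * \<alpha>)" unfolding idist_def ..
  finally have "idist (real (nat q') * \<alpha>) \<le> idist (?r * \<alpha>)" .
  moreover have "nat q' < ?q" "0 < nat q'" using q'0 q'q by linarith+
  ultimately show False using idist_gt_den[of "nat q'" n] by linarith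
qed

text \<open>Denjoy-Koksma for \<open>psi\<close>. The orbit points differ from the grid x + i p/q by
  at most 1/q. As \<open>frac\<close> can only fall behind when its argument increases, the terms
  lie between those of the grids shifted by -1/q and 1/q, up to 2/q each; this costs 2 in total, and
  the grid sum itself deviates by at most 1.\<close>

lemma birkhoff_psi_bound: "\<bar>psi_sum \<alpha> (den n) x\<bar> \<le> 3"
proof -
  let ?q = "den n" and ?r = "rden n" and ?p = "round (rden n * \<alpha>)"
  have q: "?q > 0" by (rule den_pos)
  define e where "e i = real i * (?r * \<alpha> - of_int ?p) / ?r" for i
  have e: "\<bar>e i\<bar> \<le> 1 / ?r" if "i < ?q" for i
  proof -
    have "\<bar>e i\<bar> = real i / ?r * idist (?r * \<alpha>)" unfolding e_def idist_def by (simp add: abs_mult)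
    also have "\<dots> \<le> 1 * (1 / ?r)" using that by (intro mult_mono idist_den_le) auto
    finally show ?thesis by simp
  qed
  have x: "x + real i * \<alpha> = x + real i * of_int ?p / ?r + e i" for i
    unfolding e_def using q by (simp add: field_simps)
  define G where "G y = (\<Sum>i<?q. frac (y + real i * of_int ?p / ?r))" for y
  have G: "\<bar>G y - ?r / 2\<bar> \<le> 1" for y
    unfolding G_def sum_frac_coprime_grid[OF q den_coprime] by (rule sum_frac_grid[OF q])
  have close: "frac (z + e i) \<le> frac (z + - 1 / ?r) + 2 / ?r" "frac (z + 1 / ?r) \<le> frac (z + e i) + 2 / ?r"
    if "i < ?q" for z i
  proof -
    have "0 \<le> e i + 1 / ?r" "0 \<le> 1 / ?r - e i" using e[OF that] by linarith+
    from this[THEN frac_add_le] have "frac (z + - 1 / ?r + (e i + 1 / ?r)) \<le> frac (z + - 1 / ?r) + (e i + 1 / ?r)"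
      "frac (z + e i + (1 / ?r - e i)) \<le> frac (z + e i) + (1 / ?r - e i)" by blast+
    moreover have "z + - 1 / ?r + (e i + 1 / ?r) = z + e i" "z + e i + (1 / ?r - e i) = z + 1 / ?r" by simp_all
    moreover have "2 / ?r = 1 / ?r + 1 / ?r" by simp
    ultimately show "frac (z + e i) \<le> frac (z + - 1 / ?r) + 2 / ?r" "frac (z + 1 / ?r) \<le> frac (z + e i) + 2 / ?r"
      using e[OF that] by (simp_all only:)
  qed
  have sh: "y + real i * of_int ?p / ?r + z = y + z + real i * of_int ?p / ?r" for y z i by simp
  have "(\<Sum>i<?q. frac (x + real i * \<alpha>)) \<le> (\<Sum>i<?q. frac (x + - 1 / ?r + real i * of_int ?p / ?r) + 2 / ?r)"
    unfolding x sh[symmetric] by (intro sum_mono close) simp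
  also have "\<dots> = G (x + - 1 / ?r) + 2" unfolding G_def using q by (simp add: sum.distrib)
  finally have up: "(\<Sum>i<?q. frac (x + real i * \<alpha>)) \<le> G (x + - 1 / ?r) + 2" .
  have "G (x + 1 / ?r) \<le> (\<Sum>i<?q. frac (x + real i * \<alpha>) + 2 / ?r)"
    unfolding G_def x sh[symmetric] by (intro sum_mono close) simp
  also have "\<dots> = (\<Sum>i<?q. frac (x + real i * \<alpha>)) + 2" using q by (simp add: sum.distrib)
  finally have low: "G (x + 1 / ?r) \<le> (\<Sum>i<?q. frac (x + real i * \<alpha>)) + 2" .
  have "psi_sum \<alpha> ?q x = (\<Sum>i<?q. frac (x + real i * \<alpha>)) - ?r / 2"
    unfolding birkhoff_sum_def psi_def by (simp add: sum_subtractf)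
  then show ?thesis using up low G[of "x + - 1 / ?r"] G[of "x + 1 / ?r"] by linarith
qed

end

section \<open>Levels with a definite drift when beta is well approximable by multiples of
  alpha\<close>

context irrational_rotation
begin

text \<open>The same \<open>k\<close> serves at arbitrarily late levels, where the permitted error
  \<open>\<epsilon> / rden n\<close> tends to 0.\<close>

lemma recurrent_imp_orbit:
  fixes k :: "nat \<Rightarrow> int"
  assumes rec: "\<And>n. n \<ge> N \<Longrightarrow> \<exists>n'>n. k n' = k n"
    and app: "\<And>n. n \<ge> N \<Longrightarrow> idist (\<beta> - of_int (k n) * \<alpha>) < \<epsilon> / rden n"
  shows "idist (\<beta> - of_int (k N) * \<alpha>) = 0"
proof (rule ccontr)
  let ?d = "idist (\<beta> - of_int (k N) * \<alpha>)"
  assume "?d \<noteq> 0"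
  then have d: "?d > 0" using idist_nonneg[of "\<beta> - of_int (k N) * \<alpha>"] by linarith
  have "\<exists>n\<ge>max N M. k n = k N" for M
  proof (induction M)
    case (Suc M)
    then obtain n where n: "n \<ge> max N M" "k n = k N" by blast
    then obtain n' where "n' > n" "k n' = k n" using rec[of n] by auto
    then show ?case using n by (intro exI[of _ n']) auto
  qed auto
  moreover obtain M :: nat where M: "real M > \<epsilon> / ?d" using reals_Archimedean2 by blast
  ultimately obtain n where n: "n \<ge> N" "n \<ge> M" "k n = k N" by (metis max.bounded_iff)
  have "?d < \<epsilon> / rden n" using app[OF n(1)] n(3) by simp
  then have "rden n * ?d < \<epsilon>" using den_pos[of n] by (simp add: field_simps)
  moreover have "real M * ?d \<le> rden n * ?d" using den_ge[of n] n(2) d by (intro mult_right_mono) auto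
  moreover have "\<epsilon> < real M * ?d" using M d by (simp add: field_simps)
  ultimately show False by linarith
qed

text \<open>If \<open>k\<close> approximates \<open>\<beta>\<close> well at every level \<open>n\<close>, then a failure of the last inequality at all
  late levels forces the approximating \<open>k\<close> to recur, i.e. \<open>\<beta> \<in> \<int>\<alpha> + \<int>\<close>.\<close>
lemma transition_levels:
  fixes \<beta> :: real
  defines "\<delta> \<equiv> \<lambda>n. rden n * \<alpha> - of_int (round (rden n * \<alpha>))"
    and "\<gamma> \<equiv> \<lambda>k::int. \<beta> - of_int k * \<alpha> - of_int (round (\<beta> - of_int k * \<alpha>))"
  assumes \<beta>: "\<And>k::int. idist (\<beta> - of_int k * \<alpha>) \<noteq> 0"
    and app: "\<forall>c>0. \<exists>N. \<forall>n\<ge>N. \<exists>k::int. \<bar>of_int k\<bar> \<le> 3/4 * rden n \<and>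
       idist (\<beta> - of_int k * \<alpha>) < c / rden n"
    and \<eta>: "\<eta> > 0"
  shows "\<exists>n\<ge>N. \<exists>k::int. \<bar>of_int k\<bar> \<le> 3/4 * rden n \<and> rden n * \<bar>\<delta> n\<bar> \<le> \<eta> \<and>
     rden n * \<bar>\<gamma> k\<bar> \<le> \<eta> \<and> \<bar>of_int k * \<delta> n + rden n * \<gamma> k\<bar> \<ge> rden n * \<bar>\<delta> n\<bar> / 16"
proof (rule ccontr)
  assume neg: "\<not> ?thesis"
  have \<delta>: "\<bar>\<delta> n\<bar> = idist (rden n * \<alpha>)" for n unfolding \<delta>_def idist_def ..
  have \<gamma>: "\<bar>\<gamma> k\<bar> = idist (\<beta> - of_int k * \<alpha>)" for k unfolding \<gamma>_def idist_def ..
  define h where "h = min \<eta> (1/16)"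
  have h: "0 < h" "h \<le> \<eta>" "h \<le> 1/16" using \<eta> unfolding h_def by auto
  \<comment> \<open>Chosen so that \<open>(2/h)^2 * \<epsilon>\<close> equals \<open>h / 2\<close>:
    two consecutive levels with q |delta| > h multiply the denominator by at most
    \<open>(2/h)^2\<close>, and an approximation found at the first of them must still be good
    afterwards.\<close>
  define \<epsilon> where "\<epsilon> = h ^ 3 / 8"
  have \<epsilon>: "\<epsilon> > 0" using h unfolding \<epsilon>_def by simp
  have "h ^ 2 \<le> (1/16) ^ 2" by (rule power_mono) (use h in auto)
  then have h2: "h ^ 2 \<le> 1" by (simp add: power2_eq_square)
  have h3: "h ^ 3 \<le> h" using mult_left_mono[OF h2, of h] h by (simp add: power3_eq_cube power2_eq_square)
  have \<epsilon>16: "\<epsilon> \<le> 1/16" unfolding \<epsilon>_def using h h3 by simp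
  obtain N1 where "\<forall>n\<ge>N1. \<exists>k::int. \<bar>of_int k\<bar> \<le> 3/4 * rden n \<and> idist (\<beta> - of_int k * \<alpha>) < \<epsilon> / rden n"
    using app \<epsilon> by blast
  then obtain k :: "nat \<Rightarrow> int" where k: "\<And>n. n \<ge> N1 \<Longrightarrow> \<bar>of_int (k n)\<bar> \<le> 3/4 * rden n"
    "\<And>n. n \<ge> N1 \<Longrightarrow> idist (\<beta> - of_int (k n) * \<alpha>) < \<epsilon> / rden n" by metis
  define N0 where "N0 = max N N1"
  have q0: "rden n > 0" for n using den_pos[of n] by simp
  have diff: "idist (of_int (k i - k j) * \<alpha>) \<le> idist (\<beta> - of_int (k i) * \<alpha>) + idist (\<beta> - of_int (k j) * \<alpha>)" for i j
    using idist_diff_le[of "\<beta> - of_int (k j) * \<alpha>" "\<beta> - of_int (k i) * \<alpha>"] by (simp add: algebra_simps)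
  \<comment> \<open>A product q |delta| that is not small means that the next denominator is not
    much larger than q.\<close>
  have slow: "rden (Suc m) < 2 / h * rden m" if "rden m * \<bar>\<delta> m\<bar> > h" for m
  proof -
    have "rden m * \<bar>\<delta> m\<bar> \<le> rden m * (2 / rden (Suc m))"
      unfolding \<delta> by (intro mult_left_mono idist_den_le_Suc) simp
    then have "h < rden m * (2 / rden (Suc m))" using that by linarith
    then show ?thesis using q0[of "Suc m"] h by (simp add: field_simps)
  qed
  \<comment> \<open>If \<open>k\<close> changed, the failing inequality would give |gamma (k n)| <
    (3/4 + 1/16) |delta m|. Since |gamma (k (Suc m))| is at most |delta m| / 8, the difference of
    the two integers would approximate better than \<open>den m\<close> and be at least
    \<open>den (Suc m)\<close>. But both integers obey the 3/4 bound, and \<open>den (Suc m)\<close>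
    is at least 8 times \<open>den m\<close>.\<close>
  have keep: "k (Suc m) = k n" if n: "n \<ge> N0" "n \<le> m" and a: "rden m * \<bar>\<delta> m\<bar> \<le> h"
    and b: "rden m \<le> (2/h)^2 * rden n" for n m
  proof (rule ccontr)
    assume neq: "k (Suc m) \<noteq> k n"
    have k1: "\<bar>of_int (k n)\<bar> \<le> 3/4 * rden n" "\<bar>\<gamma> (k n)\<bar> < \<epsilon> / rden n"
      "\<bar>of_int (k (Suc m))\<bar> \<le> 3/4 * rden (Suc m)" "\<bar>\<gamma> (k (Suc m))\<bar> < \<epsilon> / rden (Suc m)"
      using k[of n] k[of "Suc m"] n unfolding N0_def \<gamma> by (auto)
    have dm: "rden n \<le> rden m" using den_mono[OF n(2)] by simp
    have "rden m * \<bar>\<gamma> (k n)\<bar> \<le> ((2/h)^2 * rden n) * (\<epsilon> / rden n)"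
      using b k1(2) by (intro mult_mono) auto
    also have "\<dots> = (2/h)^2 * \<epsilon>" using q0[of n] by simp
    also have "\<dots> = h / 2" unfolding \<epsilon>_def using h by (simp add: power2_eq_square power3_eq_cube)
    finally have "rden m * \<bar>\<gamma> (k n)\<bar> \<le> \<eta>" using h by linarith
    moreover have "rden m * \<bar>\<delta> m\<bar> \<le> \<eta>" using a h by linarith
    moreover have "\<bar>of_int (k n)\<bar> \<le> 3/4 * rden m" using k1(1) dm by linarith
    moreover have "m \<ge> N" using n unfolding N0_def by simp
    ultimately have s: "\<bar>of_int (k n) * \<delta> m + rden m * \<gamma> (k n)\<bar> < rden m * \<bar>\<delta> m\<bar> / 16"
      using neg by (meson not_le)
    have "\<bar>of_int (k n) * \<delta> m\<bar> \<le> (3/4 * rden m) * \<bar>\<delta> m\<bar>"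
      unfolding abs_mult using k1(1) dm by (intro mult_right_mono) auto
    then have "\<bar>rden m * \<gamma> (k n)\<bar> < rden m * (13/16 * \<bar>\<delta> m\<bar>)" using s by linarith
    then have g1: "\<bar>\<gamma> (k n)\<bar> < 13/16 * \<bar>\<delta> m\<bar>" using q0[of m] by (simp add: abs_mult)
    have dl: "1 / rden (Suc m) < 2 * \<bar>\<delta> m\<bar>"
      using idist_den_gt[of m] unfolding \<delta> by (simp add: field_simps)
    have "\<epsilon> / rden (Suc m) \<le> \<epsilon> * (2 * \<bar>\<delta> m\<bar>)"
      using mult_left_mono[of "1 / rden (Suc m)" "2 * \<bar>\<delta> m\<bar>" \<epsilon>] dl \<epsilon> by simp
    also have "\<dots> \<le> 1/16 * (2 * \<bar>\<delta> m\<bar>)" using \<epsilon>16 by (intro mult_right_mono) auto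
    finally have "\<bar>\<gamma> (k (Suc m))\<bar> \<le> \<bar>\<delta> m\<bar> / 8" using k1(4) by linarith
    moreover have "\<bar>\<delta> m\<bar> > 0" using dl q0[of "Suc m"] by (smt (verit) divide_pos_pos)
    ultimately have "idist (of_int (k (Suc m) - k n) * \<alpha>) < idist (rden m * \<alpha>)"
      using diff[of "Suc m" n] g1 unfolding \<gamma>[symmetric] \<delta>[symmetric] by linarith
    then have big: "\<bar>k (Suc m) - k n\<bar> \<ge> int (den (Suc m))"
      using idist_ge_den_int[of "k (Suc m) - k n" m] neq by fastforce
    have "rden m * (1 / rden (Suc m)) \<le> rden m * (2 * \<bar>\<delta> m\<bar>)"
      using dl by (intro mult_left_mono) auto
    also have "\<dots> \<le> 1/8" using a h by linarith
    finally have "8 * rden m \<le> rden (Suc m)" using q0[of "Suc m"] by (simp add: field_simps)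
    moreover have "rden (Suc m) \<le> \<bar>of_int (k (Suc m))\<bar> + \<bar>of_int (k n)\<bar>"
      using big by linarith
    ultimately show False using k1(1,3) dm q0[of "Suc m"] by linarith
  qed
  have rec: "\<exists>n'>n. k n' = k n" if n: "n \<ge> N0" for n
  proof -
    have hh: "(1::real) \<le> 2 / h" using h by (simp add: field_simps)
    have h1: "1 * rden n \<le> (2/h)^2 * rden n" "2/h * rden n \<le> (2/h)^2 * rden n"
      using hh self_le_power[OF hh, of 2] one_le_power[OF hh, of 2] by (intro mult_right_mono; simp)+
    have le2: "rden (Suc (Suc n)) \<le> (2/h)^2 * rden n" if "rden n * \<bar>\<delta> n\<bar> > h" "rden (Suc n) * \<bar>\<delta> (Suc n)\<bar> > h"
    proof -
      have "rden (Suc (Suc n)) \<le> 2/h * rden (Suc n)" using slow[OF that(2)] by simp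
      also have "\<dots> \<le> 2/h * (2/h * rden n)" using slow[OF that(1)] h by (intro mult_left_mono) auto
      finally show ?thesis by (simp add: power2_eq_square)
    qed
    consider (1) "rden n * \<bar>\<delta> n\<bar> \<le> h"
      | (2) "rden n * \<bar>\<delta> n\<bar> > h" "rden (Suc n) * \<bar>\<delta> (Suc n)\<bar> \<le> h"
      | (3) "rden n * \<bar>\<delta> n\<bar> > h" "rden (Suc n) * \<bar>\<delta> (Suc n)\<bar> > h"
            "rden (Suc (Suc n)) * \<bar>\<delta> (Suc (Suc n))\<bar> \<le> h"
      | (4) "rden n * \<bar>\<delta> n\<bar> > h" "rden (Suc n) * \<bar>\<delta> (Suc n)\<bar> > h"
            "rden (Suc (Suc n)) * \<bar>\<delta> (Suc (Suc n))\<bar> > h" by linarith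
    then show ?thesis
    proof cases
      case 1
      then have "k (Suc n) = k n" using n h1 by (intro keep) auto
      then show ?thesis by blast
    next
      case 2
      then have "k (Suc (Suc n)) = k n" using n h1 slow[OF 2(1)] by (intro keep) auto
      then show ?thesis by (intro exI[of _ "Suc (Suc n)"]) auto
    next
      case 3
      then have "k (Suc (Suc (Suc n))) = k n" using n le2 by (intro keep) auto
      then show ?thesis by (intro exI[of _ "Suc (Suc (Suc n))"]) auto
    next
      \<comment> \<open>After three levels with large q |delta| no nearby level fits
        \<open>keep\<close>, but \<open>k (Suc n) = k n\<close> already holds: by
        \<open>den_double\<close> the difference is below \<open>den (Suc (Suc (Suc n)))\<close>, so
        unless it vanishes, delta at level n + 2 is below \<open>2 * \<epsilon> / rden n\<close>,
        too small for the assumed lower bound.\<close>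
      case 4
      note le = le2[OF 4(1,2)]
      have "k (Suc n) - k n = 0"
      proof (rule ccontr)
        assume neq: "k (Suc n) - k n \<noteq> 0"
        have kk: "\<bar>of_int (k n)\<bar> \<le> 3/4 * rden n" "idist (\<beta> - of_int (k n) * \<alpha>) < \<epsilon> / rden n"
          "\<bar>of_int (k (Suc n))\<bar> \<le> 3/4 * rden (Suc n)"
          "idist (\<beta> - of_int (k (Suc n)) * \<alpha>) < \<epsilon> / rden (Suc n)"
          using k[of n] k[of "Suc n"] n unfolding N0_def by (auto)
        have "rden n < rden (Suc n)" using den_less_Suc[of n] by simp
        moreover have "2 * rden (Suc n) \<le> real (den (Suc (Suc (Suc n))))"
          using den_double[of "Suc n"] by simp
        ultimately have "\<bar>of_int (k (Suc n)) - of_int (k n) :: real\<bar> < real (den (Suc (Suc (Suc n))))"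
          using kk(1,3) q0[of n] by linarith
        then have "\<bar>k (Suc n) - k n\<bar> < int (den (Suc (Suc (Suc n))))" by linarith
        then have "idist (of_int (k (Suc n) - k n) * \<alpha>) \<ge> \<bar>\<delta> (Suc (Suc n))\<bar>"
          using idist_ge_den_int[OF neq] unfolding \<delta> by blast
        moreover have "\<epsilon> / rden (Suc n) \<le> \<epsilon> / rden n"
          using \<epsilon> q0[of n] den_less_Suc[of n] by (intro divide_left_mono) (auto)
        ultimately have "\<bar>\<delta> (Suc (Suc n))\<bar> < 2 * \<epsilon> / rden n" using diff[of "Suc n" n] kk(2,4) by linarith
        then have "h < rden (Suc (Suc n)) * (2 * \<epsilon> / rden n)"
          using 4(3) mult_strict_left_mono[of "\<bar>\<delta> (Suc (Suc n))\<bar>" "2 * \<epsilon> / rden n" "rden (Suc (Suc n))"]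
            q0[of "Suc (Suc n)"] by linarith
        also have "\<dots> \<le> ((2/h)^2 * rden n) * (2 * \<epsilon> / rden n)"
          using le \<epsilon> by (intro mult_right_mono) auto
        also have "\<dots> = (2/h)^2 * (2 * \<epsilon>)" using q0[of n] by simp
        also have "\<dots> = h" unfolding \<epsilon>_def using h by (simp add: power2_eq_square power3_eq_cube)
        finally show False by simp
      qed
      then show ?thesis by (intro exI[of _ "Suc n"]) auto
    qed
  qed
  have "idist (\<beta> - of_int (k N0) * \<alpha>) = 0"
    by (rule recurrent_imp_orbit[OF rec]) (use k(2) in \<open>auto simp: N0_def\<close>)
  then show False using \<beta> by blast
qed

end

section \<open>Fibre periods of the cocycle\<close>

lemma mu_Int_ge:
  assumes "S \<in> sets borel" "T \<in> sets borel" "mu S \<ge> 1 - a" "mu T \<ge> 1 - b"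
  shows "mu (S \<inter> T) \<ge> 1 - (a + b)"
proof -
  have "S \<inter> T = S - (- T)" by auto
  then show ?thesis using mu_Diff_ge[of S "- T"] mu_Compl[of T] assms by auto
qed

lemma all_safe_borel: "finite I \<Longrightarrow> {x. \<forall>i\<in>I. safe a (x + b i)} \<in> sets borel"
  unfolding safe_def by measurable

lemma mu_all_safe:
  assumes "finite I" "a \<ge> 0"
  shows "mu {x. \<forall>i\<in>I. safe a (x + b i)} \<ge> 1 - 2 * a * real (card I)"
proof -
  have m: "{x. \<not> safe a (x + b i)} \<in> sets borel" for i unfolding safe_def by measurable
  have "mu (\<Union>i\<in>I. {x. \<not> safe a (x + b i)}) \<le> (\<Sum>i\<in>I. mu {x. \<not> safe a (x + b i)})"
    by (rule mu_UN_le) (use assms m in auto)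
  also have "\<dots> \<le> (\<Sum>i\<in>I. 2 * a)" by (rule sum_mono) (use mu_not_safe assms in auto)
  finally have "mu (\<Union>i\<in>I. {x. \<not> safe a (x + b i)}) \<le> 2 * a * real (card I)" by (simp add: mult.commute)
  moreover have eq: "{x. \<forall>i\<in>I. safe a (x + b i)} = - (\<Union>i\<in>I. {x. \<not> safe a (x + b i)})" by auto
  moreover have m': "(\<Union>i\<in>I. {x. \<not> safe a (x + b i)}) \<in> sets borel" using assms m by auto
  ultimately show ?thesis unfolding eq mu_Compl[OF m'] by linarith
qed

lemma psi_add_int [simp]: "psi (x + of_int m) = psi x"
  unfolding psi_def by simp

lemma birkhoff_psi_add_int: "psi_sum \<alpha> n (x + of_int m) = psi_sum \<alpha> n x"
proof -
  have "psi (x + of_int m + real i * \<alpha>) = psi (x + real i * \<alpha>)" for i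
    using psi_add_int[of "x + real i * \<alpha>" m] by (simp add: add_ac)
  then show ?thesis unfolding birkhoff_sum_def by simp
qed

lemma birkhoff_sum_add:
  "birkhoff_sum \<Phi> \<alpha> (m + n) x = birkhoff_sum \<Phi> \<alpha> m x + birkhoff_sum \<Phi> \<alpha> n (x + real m * \<alpha>)"
proof (induction n)
  case (Suc n)
  then show ?case by (simp add: birkhoff_sum_Suc algebra_simps)
qed (simp add: birkhoff_sum_def)

lemma birkhoff_psi_shift:
  assumes "\<And>i. i < n \<Longrightarrow> safe \<bar>u\<bar> (x + real i * \<alpha>)"
  shows "psi_sum \<alpha> n (x + u) = psi_sum \<alpha> n x + real n * u"
proof -
  have "psi_sum \<alpha> n (x + u) = (\<Sum>i<n. psi (x + real i * \<alpha>) + u)"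
    unfolding birkhoff_sum_def
  proof (rule sum.cong[OF refl])
    fix i assume "i \<in> {..<n}"
    then have "frac ((x + real i * \<alpha>) + u) = frac (x + real i * \<alpha>) + u"
      using assms by (intro frac_add_safe) auto
    then show "psi (x + u + real i * \<alpha>) = psi (x + real i * \<alpha>) + u"
      unfolding psi_def by (simp add: add_ac)
  qed
  then show ?thesis unfolding birkhoff_sum_def by (simp add: sum.distrib)
qed

section \<open>Birkhoff sums of the planar cocycle, its diagonal periods, and crossing a single
  jump\<close>

definition vec2 :: "real \<Rightarrow> real \<Rightarrow> real ^ 2" where
  "vec2 a b = vector [a, b]"

lemma vec2_nth [simp]: "vec2 a b $ 1 = a" "vec2 a b $ 2 = b"
  unfolding vec2_def by simp_all

lemma vec2_eqI: "v $ 1 = a \<Longrightarrow> v $ 2 = b \<Longrightarrow> v = vec2 a b"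
  by (simp add: vec_eq_iff forall_2)

lemma vec2_arith: "vec2 a b + vec2 c d = vec2 (a + c) (b + d)" "vec2 a b - vec2 c d = vec2 (a - c) (b - d)"
  "- vec2 a b = vec2 (- a) (- b)" "r *\<^sub>R vec2 a b = vec2 (r * a) (r * b)" "0 = vec2 0 0"
  by (auto simp: vec_eq_iff forall_2)

lemma norm_vec2_le: "norm (vec2 a b) \<le> \<bar>a\<bar> + \<bar>b\<bar>"
  using norm_le_l1_cart[of "vec2 a b"] by (simp add: sum_2)

lemma birkhoff_Psi2:
  "birkhoff_sum (Psi2 \<beta>) \<alpha> n x = vec2 (psi_sum \<alpha> n x) (psi_sum \<alpha> n (x + \<beta>))"
proof (rule vec2_eqI)
  have "psi (x + real i * \<alpha> + \<beta>) = psi (x + \<beta> + real i * \<alpha>)" for i by (simp add: add_ac)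
  then show "birkhoff_sum (Psi2 \<beta>) \<alpha> n x $ 1 = psi_sum \<alpha> n x"
    "birkhoff_sum (Psi2 \<beta>) \<alpha> n x $ 2 = psi_sum \<alpha> n (x + \<beta>)"
    unfolding birkhoff_sum_def Psi2_def by simp_all
qed

locale Psi2_observable = invariant_observable \<alpha> "Psi2 \<beta>" g L
  for \<alpha> \<beta> :: real and g :: "real \<Rightarrow> real ^ 2 \<Rightarrow> real" and L :: real
begin

sublocale irrational_rotation \<alpha>
  by unfold_locales (rule irrational)

abbreviation "Psi_sum \<equiv> birkhoff_sum (Psi2 \<beta>) \<alpha>"

lemma norm_birkhoff_le: "norm (Psi_sum (den n) x) \<le> 6"
  unfolding birkhoff_Psi2
  using norm_vec2_le birkhoff_psi_bound[of n x] birkhoff_psi_bound[of n "x + \<beta>"] by (smt (verit))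

lemma large_den:
  assumes "\<tau> > 0" "C \<ge> 0" obtains N where "\<And>n. n \<ge> N \<Longrightarrow> C / rden n < \<tau>"
proof -
  obtain N :: nat where N: "C / \<tau> < real N" using reals_Archimedean2 by blast
  have "C / rden n < \<tau>" if "n \<ge> N" for n
  proof -
    have "C / \<tau> < rden n" using N that den_ge[of n] by linarith
    then show ?thesis using assms den_pos[of n] by (simp add: field_simps)
  qed
  then show thesis using that by blast
qed

lemma diagonal_period_small:
  assumes s: "0 < s" "s \<le> 1/8"
  shows "period (vec2 s s)"
proof (rule period_if_difference[of "1/2" 6], goal_cases)
  case (2 \<tau>)
  then obtain n where n: "s / rden n < \<tau>" using large_den[of \<tau> s] s by auto
  let ?q = "den n" and ?r = "rden n"
  define a where "a = s / ?r"
  have q: "?r > 0" using den_pos[of n] by simp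
  have a: "a > 0" "?r * a = s" using q s unfolding a_def by auto
  define Y where "Y = {x. \<forall>i\<in>{..<?q}. safe a (x + real i * \<alpha>)} \<inter> {x. \<forall>i\<in>{..<?q}. safe a (x + (\<beta> + real i * \<alpha>))}"
  have Yb: "Y \<in> sets borel" unfolding Y_def by (intro sets.Int all_safe_borel) auto
  have "mu Y \<ge> 1 - (2 * a * real (card {..<?q}) + 2 * a * real (card {..<?q}))"
    unfolding Y_def by (intro mu_Int_ge mu_all_safe all_safe_borel) (use a in auto)
  \<comment> \<open>Each coordinate excludes measure at most \<open>2 * s\<close>, so
    \<open>s \<le> 1/8\<close> leaves half of the circle.\<close>
  then have Ym: "mu Y \<ge> 1/2" using a s by (simp add: algebra_simps)
  show ?case
  proof (rule exI[of _ ?q], rule exI[of _ "- a"], rule exI[of _ Y], intro conjI ballI)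
    show "\<bar>- a\<bar> < \<tau>" using n a unfolding a_def by simp
    fix x assume x: "x \<in> Y"
    show "norm (Psi_sum ?q x) \<le> 6" by (rule norm_birkhoff_le)
    have b1: "psi_sum \<alpha> ?q (x + - a) = psi_sum \<alpha> ?q x + ?r * - a"
      by (rule birkhoff_psi_shift) (use x a in \<open>auto simp: Y_def\<close>)
    have b2: "psi_sum \<alpha> ?q (x + \<beta> + - a) = psi_sum \<alpha> ?q (x + \<beta>) + ?r * - a"
      by (rule birkhoff_psi_shift) (use x a in \<open>auto simp: Y_def add_ac\<close>)
    have e: "x + \<beta> + - a = x + - a + \<beta>" by simp
    have "psi_sum \<alpha> ?q x - psi_sum \<alpha> ?q (x + - a) = s"
      "psi_sum \<alpha> ?q (x + \<beta>) - psi_sum \<alpha> ?q (x + - a + \<beta>) = s"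
      using b1 b2[unfolded e] a by linarith+
    then show "Psi_sum ?q x - Psi_sum ?q (x + - a) = vec2 s s"
      unfolding birkhoff_Psi2 vec2_arith by (simp only:)
  qed (use Yb Ym in auto)
qed simp

lemma diagonal_period: "period (vec2 s s)"
proof -
  have pos: "period (vec2 s s)" if "s > 0" for s
  proof -
    obtain n :: nat where n: "real n > 8 * s" using reals_Archimedean2 by blast
    then have n0: "real n > 0" using that by linarith
    have "period (vec2 (s / real n) (s / real n))"
      using n n0 that by (intro diagonal_period_small) (auto simp: field_simps)
    from period_scale_nat[OF this, of n] show ?thesis using n0 by (simp add: vec2_arith)
  qed
  consider "s > 0" | "s = 0" | "s < 0" by linarith
  then show ?thesis
    using pos[of s] period_minus[OF pos, of "- s"] period_0 by cases (auto simp: vec2_arith)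
qed

lemma period_modulo_diagonal: "period (vec2 a b) \<longleftrightarrow> period (vec2 0 (b - a))"
proof
  assume "period (vec2 a b)"
  from period_diff[OF this diagonal_period[of a]] show "period (vec2 0 (b - a))"
    by (simp add: vec2_arith)
next
  assume "period (vec2 0 (b - a))"
  from period_add[OF this diagonal_period[of a]] show "period (vec2 a b)"
    by (simp add: vec2_arith)
qed

text \<open>Moving x back by \<open>a\<close> across the jump with index \<open>i\<close> crosses no
  other jump of the first coordinate, since the orbit points are further apart, and none of the
  second, by the separation from beta. Both coordinates otherwise have slope q, which gives
  \<open>vec2 (c/2 - 1) (c/2)\<close>; modulo the diagonal this is \<open>vec2 0 1\<close>.\<close>

lemma unit_period_if_separated:
  assumes c: "0 < c" "c \<le> 1/2"
    and sep: "\<And>N. \<exists>n\<ge>N. \<forall>k::int. \<bar>of_int k\<bar> \<le> 3/4 * rden n \<longrightarrow> c / rden n \<le> idist (\<beta> - of_int k * \<alpha>)"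
  shows "period (vec2 0 1)"
proof -
  have "period (vec2 (c/2 - 1) (c/2))"
  proof (rule period_if_difference[of "c/8" 6], goal_cases)
    case (2 \<tau>)
    then obtain N where N: "\<And>n. n \<ge> N \<Longrightarrow> c / rden n < \<tau>" using large_den[of \<tau> c] c by auto
    obtain n where n: "n \<ge> max N 4" and sepn:
      "\<And>k::int. \<bar>of_int k\<bar> \<le> 3/4 * rden n \<Longrightarrow> c / rden n \<le> idist (\<beta> - of_int k * \<alpha>)"
      using sep[of "max N 4"] by blast
    let ?q = "den n" and ?r = "rden n"
    \<comment> \<open>Half the separation c/q, and less than the bound 1/(2q) for the spacing of the
      q orbit points.\<close>
    define a where "a = c / (2 * ?r)"
    have q4: "?q \<ge> 4" using n den_ge[of n] by simp
    then have q: "?r > 0" by simp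
    have a: "a > 0" "?r * a = c / 2" "2 * a = c / ?r" using q c unfolding a_def by auto
    have a_half: "a < 1 / (2 * ?r)" unfolding a_def using q c by (simp add: field_simps)
    have "1 * a \<le> ?r * a" using q4 a(1) by (intro mult_right_mono) auto
    then have a1: "a \<le> 1" using a(2) c by linarith
    \<comment> \<open>The middle half of the indices: for \<open>i\<close> in \<open>W\<close> and
      any \<open>j < den n\<close>, the difference is at most 3/4 of \<open>den n\<close>, as the
      separation hypothesis requires.\<close>
    define W where "W = {(?q + 3) div 4..3 * ?q div 4}"
    have W: "i < ?q" "?q \<le> 4 * i" "4 * i \<le> 3 * ?q" if "i \<in> W" for i using that q4 unfolding W_def by auto
    have cardW: "real (card W) \<ge> ?r / 4" unfolding W_def using q4 by simp
    define S where "S i = {x. frac (x + real i * \<alpha>) < a}" for i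
    have S: "S i \<in> sets borel" for i unfolding S_def by measurable
    define Y where "Y = (\<Union>i\<in>W. S i)"
    have Yb: "Y \<in> sets borel" unfolding Y_def W_def using S by auto
    have dist_ij: "a < idist (real j * \<alpha> - real i * \<alpha>)" if "i < ?q" "j < ?q" "j \<noteq> i" for i j
    proof -
      have "1 / (2 * ?r) < idist (of_int (int j - int i) * \<alpha>)"
        by (rule idist_gt_half_inverse_int) (use that in auto)
      then show ?thesis using a_half by (simp add: left_diff_distrib)
    qed
    have disj: "disjoint_family_on S W"
    proof (unfold disjoint_family_on_def, intro ballI impI)
      fix i j assume ij: "i \<in> W" "j \<in> W" "i \<noteq> j"
      have "False" if x: "x \<in> S i" "x \<in> S j" for x
      proof -
        have "idist (real j * \<alpha> - real i * \<alpha>) \<le> \<bar>frac (x + real j * \<alpha>) - frac (x + real i * \<alpha>)\<bar>"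
          using idist_le[of "real j * \<alpha> - real i * \<alpha>" "\<lfloor>x + real j * \<alpha>\<rfloor> - \<lfloor>x + real i * \<alpha>\<rfloor>"]
          unfolding frac_def by (simp add: algebra_simps)
        also have "\<dots> < a" using x frac_ge_0[of "x + real j * \<alpha>"] frac_ge_0[of "x + real i * \<alpha>"]
          unfolding S_def mem_Collect_eq by linarith
        finally show False using dist_ij[of i j] W(1) ij by force
      qed
      then show "S i \<inter> S j = {}" by blast
    qed
    have "mu Y = (\<Sum>i\<in>W. mu (S i))" unfolding Y_def
      by (rule mu_disjoint_UN) (use S disj in \<open>auto simp: W_def\<close>)
    also have "\<dots> = real (card W) * a" unfolding S_def using mu_frac_less a a1 by simp
    finally have "mu Y \<ge> ?r / 4 * a" using mult_right_mono[OF cardW, of a] a(1) by linarith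
    moreover have "?r / 4 * a = c / 8" using a(2) by (simp add: mult.commute)
    ultimately have Ym: "mu Y \<ge> c/8" by linarith
    show ?case
    proof (rule exI[of _ ?q], rule exI[of _ "- a"], rule exI[of _ Y], intro conjI ballI)
      show "\<bar>- a\<bar> < \<tau>" using N[of n] n a by simp
      fix x assume "x \<in> Y"
      then obtain i where i: "i \<in> W" "frac (x + real i * \<alpha>) < a" unfolding Y_def S_def by blast
      define u where "u = frac (x + real i * \<alpha>)"
      define m where "m = \<lfloor>x + real i * \<alpha>\<rfloor>"
      have u: "0 \<le> u" "u < a" using i(2) unfolding u_def by auto
      have xum: "x = u - real i * \<alpha> + of_int m" unfolding u_def m_def frac_def by simp
      show "norm (Psi_sum ?q x) \<le> 6" by (rule norm_birkhoff_le)
      \<comment> \<open>A point \<open>z\<close> further than \<open>a\<close> from the integers: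
        both z + u - a and z + u lie on the same branch.\<close>
      have jump: "frac (z + u + of_int m) - frac (z + u + of_int m + - a) = a" if "a < idist z" for z
      proof -
        have sz: "safe a z" by (rule safe_if_less_idist[OF that])
        have "frac (z + (u - a)) = frac z + (u - a)" "frac (z + u) = frac z + u"
          using u by (auto intro!: frac_add_safe[OF sz])
        moreover have "z + u + of_int m + - a = (z + (u - a)) + of_int m" by simp
        ultimately show ?thesis by (simp only: frac_add_of_int_right)
      qed
      \<comment> \<open>The crossed jump: u - a is negative, so the shifted point has fractional
        part 1 + u - a.\<close>
      have jump0: "frac (u + of_int m) - frac (u + of_int m + - a) = a - 1"
      proof -
        have "frac (u + of_int m) = u" using u a1 by (simp add: frac_eq)
        moreover have "u + of_int m + - a = (1 + u - a) + of_int (m - 1)" by simp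
        then have "frac (u + of_int m + - a) = frac (1 + u - a)" by (simp only: frac_add_of_int_right)
        moreover have "frac (1 + u - a) = 1 + u - a" using u a1 by (subst frac_eq) auto
        ultimately show ?thesis by simp
      qed
      have "psi_sum \<alpha> ?q x - psi_sum \<alpha> ?q (x + - a)
          = (\<Sum>j<?q. a - (if j = i then 1 else 0))"
        unfolding birkhoff_sum_def sum_subtractf[symmetric]
      proof (rule sum.cong[OF refl])
        fix j assume j: "j \<in> {..<?q}"
        have e: "x + real j * \<alpha> = (real j * \<alpha> - real i * \<alpha>) + u + of_int m"
          "x + - a + real j * \<alpha> = (real j * \<alpha> - real i * \<alpha>) + u + of_int m + - a" using xum by auto
        show "psi (x + real j * \<alpha>) - psi (x + - a + real j * \<alpha>) = a - (if j = i then 1 else 0)"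
        proof (cases "j = i")
          case True
          then show ?thesis unfolding psi_def e using jump0 by simp
        next
          case False
          then show ?thesis unfolding psi_def e using jump[OF dist_ij[OF W(1)[OF i(1)] _ False]] j by simp
        qed
      qed
      also have "\<dots> = ?r * a - 1" using W(1)[OF i(1)] by (simp add: sum_subtractf)
      finally have 1: "psi_sum \<alpha> ?q x - psi_sum \<alpha> ?q (x + - a) = c / 2 - 1" using a by simp
      have "psi_sum \<alpha> ?q (x + \<beta>) - psi_sum \<alpha> ?q (x + - a + \<beta>) = (\<Sum>j<?q. a)"
        unfolding birkhoff_sum_def sum_subtractf[symmetric]
      proof (rule sum.cong[OF refl])
        fix j assume j: "j \<in> {..<?q}"
        have e: "x + \<beta> + real j * \<alpha> = (\<beta> - of_int (int i - int j) * \<alpha>) + u + of_int m"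
          "x + - a + \<beta> + real j * \<alpha> = (\<beta> - of_int (int i - int j) * \<alpha>) + u + of_int m + - a"
          using xum by (auto simp: algebra_simps)
        have "int ?q \<le> 4 * int i" "4 * int i \<le> 3 * int ?q" using W(2,3)[OF i(1)] by linarith+
        moreover have "0 \<le> int j" "int j < int ?q" using j by simp_all
        ultimately have "4 * (int i - int j) \<le> 3 * int ?q" "4 * (int j - int i) \<le> 3 * int ?q"
          unfolding right_diff_distrib by linarith+
        then have "4 * \<bar>int i - int j\<bar> \<le> 3 * int ?q" unfolding abs_if by (simp split: if_split)
        then have "real_of_int (4 * \<bar>int i - int j\<bar>) \<le> real_of_int (3 * int ?q)" by (simp only: of_int_le_iff)
        then have "\<bar>of_int (int i - int j) :: real\<bar> \<le> 3/4 * ?r" by simp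
        then have "2 * a \<le> idist (\<beta> - of_int (int i - int j) * \<alpha>)" using sepn a(3) by metis
        then have "a < idist (\<beta> - of_int (int i - int j) * \<alpha>)" using a(1) by linarith
        then show "psi (x + \<beta> + real j * \<alpha>) - psi (x + - a + \<beta> + real j * \<alpha>) = a"
          unfolding psi_def e using jump by simp
      qed
      then have 2: "psi_sum \<alpha> ?q (x + \<beta>) - psi_sum \<alpha> ?q (x + - a + \<beta>) = c / 2" using a by simp
      show "Psi_sum ?q x - Psi_sum ?q (x + - a) = vec2 (c/2 - 1) (c/2)"
        unfolding birkhoff_Psi2 vec2_arith 1 2 ..
    qed (use Yb Ym in auto)
  qed (use c in auto)
  then show ?thesis using period_modulo_diagonal[of "c/2 - 1" "c/2"] by simp
qed

end

section \<open>Sums at multiples of a denominator and the resulting vertical periods\<close>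

lemma idist_witness: "\<bar>x - of_int (round x)\<bar> = idist x"
  unfolding idist_def ..

text \<open>The sum over n + k steps is split in two ways. This trades a shift by
  \<open>k * \<alpha>\<close> over the long time \<open>n\<close> for a shift by
  \<open>n * \<alpha>\<close>, tiny mod 1 at a near return, over the short time
  \<open>k\<close>.\<close>

lemma birkhoff_psi_orbit_shift:
  "psi_sum \<alpha> n (x + real k * \<alpha>) - psi_sum \<alpha> n x
    = psi_sum \<alpha> k (x + real n * \<alpha>) - psi_sum \<alpha> k x"
  using birkhoff_sum_add[of psi \<alpha> n k x] birkhoff_sum_add[of psi \<alpha> k n x] by (simp add: add.commute)

lemma safe_add:
  assumes "safe (a + b) x" "\<bar>u\<bar> \<le> b" "a \<ge> 0" shows "safe a (x + u)"
proof -
  have "frac (x + u) = frac x + u" by (rule frac_add_safe[OF assms(1)]) (use assms in auto)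
  then show ?thesis using assms unfolding safe_def by auto
qed

lemma safe_add_int: "safe a (x + of_int m) \<longleftrightarrow> safe a x"
  unfolding safe_def by simp

text \<open>At time \<open>l * q\<close>, with \<open>q * \<alpha> = p + \<delta>\<close> and \<open>\<beta> = k * \<alpha> + \<gamma> + m\<close>, the sum telescopes to a
  constant away from the points whose orbit meets a discontinuity.\<close>
lemma birkhoff_psi_difference_constant:
  fixes q l :: nat and k p m :: int
  assumes \<delta>: "real q * \<alpha> = of_int p + \<delta>" and \<gamma>: "\<beta> = of_int k * \<alpha> + \<gamma> + of_int m" and q: "q > 0"
    and s1: "\<And>i. i < q \<Longrightarrow> safe (\<bar>\<gamma>\<bar> + real l * \<bar>\<delta>\<bar>) (x + (of_int k * \<alpha> + real i * \<alpha>))"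
    and s2: "\<And>i. i < nat \<bar>k\<bar> \<Longrightarrow> safe (real l * \<bar>\<delta>\<bar>) (x + (of_int (min 0 k) * \<alpha> + real i * \<alpha>))"
  shows "psi_sum \<alpha> (l * q) (x + \<beta>) - psi_sum \<alpha> (l * q) x
    = real l * (of_int k * \<delta> + real q * \<gamma>)"
proof -
  let ?T = "l * q" and ?u = "real l * \<delta>"
  have T\<alpha>: "real ?T * \<alpha> = ?u + of_int (int l * p)"
  proof -
    have "real ?T * \<alpha> = real l * (real q * \<alpha>)" by simp
    then show ?thesis unfolding \<delta> by (simp add: algebra_simps)
  qed
  have "psi_sum \<alpha> ?T (x + \<beta>) = psi_sum \<alpha> ?T ((x + of_int k * \<alpha>) + \<gamma> + of_int m)"
    unfolding \<gamma> by (simp add: add_ac)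
  also have "\<dots> = psi_sum \<alpha> ?T ((x + of_int k * \<alpha>) + \<gamma>)" by (rule birkhoff_psi_add_int)
  also have "\<dots> = psi_sum \<alpha> ?T (x + of_int k * \<alpha>) + real ?T * \<gamma>"
  proof (rule birkhoff_psi_shift)
    fix t assume t: "t < ?T"
    \<comment> \<open>Mod 1, the orbit point at time i + j q is the one at time \<open>i\<close>
      displaced by \<open>j * \<delta>\<close>; so q points with a margin of
      \<open>l * |\<delta>|\<close> take care of all l q points.\<close>
    define i j where "i = t mod q" and "j = t div q"
    have ij: "i < q" "j < l" "t = i + j * q"
      using q t unfolding i_def j_def by (auto simp: less_mult_imp_div_less)
    have "real t * \<alpha> = real i * \<alpha> + real j * \<delta> + of_int (int j * p)"
    proof -
      have "real t * \<alpha> = real i * \<alpha> + real j * (real q * \<alpha>)" unfolding ij(3) by (simp add: algebra_simps)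
      then show ?thesis unfolding \<delta> by (simp add: algebra_simps)
    qed
    then have e: "x + of_int k * \<alpha> + real t * \<alpha>
        = (x + (of_int k * \<alpha> + real i * \<alpha>)) + real j * \<delta> + of_int (int j * p)" by simp
    have "safe \<bar>\<gamma>\<bar> ((x + (of_int k * \<alpha> + real i * \<alpha>)) + real j * \<delta>)"
      by (rule safe_add[OF s1[OF ij(1)]]) (use ij(2) in \<open>auto simp: abs_mult intro!: mult_right_mono\<close>)
    then show "safe \<bar>\<gamma>\<bar> (x + of_int k * \<alpha> + real t * \<alpha>)" unfolding e safe_add_int .
  qed
  finally have 1: "psi_sum \<alpha> ?T (x + \<beta>) = psi_sum \<alpha> ?T (x + of_int k * \<alpha>) + real ?T * \<gamma>" .
  have shift: "psi_sum \<alpha> ?T (y + real k' * \<alpha>) - psi_sum \<alpha> ?T y = real k' * ?u"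
    if "\<And>i. i < k' \<Longrightarrow> safe (real l * \<bar>\<delta>\<bar>) (y + real i * \<alpha>)" for y k'
  proof -
    have e: "y + real ?T * \<alpha> = y + ?u + of_int (int l * p)" using T\<alpha> by simp
    have "psi_sum \<alpha> k' (y + real ?T * \<alpha>) = psi_sum \<alpha> k' (y + ?u)"
      unfolding e by (rule birkhoff_psi_add_int)
    also have "\<dots> = psi_sum \<alpha> k' y + real k' * ?u"
      by (rule birkhoff_psi_shift) (use that in \<open>simp add: abs_mult\<close>)
    finally show ?thesis unfolding birkhoff_psi_orbit_shift by simp
  qed
  have 2: "psi_sum \<alpha> ?T (x + of_int k * \<alpha>) - psi_sum \<alpha> ?T x = of_int k * ?u"
  proof (cases "k \<ge> 0")
    case True
    then show ?thesis using shift[of "nat k" x] s2 by (simp add: add_ac)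
  next
    case False
    \<comment> \<open>For negative \<open>k\<close> the connecting orbit segment starts at
      \<open>x + k * \<alpha>\<close> and ends at \<open>x\<close>; hence \<open>min 0 k\<close> in
      the hypothesis.\<close>
    have "psi_sum \<alpha> ?T (x + of_int k * \<alpha> + real (nat (- k)) * \<alpha>) - psi_sum \<alpha> ?T (x + of_int k * \<alpha>)
        = real (nat (- k)) * ?u"
      by (rule shift) (use s2 False in \<open>simp add: add_ac min_def\<close>)
    then show ?thesis using False by simp
  qed
  show ?thesis using 1 2 by (simp add: algebra_simps)
qed

context Psi2_observable
begin

lemma rational_close:
  fixes A e :: real
  assumes "e > 0" obtains s where "s \<in> \<rat>" "\<bar>A - s\<bar> < e"
proof -
  obtain s where "s \<in> \<rat>" "A - e < s" "s < A + e" using Rats_dense_in_real[of "A - e" "A + e"] assms by auto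
  then show thesis using that[of s] by (simp add: abs_diff_less_iff)
qed

text \<open>Nothing is assumed about the first coordinate of the sum: it is within any tolerance of
  a rational \<open>s\<close>, and the diagonal vectors with rational entries form a countable set
  of periods that absorbs it.\<close>

lemma period_if_constant_differences:
  assumes P: "countable P" "\<And>p. p \<in> P \<Longrightarrow> period (vec2 0 p)" and c: "c > 0"
    and val: "\<And>\<tau>. \<tau> > 0 \<Longrightarrow> \<exists>n (m::int) Y. \<bar>real n * \<alpha> - of_int m\<bar> < \<tau> \<and> Y \<in> sets borel \<and> mu Y \<ge> c \<and>
      ((\<forall>x\<in>Y. \<exists>p\<in>P. \<bar>psi_sum \<alpha> n (x + \<beta>) - psi_sum \<alpha> n x - (v + p)\<bar> < \<tau>) \<or>
       (\<forall>x\<in>Y. \<exists>p\<in>P. \<bar>psi_sum \<alpha> n (x + \<beta>) - psi_sum \<alpha> n x - (- v + p)\<bar> < \<tau>))"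
  shows "period (vec2 0 v)"
proof (rule period_if_value[of c "(\<lambda>(s, p). vec2 s (s + p)) ` (\<rat> \<times> P)"], goal_cases)
  case 2
  show ?case using P(1) countable_rat by (intro countable_image countable_SIGMA) auto
next
  case (3 w)
  then obtain s p where "p \<in> P" "w = vec2 s (s + p)" by auto
  then show ?case using period_modulo_diagonal[of s "s + p"] P(2) by simp
next
  case (4 \<tau>)
  note \<tau> = this
  let ?P = "(\<lambda>(s, p). vec2 s (s + p)) ` (\<rat> \<times> P)"
  have near: "\<exists>w\<in>?P. dist (Psi_sum n x) (vec2 0 v' + w) < \<tau>"
    if p: "p \<in> P" "\<bar>psi_sum \<alpha> n (x + \<beta>) - psi_sum \<alpha> n x - (v' + p)\<bar> < \<tau> / 2" for n x v' p
  proof -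
    obtain s where s: "s \<in> \<rat>" "\<bar>psi_sum \<alpha> n x - s\<bar> < \<tau> / 4" using rational_close[of "\<tau> / 4"] \<tau> by auto
    have "dist (Psi_sum n x) (vec2 0 v' + vec2 s (s + p))
      \<le> \<bar>psi_sum \<alpha> n x - (0 + s)\<bar> + \<bar>psi_sum \<alpha> n (x + \<beta>) - (v' + (s + p))\<bar>"
      unfolding birkhoff_Psi2 dist_norm vec2_arith by (rule norm_vec2_le)
    also have "\<dots> < \<tau>" using s(2) p(2) by linarith
    finally show ?thesis using s(1) p(1) by force
  qed
  have "\<tau> / 2 > 0" using \<tau> by simp
  from val[OF this] obtain n Y v' and m :: int where Y: "\<bar>real n * \<alpha> - of_int m\<bar> < \<tau> / 2" "Y \<in> sets borel"
      "mu Y \<ge> c" "v' = v \<or> v' = - v"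
      "\<And>x. x \<in> Y \<Longrightarrow> \<exists>p\<in>P. \<bar>psi_sum \<alpha> n (x + \<beta>) - psi_sum \<alpha> n x - (v' + p)\<bar> < \<tau> / 2"
    by metis
  have eq: "- vec2 0 v = vec2 0 (- v)" by (simp add: vec2_arith)
  have "\<forall>x\<in>Y. \<exists>p\<in>?P. dist (Psi_sum n x) (vec2 0 v' + p) < \<tau>"
    using Y(5) near by blast
  then have "(\<forall>x\<in>Y. \<exists>p\<in>?P. dist (Psi_sum n x) (vec2 0 v + p) < \<tau>) \<or>
      (\<forall>x\<in>Y. \<exists>p\<in>?P. dist (Psi_sum n x) (- vec2 0 v + p) < \<tau>)"
    using Y(4) unfolding eq by (elim disjE; hypsubst; blast)
  moreover have "\<bar>real n * \<alpha> - of_int m\<bar> < \<tau>" using Y(1) \<tau> by linarith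
  ultimately show ?case using Y(2,3) by blast
qed (rule c)

text \<open>Each block of q steps contributes the constant \<open>\<sigma>\<close> to the difference
  of the coordinates, and |\<open>\<sigma>\<close>| is arbitrarily small but positive. Suitably many
  blocks reach \<open>v\<close> or \<open>-v\<close> up to |\<open>\<sigma>\<close>|. The lower
  bound for |\<open>\<sigma>\<close>| ensures that so many blocks do not yet smear the
  discontinuities over the circle.\<close>

lemma vertical_period_if_approximable:
  assumes \<beta>: "\<And>k::int. idist (\<beta> - of_int k * \<alpha>) \<noteq> 0"
    and app: "\<forall>c>0. \<exists>N. \<forall>n\<ge>N. \<exists>k::int. \<bar>of_int k\<bar> \<le> 3/4 * rden n \<and>
       idist (\<beta> - of_int k * \<alpha>) < c / rden n"
    and v: "0 < v" "v \<le> 1/256"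
  shows "period (vec2 0 v)"
proof (rule period_if_constant_differences[of "{0}" "1/4"], goal_cases)
  case (2 p)
  then show ?case using diagonal_period[of 0] by simp
next
  case (4 \<tau>)
  note \<tau> = this
  \<comment> \<open>The two parts of \<open>\<sigma>\<close> are at most \<open>\<eta>\<close> each,
    so \<open>\<tau> / 4\<close> gives |\<open>\<sigma>\<close>| <= \<open>\<tau> / 2\<close>; the
    bound 1/16 limits the set excluded because of \<open>\<gamma>\<close>.\<close>
  define \<eta> where "\<eta> = min (\<tau> / 4) (1/16)"
  have \<eta>: "\<eta> > 0" "\<eta> \<le> \<tau> / 4" "\<eta> \<le> 1/16" unfolding \<eta>_def using \<tau> by auto
  obtain N where N: "\<And>n. n \<ge> N \<Longrightarrow> 1 / rden n < \<tau>" using large_den[OF \<tau>, of 1] by auto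
  define d r where "d n = rden n * \<alpha> - of_int (round (rden n * \<alpha>))"
    and "r k = \<beta> - of_int k * \<alpha> - of_int (round (\<beta> - of_int k * \<alpha>))" for n and k :: int
  obtain n and k :: int where n: "n \<ge> N" and k: "\<bar>of_int k\<bar> \<le> 3/4 * rden n"
    and d: "rden n * \<bar>d n\<bar> \<le> \<eta>" and g: "rden n * \<bar>r k\<bar> \<le> \<eta>"
    and s: "\<bar>of_int k * d n + rden n * r k\<bar> \<ge> rden n * \<bar>d n\<bar> / 16"
    using transition_levels[OF \<beta> app \<eta>(1), of N, folded d_def r_def] by blast
  let ?q = "den n" and ?r = "rden n"
  define \<delta> \<gamma> where "\<delta> = d n" and "\<gamma> = r k"
  define \<sigma> where "\<sigma> = of_int k * \<delta> + ?r * \<gamma>"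
  have q: "?r > 0" using den_pos[of n] by simp
  have d0: "?r * \<bar>\<delta>\<bar> \<le> \<eta>" and g0: "?r * \<bar>\<gamma>\<bar> \<le> \<eta>" and s0: "\<bar>\<sigma>\<bar> \<ge> ?r * \<bar>\<delta>\<bar> / 16"
    using d g s unfolding \<delta>_def \<gamma>_def \<sigma>_def by auto
  have "\<bar>\<delta>\<bar> > 0" unfolding \<delta>_def d_def idist_witness by (rule idist_pos_nat[OF den_pos])
  then have qd: "?r * \<bar>\<delta>\<bar> > 0" using q by simp
  then have \<sigma>0: "\<bar>\<sigma>\<bar> > 0" using s0 by linarith
  have kd: "\<bar>of_int k\<bar> * \<bar>\<delta>\<bar> \<le> ?r * \<bar>\<delta>\<bar>" using k q by (intro mult_right_mono) auto
  have "\<bar>\<sigma>\<bar> \<le> \<bar>of_int k\<bar> * \<bar>\<delta>\<bar> + ?r * \<bar>\<gamma>\<bar>" unfolding \<sigma>_def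
    using abs_triangle_ineq[of "of_int k * \<delta>" "?r * \<gamma>"] by (simp add: abs_mult)
  then have \<sigma>\<tau>: "\<bar>\<sigma>\<bar> \<le> \<tau> / 2" using kd d0 g0 \<eta>(2) by linarith
  define l where "l = nat \<lfloor>v / \<bar>\<sigma>\<bar>\<rfloor>"
  have l: "real l \<le> v / \<bar>\<sigma>\<bar>" "v / \<bar>\<sigma>\<bar> < real l + 1"
    unfolding l_def using v \<sigma>0 by (auto simp: of_nat_nat)
  have l\<sigma>: "real l * \<bar>\<sigma>\<bar> \<le> v" "v < real l * \<bar>\<sigma>\<bar> + \<bar>\<sigma>\<bar>" using l \<sigma>0 by (auto simp: field_simps)
  have "real l * (?r * \<bar>\<delta>\<bar> / 16) \<le> real l * \<bar>\<sigma>\<bar>" using s0 by (intro mult_left_mono) auto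
  \<comment> \<open>Origin of 1/256: |\<open>\<sigma>\<close>| is at least a sixteenth of q |delta|,
    so l q |delta| is at most 16 v. The excluded measure is then at most 2/16 + 4/16.\<close>
  then have lqd: "real l * (?r * \<bar>\<delta>\<bar>) \<le> 1/16" using l\<sigma>(1) v by linarith
  define Y where "Y = {x. \<forall>i\<in>{..<?q}. safe (\<bar>\<gamma>\<bar> + real l * \<bar>\<delta>\<bar>) (x + (of_int k * \<alpha> + real i * \<alpha>))}
     \<inter> {x. \<forall>i\<in>{..<nat \<bar>k\<bar>}. safe (real l * \<bar>\<delta>\<bar>) (x + (of_int (min 0 k) * \<alpha> + real i * \<alpha>))}"
  have Yb: "Y \<in> sets borel" unfolding Y_def by (intro sets.Int all_safe_borel) auto
  have "mu Y \<ge> 1 - (2 * (\<bar>\<gamma>\<bar> + real l * \<bar>\<delta>\<bar>) * real (card {..<?q}) + 2 * (real l * \<bar>\<delta>\<bar>) * real (card {..<nat \<bar>k\<bar>}))"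
    unfolding Y_def by (intro mu_Int_ge mu_all_safe all_safe_borel) auto
  moreover have "2 * (real l * \<bar>\<delta>\<bar>) * real (card {..<nat \<bar>k\<bar>}) \<le> 2 * (real l * (?r * \<bar>\<delta>\<bar>))"
  proof -
    have "real (card {..<nat \<bar>k\<bar>}) = \<bar>of_int k\<bar>" by simp
    then show ?thesis using mult_left_mono[OF kd, of "2 * real l"] by (simp add: mult_ac)
  qed
  moreover have "2 * (\<bar>\<gamma>\<bar> + real l * \<bar>\<delta>\<bar>) * real (card {..<?q}) = 2 * (?r * \<bar>\<gamma>\<bar>) + 2 * (real l * (?r * \<bar>\<delta>\<bar>))"
    by (simp add: algebra_simps)
  ultimately have Ym: "mu Y \<ge> 1/4" using lqd g0 \<eta>(3) by linarith
  have val: "psi_sum \<alpha> (l * ?q) (x + \<beta>) - psi_sum \<alpha> (l * ?q) x = real l * \<sigma>" if "x \<in> Y" for x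
    unfolding \<sigma>_def
    by (rule birkhoff_psi_difference_constant[where p = "round (?r * \<alpha>)" and m = "round (\<beta> - of_int k * \<alpha>)"])
      (use that den_pos in \<open>auto simp: \<delta>_def \<gamma>_def d_def r_def Y_def\<close>)
  have close: "\<bar>real (l * ?q) * \<alpha> - of_int (int l * round (?r * \<alpha>))\<bar> < \<tau>"
  proof -
    have "real (l * ?q) * \<alpha> - of_int (int l * round (?r * \<alpha>)) = real l * \<delta>"
      unfolding \<delta>_def d_def by (simp add: algebra_simps)
    then have "\<bar>real (l * ?q) * \<alpha> - of_int (int l * round (?r * \<alpha>))\<bar> = real l * \<bar>\<delta>\<bar>"
      by (simp add: abs_mult)
    also have "\<dots> \<le> 1 / ?r" using lqd q by (simp add: field_simps)
    also have "\<dots> < \<tau>" by (rule N[OF n])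
    finally show ?thesis .
  qed
  have "\<bar>real l * \<sigma> - (v + 0)\<bar> < \<tau> \<or> \<bar>real l * \<sigma> - (- v + 0)\<bar> < \<tau>"
    using l\<sigma> \<sigma>\<tau> \<tau> by (cases "\<sigma> \<ge> 0") auto
  then show ?case
    using close Yb Ym val
    by (intro exI[of _ "l * ?q"] exI[of _ "int l * round (?r * \<alpha>)"] exI[of _ Y]) auto
qed auto

lemma unit_period:
  assumes \<beta>: "\<And>k::int. idist (\<beta> - of_int k * \<alpha>) \<noteq> 0"
  shows "period (vec2 0 1)"
proof (cases "\<exists>c>0. \<forall>N. \<exists>n\<ge>N. \<forall>k::int. \<bar>of_int k\<bar> \<le> 3/4 * rden n \<longrightarrow> c / rden n \<le> idist (\<beta> - of_int k * \<alpha>)")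
  case True
  then obtain c where c: "c > 0"
    "\<And>N. \<exists>n\<ge>N. \<forall>k::int. \<bar>of_int k\<bar> \<le> 3/4 * rden n \<longrightarrow> c / rden n \<le> idist (\<beta> - of_int k * \<alpha>)" by blast
  show ?thesis
  proof (rule unit_period_if_separated[of "min c (1/2)"])
    have "min c (1/2) / rden n \<le> c / rden n" for n by (rule divide_right_mono) auto
    then show "\<exists>n\<ge>N. \<forall>k::int. \<bar>of_int k\<bar> \<le> 3/4 * rden n \<longrightarrow> min c (1/2) / rden n \<le> idist (\<beta> - of_int k * \<alpha>)" for N
      using c(2)[of N] order_trans by blast
  qed (use c in auto)
next
  case False
  then have app: "\<forall>c>0. \<exists>N. \<forall>n\<ge>N. \<exists>k::int. \<bar>of_int k\<bar> \<le> 3/4 * rden n \<and> idist (\<beta> - of_int k * \<alpha>) < c / rden n"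
    by (meson not_le)
  have "period (vec2 0 (1/256))"
    by (rule vertical_period_if_approximable[OF \<beta> app]) auto
  from period_scale_nat[OF this, of 256] show ?thesis by (simp add: vec2_arith)
qed

text \<open>The uncontrolled integer parts of the sums are absorbed by the period
  \<open>vec2 0 1\<close>, so every starting point may be used and no discontinuity has to be
  avoided.\<close>

lemma vertical_period_if_simultaneous:
  assumes one: "period (vec2 0 1)"
    and sim: "\<And>\<tau>. \<tau> > 0 \<Longrightarrow> \<exists>(n::int) (m::int) (m'::int). \<bar>of_int n * \<alpha> - of_int m\<bar> < \<tau> \<and> \<bar>of_int n * \<beta> - of_int m' - v\<bar> < \<tau>"
  shows "period (vec2 0 v)"
proof (rule period_if_constant_differences[of \<int> 1], goal_cases)
  case (2 p)
  then obtain j where j: "p = of_int j" by (rule Ints_cases)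
  show ?case using period_scale_int[OF one, of j] by (simp add: j vec2_arith)
next
  case (4 \<tau>)
  then obtain n m m' :: int where nm: "\<bar>of_int n * \<alpha> - of_int m\<bar> < \<tau>" "\<bar>of_int n * \<beta> - of_int m' - v\<bar> < \<tau>"
    using sim by blast
  have diff: "\<exists>j::int. psi_sum \<alpha> t (x + \<beta>) - psi_sum \<alpha> t x = real t * \<beta> + of_int j" for t x
  proof (induction t)
    case (Suc t)
    then obtain j :: int where j: "psi_sum \<alpha> t (x + \<beta>) - psi_sum \<alpha> t x = real t * \<beta> + of_int j" by blast
    have "psi (x + \<beta> + real t * \<alpha>) - psi (x + real t * \<alpha>) = \<beta> + of_int (\<lfloor>x + real t * \<alpha>\<rfloor> - \<lfloor>x + \<beta> + real t * \<alpha>\<rfloor>)"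
      unfolding psi_def frac_def by simp
    then have "psi_sum \<alpha> (Suc t) (x + \<beta>) - psi_sum \<alpha> (Suc t) x
        = real (Suc t) * \<beta> + of_int (j + (\<lfloor>x + real t * \<alpha>\<rfloor> - \<lfloor>x + \<beta> + real t * \<alpha>\<rfloor>))"
      unfolding birkhoff_sum_Suc using j by (simp add: algebra_simps)
    then show ?case by blast
  qed (auto simp: birkhoff_sum_def intro: exI[of _ 0])
  show ?case
  proof (cases "n \<ge> 0")
    case True
    have "\<exists>p\<in>\<int>. \<bar>psi_sum \<alpha> (nat n) (x + \<beta>) - psi_sum \<alpha> (nat n) x - (v + p)\<bar> < \<tau>" for x
    proof -
      obtain j :: int where "psi_sum \<alpha> (nat n) (x + \<beta>) - psi_sum \<alpha> (nat n) x = real (nat n) * \<beta> + of_int j"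
        using diff by blast
      then show ?thesis using nm(2) True by (intro bexI[of _ "of_int (m' + j)"]) auto
    qed
    then show ?thesis using nm(1) True by (intro exI[of _ "nat n"] exI[of _ m] exI[of _ UNIV]) auto
  next
    case False
    \<comment> \<open>Sums have nonnegative length; for n < 0 the time -n returns as closely and
      produces -v, which the sign alternative admits.\<close>
    have "\<exists>p\<in>\<int>. \<bar>psi_sum \<alpha> (nat (- n)) (x + \<beta>) - psi_sum \<alpha> (nat (- n)) x - (- v + p)\<bar> < \<tau>" for x
    proof -
      obtain j :: int where "psi_sum \<alpha> (nat (- n)) (x + \<beta>) - psi_sum \<alpha> (nat (- n)) x = real (nat (- n)) * \<beta> + of_int j"
        using diff by blast
      then show ?thesis using nm(2) False by (intro bexI[of _ "of_int (j - m')"]) auto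
    qed
    then show ?thesis using nm(1) False by (intro exI[of _ "nat (- n)"] exI[of _ "- m"] exI[of _ UNIV]) auto
  qed
qed (auto simp: countable_int)

end

section \<open>Haar measures on closed subgroups\<close>

text \<open>Stability under intersections makes measures that agree on \<open>\<U>\<close> equal,
  boundedness gives finite mass and compactly supported cutoffs, and countability allows one null
  set for all of \<open>\<U>\<close>. Intersecting a basis with balls and then closing under finite
  intersections achieves all three.\<close>

lemma countable_bounded_Int_stable_basis:
  obtains \<U> :: "'a::euclidean_space set set" where "countable \<U>" "\<And>U. U \<in> \<U> \<Longrightarrow> open U \<and> bounded U"
    "Int_stable \<U>" "sets borel = sigma_sets UNIV \<U>" "\<Union>\<U> = UNIV"
proof -
  obtain \<B> :: "'a set set" where \<B>: "countable \<B>" "topological_basis \<B>" using ex_countable_basis by blast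
  define \<C> where "\<C> = (\<lambda>(B, n). B \<inter> ball 0 (real n)) ` (\<B> \<times> (UNIV :: nat set))"
  define \<U> where "\<U> = Inter ` {F. finite F \<and> F \<subseteq> \<C> \<and> F \<noteq> {}}"
  have "countable \<C>" unfolding \<C>_def using \<B>(1) by (intro countable_image countable_SIGMA) auto
  then have "countable {F. finite F \<and> F \<subseteq> \<C>}" by (rule countable_Collect_finite_subset)
  then have "countable {F. finite F \<and> F \<subseteq> \<C> \<and> F \<noteq> {}}"
    by (rule countable_subset[rotated]) blast
  then have cU: "countable \<U>" unfolding \<U>_def by (rule countable_image)
  have \<C>: "open C \<and> bounded C" if "C \<in> \<C>" for C
    using that topological_basis_open[OF \<B>(2)] unfolding \<C>_def by (auto intro: bounded_Int)
  have oU: "open U \<and> bounded U" if U: "U \<in> \<U>" for U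
  proof -
    obtain F where F: "finite F" "F \<subseteq> \<C>" "F \<noteq> {}" "U = \<Inter>F" using U unfolding \<U>_def by blast
    obtain C where C: "C \<in> F" using F(3) by blast
    have "bounded U" by (rule bounded_subset[of C]) (use C F \<C> in auto)
    moreover have "open U" unfolding F(4) using F(1,2) \<C> by (intro open_Inter) auto
    ultimately show ?thesis by blast
  qed
  have IU: "Int_stable \<U>"
  proof (rule Int_stableI)
    fix U V assume "U \<in> \<U>" "V \<in> \<U>"
    then obtain F G where "finite F" "F \<subseteq> \<C>" "F \<noteq> {}" "U = \<Inter>F" "finite G" "G \<subseteq> \<C>" "V = \<Inter>G"
      unfolding \<U>_def by blast
    then show "U \<inter> V \<in> \<U>" unfolding \<U>_def by (intro image_eqI[of _ _ "F \<union> G"]) auto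
  qed
  have \<C>\<U>: "C \<in> \<U>" if "C \<in> \<C>" for C
    unfolding \<U>_def by (rule image_eqI[of _ _ "{C}"]) (use that in auto)
  have near: "\<exists>U\<in>\<U>. x \<in> U \<and> U \<subseteq> W" if "open W" "x \<in> W" for W x
  proof -
    obtain B where B: "B \<in> \<B>" "x \<in> B" "B \<subseteq> W" using topological_basisE[OF \<B>(2) \<open>open W\<close> \<open>x \<in> W\<close>] by blast
    obtain n :: nat where "norm x < real n" using reals_Archimedean2 by blast
    moreover have "B \<inter> ball 0 (real n) \<in> \<C>" unfolding \<C>_def using B(1) by auto
    ultimately show ?thesis using B \<C>\<U> by (intro bexI[of _ "B \<inter> ball 0 (real n)"]) auto
  qed
  have "topological_basis \<U>" by (rule topological_basisI) (use oU near in auto)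
  then have "borel = sigma UNIV \<U>" using borel_eq_countable_basis[OF cU] by simp
  then have "sets borel = sets (sigma UNIV \<U>)" by (rule arg_cong)
  also have "\<dots> = sigma_sets UNIV \<U>" by (rule sets_measure_of) simp
  finally have "sets borel = sigma_sets UNIV \<U>" .
  moreover have "\<Union>\<U> = UNIV" using near[OF open_UNIV] by blast
  ultimately show thesis using that cU oU IU by blast
qed

lemma open_cutoff_lipschitz:
  fixes U :: "'a::metric_space set"
  shows "\<bar>min 1 (real n * infdist y (- U)) - min 1 (real n * infdist z (- U))\<bar> \<le> real n * dist y z"
proof -
  have "\<bar>real n * infdist y (- U) - real n * infdist z (- U)\<bar> \<le> real n * dist y z"
    using infdist_triangle_abs[of y "- U" z] by (simp add: right_diff_distrib[symmetric] abs_mult mult_left_mono)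
  then show ?thesis by linarith
qed

lemma open_cutoff_SUP:
  fixes U :: "'a::euclidean_space set"
  assumes U: "open U" "bounded U"
  shows "(SUP n. ennreal (min 1 (real n * infdist y (- U)))) = indicator U y"
proof (cases "y \<in> U")
  case True
  \<comment> \<open>By convention \<open>infdist\<close> to the empty set is 0, so the complement
    must be nonempty for the cutoffs to reach 1.\<close>
  have "U \<noteq> UNIV" using U(2) not_bounded_UNIV by metis
  then have "- U \<noteq> {}" by blast
  then have pos: "infdist y (- U) > 0" using True U(1) by (intro infdist_pos_not_in_closed) auto
  obtain n where n: "1 / infdist y (- U) < real n" using reals_Archimedean2 by blast
  then have "min 1 (real n * infdist y (- U)) = 1" using pos by (simp add: field_simps)
  then have "1 \<le> (SUP n. ennreal (min 1 (real n * infdist y (- U))))" by (intro SUP_upper2[of n]) auto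
  moreover have "(SUP n. ennreal (min 1 (real n * infdist y (- U)))) \<le> 1" by (intro SUP_least) auto
  ultimately show ?thesis using True by simp
qed simp

locale haar_subgroup =
  fixes H :: "(real ^ 'm) set" and N :: "(real ^ 'm) measure"
  assumes subgroup: "closed_subgroup H" and haar: "haar_measure_on H N"
begin

lemma closed_H: "closed H" and zero_H: "0 \<in> H" and add_H: "g \<in> H \<Longrightarrow> h \<in> H \<Longrightarrow> g + h \<in> H"
  and minus_H: "h \<in> H \<Longrightarrow> - h \<in> H"
  using subgroup unfolding closed_subgroup_def by auto

lemma diff_H: "g \<in> H \<Longrightarrow> h \<in> H \<Longrightarrow> g - h \<in> H"
  using add_H[OF _ minus_H] by simp

lemma space_N [simp]: "space N = H" and sets_N: "sets N = sets (restrict_space borel H)"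
  and N_translate: "h \<in> H \<Longrightarrow> A \<in> sets N \<Longrightarrow> emeasure N ((\<lambda>y. h + y) ` A) = emeasure N A"
  and N_compact: "compact K \<Longrightarrow> K \<subseteq> H \<Longrightarrow> emeasure N K < \<infinity>"
  using haar unfolding haar_measure_on_def by auto

lemma sets_N_iff: "A \<in> sets N \<longleftrightarrow> A \<subseteq> H \<and> A \<in> sets borel"
  unfolding sets_N using closed_H by (subst sets_restrict_space_iff) auto

lemma measurable_N_id [measurable]: "(\<lambda>x. x) \<in> N \<rightarrow>\<^sub>M borel"
  using sets_N by (subst measurable_cong_sets[OF sets_N refl]) (rule measurable_restrict_space1, simp)

lemma measurable_into_N:
  assumes "f \<in> borel_measurable M" "\<And>x. x \<in> space M \<Longrightarrow> f x \<in> H" shows "f \<in> M \<rightarrow>\<^sub>M N"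
  by (subst measurable_cong_sets[OF refl sets_N]) (rule measurable_restrict_space2, use assms in auto)

lemma translate_measurable [measurable]: "h \<in> H \<Longrightarrow> (\<lambda>y. y + h) \<in> N \<rightarrow>\<^sub>M N"
  by (rule measurable_into_N) (auto intro: add_H)

lemma emeasure_translate_vimage:
  assumes h: "h \<in> H" and A: "A \<in> sets N"
  shows "emeasure N ((\<lambda>y. y + h) -` A \<inter> H) = emeasure N A"
proof -
  have "(\<lambda>y. y + h) -` A \<inter> H = (\<lambda>y. - h + y) ` A"
  proof (intro set_eqI iffI)
    fix y assume "y \<in> (\<lambda>y. y + h) -` A \<inter> H"
    then show "y \<in> (\<lambda>y. - h + y) ` A" by (intro image_eqI[of _ _ "y + h"]) auto
  next
    fix y assume "y \<in> (\<lambda>y. - h + y) ` A"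
    then obtain z where "z \<in> A" "y = - h + z" by blast
    moreover from this have "z \<in> H" using A sets_N_iff by blast
    ultimately show "y \<in> (\<lambda>y. y + h) -` A \<inter> H" using diff_H[OF _ h, of z] by simp
  qed
  then show ?thesis using N_translate[OF minus_H[OF h] A] by simp
qed

lemma distr_translate: "h \<in> H \<Longrightarrow> distr N N (\<lambda>y. y + h) = N"
  by (rule measure_eqI) (auto simp: emeasure_distr emeasure_translate_vimage)

sublocale N: sigma_finite_measure N
proof
  have "emeasure N (H \<inter> cball 0 (real n)) \<noteq> \<infinity>" for n
    using N_compact[of "H \<inter> cball 0 (real n)"] by (simp add: closed_H closed_Int_compact less_top)
  moreover have "(\<Union>n. H \<inter> cball 0 (real n)) = H"
  proof -
    have "x \<in> (\<Union>n. H \<inter> cball 0 (real n))" if "x \<in> H" for x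
    proof -
      obtain n :: nat where "norm x < real n" using reals_Archimedean2 by blast
      then show ?thesis using that by (intro UN_I[of n]) auto
    qed
    then show ?thesis by auto
  qed
  moreover have "H \<inter> cball 0 (real n) \<in> sets N" for n unfolding sets_N_iff using closed_H by auto
  ultimately show "\<exists>A. countable A \<and> A \<subseteq> sets N \<and> \<Union>A = space N \<and> (\<forall>a\<in>A. emeasure N a \<noteq> \<infinity>)"
    by (intro exI[of _ "range (\<lambda>n. H \<inter> cball 0 (real n))"]) auto
qed

text \<open>Translating by a point of \<open>H\<close> in the ball moves its trace on
  \<open>H\<close> into the ball around 0. The bound is uniform over all centres, also those outside
  \<open>H\<close>.\<close>

lemma emeasure_ball_le: "emeasure N (H \<inter> cball z R) \<le> emeasure N (H \<inter> cball 0 (2 * R))"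
proof (cases "H \<inter> cball z R = {}")
  case False
  then obtain h where h: "h \<in> H" "dist z h \<le> R" by auto
  have "emeasure N (H \<inter> cball z R) \<le> emeasure N ((\<lambda>y. y + - h) -` (H \<inter> cball 0 (2 * R)) \<inter> H)"
  proof (rule emeasure_mono)
    show "H \<inter> cball z R \<subseteq> (\<lambda>y. y + - h) -` (H \<inter> cball 0 (2 * R)) \<inter> H"
    proof
      fix y assume y: "y \<in> H \<inter> cball z R"
      have "norm (y - h) \<le> dist z y + dist z h" using dist_triangle3[of y h z] by (simp add: dist_norm)
      then show "y \<in> (\<lambda>y. y + - h) -` (H \<inter> cball 0 (2 * R)) \<inter> H" using y h diff_H[of y h] by auto
    qed
    show "(\<lambda>y. y + - h) -` (H \<inter> cball 0 (2 * R)) \<inter> H \<in> sets N"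
      using measurable_sets[OF translate_measurable[OF minus_H[OF h(1)]], of "H \<inter> cball 0 (2 * R)"] closed_H
      by (auto simp: sets_N_iff)
  qed
  also have "\<dots> = emeasure N (H \<inter> cball 0 (2 * R))"
    by (rule emeasure_translate_vimage[OF minus_H[OF h(1)]]) (use closed_H in \<open>auto simp: sets_N_iff\<close>)
  finally show ?thesis .
qed simp

lemma emeasure_ball_finite: "emeasure N (H \<inter> cball z R) < \<infinity>"
  by (rule N_compact) (auto simp: closed_H closed_Int_compact)

text \<open>As on the circle: Fubini for the pairs (y, h) with y in \<open>B\<close> and y + h
  outside \<open>B\<close> gives 0 in one order and the product of the measures of \<open>B\<close>
  and \<open>H - B\<close> in the other.\<close>

lemma null_or_conull_if_translates:
  assumes B: "B \<in> sets N" and 0: "\<And>h. h \<in> H \<Longrightarrow> emeasure N {y \<in> B. y + h \<notin> B} = 0"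
  shows "emeasure N B = 0 \<or> emeasure N (H - B) = 0"
proof -
  interpret NN: pair_sigma_finite N N ..
  have [measurable]: "fst \<in> N \<Otimes>\<^sub>M N \<rightarrow>\<^sub>M borel" "snd \<in> N \<Otimes>\<^sub>M N \<rightarrow>\<^sub>M borel"
    using measurable_compose[OF measurable_fst measurable_N_id, of N]
      measurable_compose[OF measurable_snd measurable_N_id, of N] by simp_all
  have [measurable]: "B \<in> sets borel" using B sets_N_iff by blast
  have [measurable]: "H - B \<in> sets borel" using closed_H by auto
  let ?f = "\<lambda>(y, h). indicator B y * indicator (H - B) (y + h) :: ennreal"
  have fm: "?f \<in> borel_measurable (N \<Otimes>\<^sub>M N)" unfolding case_prod_beta' by measurable
  have 1: "(\<integral>\<^sup>+ y. ?f (y, h) \<partial>N) = 0" if h: "h \<in> H" for h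
  proof -
    have "{y \<in> B. y + h \<notin> B} = B - ((\<lambda>y. y + h) -` B \<inter> H)" using B sets_N_iff by auto
    then have m: "{y \<in> B. y + h \<notin> B} \<in> sets N"
      using measurable_sets[OF translate_measurable[OF h] B] B by auto
    have "(\<integral>\<^sup>+ y. ?f (y, h) \<partial>N) = (\<integral>\<^sup>+ y. indicator {y \<in> B. y + h \<notin> B} y \<partial>N)"
      by (rule nn_integral_cong) (use h in \<open>auto simp: add_H split: split_indicator\<close>)
    also have "\<dots> = 0" using m 0[OF h] by simp
    finally show ?thesis .
  qed
  have 2: "(\<integral>\<^sup>+ h. ?f (y, h) \<partial>N) = indicator B y * emeasure N (H - B)" if y: "y \<in> H" for y
  proof -
    have HB: "H - B \<in> sets N" using B sets.compl_sets[of B N] by simp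
    have "(\<integral>\<^sup>+ h. ?f (y, h) \<partial>N) = (\<integral>\<^sup>+ h. indicator B y * indicator ((\<lambda>h. h + y) -` (H - B) \<inter> H) h \<partial>N)"
      by (rule nn_integral_cong) (auto simp: add.commute split: split_indicator)
    also have "\<dots> = indicator B y * emeasure N ((\<lambda>h. h + y) -` (H - B) \<inter> H)"
      using measurable_sets[OF translate_measurable[OF y] HB] by (intro nn_integral_cmult_indicator) simp
    finally show ?thesis using emeasure_translate_vimage[OF y HB] by simp
  qed
  have "(\<integral>\<^sup>+ y. indicator B y * emeasure N (H - B) \<partial>N) = (\<integral>\<^sup>+ y. \<integral>\<^sup>+ h. ?f (y, h) \<partial>N \<partial>N)"
    by (rule nn_integral_cong) (use 2 in simp)
  also have "\<dots> = (\<integral>\<^sup>+ h. \<integral>\<^sup>+ y. ?f (y, h) \<partial>N \<partial>N)" using NN.Fubini[OF fm] by simp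
  also have "\<dots> = (\<integral>\<^sup>+ h. 0 \<partial>N)" by (rule nn_integral_cong) (use 1 in simp)
  finally have "(\<integral>\<^sup>+ y. emeasure N (H - B) * indicator B y \<partial>N) = 0" by (simp add: mult.commute)
  then show ?thesis using B by (auto simp: nn_integral_cmult_indicator)
qed

text \<open>The measures \<open>N (B \<inter> E)\<close> and \<open>N (B \<inter> (E - h))\<close> of \<open>E\<close> agree on a generator, hence everywhere, in
  particular on the complement of \<open>B\<close>.\<close>
lemma null_or_conull_if_cutoffs:
  assumes \<U>: "\<And>U. U \<in> \<U> \<Longrightarrow> open U \<and> bounded U" "Int_stable \<U>" "sets borel = sigma_sets UNIV \<U>"
    "\<Union>\<U> = UNIV" "countable \<U>"
    and B: "B \<in> sets N"
    and eq: "\<And>h U n. h \<in> H \<Longrightarrow> U \<in> \<U> \<Longrightarrow>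
      (\<integral>\<^sup>+ y. indicator B y * ennreal (min 1 (real n * infdist (y + h) (- U))) \<partial>N)
      = (\<integral>\<^sup>+ y. indicator B y * ennreal (min 1 (real n * infdist y (- U))) \<partial>N)"
  shows "emeasure N B = 0 \<or> emeasure N (H - B) = 0"
proof (rule null_or_conull_if_translates[OF B])
  fix h assume h: "h \<in> H"
  have Bb [measurable]: "B \<in> sets borel" and BH: "B \<subseteq> H" using B sets_N_iff by auto
  define M where "M v = distr (density N (indicator B)) borel (\<lambda>y. y + v)" for v :: "real ^ 'm"
  have M: "emeasure (M v) E = (\<integral>\<^sup>+ y. indicator B y * indicator E (y + v) \<partial>N)" if [measurable]: "E \<in> sets borel" for v E
  proof -
    have "emeasure (M v) E = emeasure (density N (indicator B)) ((\<lambda>y. y + v) -` E \<inter> H)"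
      unfolding M_def by (subst emeasure_distr) auto
    also have "\<dots> = (\<integral>\<^sup>+ y. indicator B y * indicator ((\<lambda>y. y + v) -` E \<inter> H) y \<partial>N)"
    proof (rule emeasure_density)
      show "(\<lambda>y. y + v) -` E \<inter> H \<in> sets N" using measurable_sets[of "\<lambda>y. y + v" N borel E] by simp
    qed (use B in measurable)
    also have "\<dots> = (\<integral>\<^sup>+ y. indicator B y * indicator E (y + v) \<partial>N)"
      by (rule nn_integral_cong) (auto split: split_indicator)
    finally show ?thesis .
  qed
  have cut: "(\<integral>\<^sup>+ y. indicator B y * indicator U (y + v) \<partial>N)
      = (SUP n. \<integral>\<^sup>+ y. indicator B y * ennreal (min 1 (real n * infdist (y + v) (- U))) \<partial>N)" if U: "U \<in> \<U>" for U v
  proof -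
    have cm: "(\<lambda>y. infdist (y + v) (- U)) \<in> borel_measurable N"
    proof -
      have "continuous_on UNIV (\<lambda>y. infdist (y + v) (- U))" by (intro continuous_intros)
      then show ?thesis
        using measurable_compose[OF measurable_N_id borel_measurable_continuous_onI] by blast
    qed
    have "(\<integral>\<^sup>+ y. indicator B y * indicator U (y + v) \<partial>N)
      = (\<integral>\<^sup>+ y. (SUP n. indicator B y * ennreal (min 1 (real n * infdist (y + v) (- U)))) \<partial>N)"
      using \<U>(1)[OF U] by (intro nn_integral_cong) (simp add: open_cutoff_SUP[symmetric] SUP_mult_left_ennreal)
    also have "\<dots> = (SUP n. \<integral>\<^sup>+ y. indicator B y * ennreal (min 1 (real n * infdist (y + v) (- U))) \<partial>N)"
    proof (rule nn_integral_monotone_convergence_SUP)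
      show "incseq (\<lambda>n y. indicator B y * ennreal (min 1 (real n * infdist (y + v) (- U))))"
        by (auto simp: incseq_def le_fun_def intro!: mult_left_mono ennreal_leI min.mono mult_right_mono infdist_nonneg)
      show "(\<lambda>y. indicator B y * ennreal (min 1 (real n * infdist (y + v) (- U)))) \<in> borel_measurable N" for n
        using cm B by measurable
    qed
    finally show ?thesis .
  qed
  have "M h = M 0"
  proof (rule measure_eqI_generator_eq_countable[where E = \<U> and A = \<U> and \<Omega> = UNIV])
    fix U assume U: "U \<in> \<U>"
    then have Um: "U \<in> sets borel" using \<U>(1) by auto
    show "emeasure (M h) U = emeasure (M 0) U"
      unfolding M[OF Um] cut[OF U] using eq[OF h U] by simp
    obtain R where R: "\<forall>y\<in>U. norm y \<le> R" using \<U>(1)[OF U] bounded_iff by metis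
    have "emeasure (M h) U \<le> (\<integral>\<^sup>+ y. indicator (H \<inter> cball (- h) R) y \<partial>N)"
      unfolding M[OF Um]
    proof (rule nn_integral_mono)
      fix y assume "y \<in> space N"
      moreover have "dist (- h) y = norm (y + h)" by (simp add: dist_norm norm_minus_commute add.commute)
      moreover have "y + h \<in> U \<Longrightarrow> norm (y + h) \<le> R" using R by blast
      ultimately show "indicator B y * indicator U (y + h) \<le> (indicator (H \<inter> cball (- h) R) y :: ennreal)"
        by (auto split: split_indicator)
    qed
    also have "\<dots> = emeasure N (H \<inter> cball (- h) R)"
      by (rule nn_integral_indicator) (use closed_H in \<open>auto simp: sets_N_iff\<close>)
    also have "\<dots> < \<infinity>" by (rule emeasure_ball_finite)
    finally show "emeasure (M h) U \<noteq> \<infinity>" by simp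
  qed (use \<U> in \<open>auto simp: M_def\<close>)
  \<comment> \<open>\<open>M 0\<close> is carried by \<open>B\<close>, whereas \<open>M h\<close>
    gives to \<open>- B\<close> the mass that \<open>h\<close> moves out of
    \<open>B\<close>.\<close>
  then have "emeasure (M h) (- B) = emeasure (M 0) (- B)" by simp
  also have "\<dots> = (\<integral>\<^sup>+ y. 0 \<partial>N)"
  proof -
    have "indicator B y * indicator (- B) (y + 0) = (0 :: ennreal)" for y
      by (simp split: split_indicator)
    then show ?thesis by (subst M) (simp_all only: borel_comp Bb)
  qed
  finally have "(\<integral>\<^sup>+ y. indicator B y * indicator (- B) (y + h) \<partial>N) = 0" by (subst (asm) M) auto
  moreover have "(\<integral>\<^sup>+ y. indicator B y * indicator (- B) (y + h) \<partial>N) = (\<integral>\<^sup>+ y. indicator {y \<in> B. y + h \<notin> B} y \<partial>N)"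
    by (rule nn_integral_cong) (auto split: split_indicator)
  moreover have "{y \<in> B. y + h \<notin> B} \<in> sets N"
  proof -
    have "{y \<in> B. y + h \<notin> B} = B - ((\<lambda>y. y + h) -` B \<inter> H)" using BH by auto
    then show ?thesis using measurable_sets[OF translate_measurable[OF h] B] B by auto
  qed
  ultimately show "emeasure N {y \<in> B. y + h \<notin> B} = 0" by simp
qed

end

section \<open>Ergodicity of skew products\<close>

lemma space_circle [simp]: "space circle = {0..<1}"
  unfolding circle_def by (simp add: space_restrict_space)

lemma sets_circle_iff: "A \<in> sets circle \<longleftrightarrow> A \<subseteq> {0..<1} \<and> A \<in> sets borel"
  unfolding circle_def by (subst sets_restrict_space_iff) auto

lemma measurable_circle_id [measurable]: "(\<lambda>x. x) \<in> circle \<rightarrow>\<^sub>M borel"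
  unfolding circle_def by (rule measurable_restrict_space1) simp

lemma measurable_circle_borel: "f \<in> borel_measurable borel \<Longrightarrow> f \<in> borel_measurable circle"
  using measurable_compose[OF measurable_circle_id] by simp

lemma frac_measurable_circle [measurable]: "frac \<in> borel \<rightarrow>\<^sub>M circle"
  unfolding circle_def
  by (rule measurable_restrict_space2) (auto simp: frac_lt_1)

lemma rotation_measurable [measurable]: "rotation \<alpha> \<in> circle \<rightarrow>\<^sub>M circle"
proof -
  have "(\<lambda>x. frac (x + \<alpha>)) \<in> circle \<rightarrow>\<^sub>M circle"
    by (rule measurable_compose[OF _ frac_measurable_circle]) measurable
  then show ?thesis by (simp add: rotation_def[abs_def])
qed

lemma emeasure_circle: "A \<subseteq> {0..<1} \<Longrightarrow> emeasure circle A = emeasure lborel A"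
  unfolding circle_def by (subst emeasure_restrict_space) auto

lemma distr_rotation: "distr circle circle (rotation \<alpha>) = circle"
proof (rule measure_eqI)
  fix A assume "A \<in> sets (distr circle circle (rotation \<alpha>))"
  then have A: "A \<in> sets circle" "A \<subseteq> {0..<1}" "A \<in> sets borel" by (auto simp: sets_circle_iff)
  define S where "S = frac -` A"
  have S: "S \<in> sets borel" unfolding S_def using borel_vimage[OF borel_measurable_frac A(3)] .
  have pS: "periodic_set S" unfolding periodic_set_def S_def by (simp add: frac_1_eq)
  have "emeasure (distr circle circle (rotation \<alpha>)) A = emeasure circle (rotation \<alpha> -` A \<inter> {0..<1})"
    using A by (simp add: emeasure_distr)
  also have "rotation \<alpha> -` A \<inter> {0..<1} = (\<lambda>x. x + \<alpha>) -` S \<inter> {0..<1}"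
    unfolding rotation_def S_def by auto
  also have "emeasure circle \<dots> = emeasure lborel (S \<inter> {0..<1})"
    using emeasure_periodic_translate[OF S pS] by (simp add: emeasure_circle)
  also have "S \<inter> {0..<1} = A" unfolding S_def using A(2) by auto
  finally show "emeasure (distr circle circle (rotation \<alpha>)) A = emeasure circle A"
    using A by (simp add: emeasure_circle)
qed simp

lemma AE_circle: "(AE x in lborel. P x) \<Longrightarrow> AE x in circle. P x"
  unfolding circle_def by (subst AE_restrict_space_iff) auto

text \<open>The equation between the cocycles and the membership in \<open>H\<close> hold at every
  point, so that the smoothed set is invariant without exceptions. Values in \<open>H\<close> are
  what makes the translation by \<open>\<Psi> x\<close> preserve \<open>N\<close>.\<close>

locale skew_extension = haar_subgroup H N for H :: "(real ^ 'm) set" and N +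
  fixes \<alpha> :: real and \<Phi> \<Psi> f :: "real \<Rightarrow> real ^ 'm"
  assumes irrational: "\<alpha> \<notin> \<rat>"
    and \<Psi>_borel: "\<Psi> \<in> borel_measurable borel" and f_borel: "f \<in> borel_measurable borel"
    and \<Psi>_periodic: "\<Psi> (x + 1) = \<Psi> x" and f_periodic: "f (x + 1) = f x" and \<Phi>_periodic: "\<Phi> (x + 1) = \<Phi> x"
    and \<Psi>_in_H: "\<Psi> x \<in> H"
    and cobounding: "\<Phi> x - \<Psi> x = f x - f (x + \<alpha>)"
begin

lemma periodic_fun_frac:
  assumes "\<And>x. F (x + 1) = F x" shows "F (frac x) = F (x::real)"
proof -
  have "periodic_set {y. F y = F x}" unfolding periodic_set_def using assms by simp
  from periodic_set_frac[OF this, of x] show ?thesis by simp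
qed

abbreviation "M \<equiv> circle \<Otimes>\<^sub>M N"
abbreviation "S \<equiv> skew_product (rotation \<alpha>) \<Psi>"

lemma space_M: "space M = {0..<1} \<times> H"
  by (simp add: space_pair_measure)

lemma S_apply: "S (x, h) = (rotation \<alpha> x, h + \<Psi> x)"
  by (simp add: skew_product_def)

lemma S_measurable: "S \<in> M \<rightarrow>\<^sub>M M"
proof -
  have snd: "snd \<in> M \<rightarrow>\<^sub>M borel" using measurable_compose[OF measurable_snd measurable_N_id, of circle] by simp
  have "\<Psi> \<in> borel_measurable circle" by (rule measurable_circle_borel[OF \<Psi>_borel])
  then have "(\<lambda>z. \<Psi> (fst z)) \<in> M \<rightarrow>\<^sub>M borel" by (rule measurable_compose[OF measurable_fst])
  then have "(\<lambda>z. snd z + \<Psi> (fst z)) \<in> M \<rightarrow>\<^sub>M N"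
    by (intro measurable_into_N borel_measurable_add snd) (auto simp: space_M intro: add_H \<Psi>_in_H)
  moreover have "(\<lambda>z. rotation \<alpha> (fst z)) \<in> M \<rightarrow>\<^sub>M circle"
    by (rule measurable_compose[OF measurable_fst rotation_measurable])
  ultimately have "(\<lambda>z. (rotation \<alpha> (fst z), snd z + \<Psi> (fst z))) \<in> M \<rightarrow>\<^sub>M M" by (rule measurable_Pair[rotated])
  then show ?thesis unfolding skew_product_def case_prod_beta' .
qed

lemma section_sets: "A \<in> sets M \<Longrightarrow> Pair x -` A \<in> sets N"
  by (rule sets_Pair1)

lemma distr_S: "distr M M S = M"
proof (rule measure_eqI)
  fix A assume "A \<in> sets (distr M M S)"
  then have A: "A \<in> sets M" by simp
  have m: "(\<lambda>x. emeasure N (Pair x -` A)) \<in> borel_measurable circle"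
    by (rule N.measurable_emeasure_Pair[OF A])
  have "emeasure (distr M M S) A = emeasure M (S -` A \<inter> space M)"
    using A S_measurable by (simp add: emeasure_distr)
  also have "\<dots> = (\<integral>\<^sup>+ x. emeasure N (Pair x -` (S -` A \<inter> space M)) \<partial>circle)"
    by (rule N.emeasure_pair_measure_alt) (rule measurable_sets[OF S_measurable A])
  also have "\<dots> = (\<integral>\<^sup>+ x. emeasure N (Pair (rotation \<alpha> x) -` A) \<partial>circle)"
  proof (rule nn_integral_cong)
    fix x assume x: "x \<in> space circle"
    have "Pair x -` (S -` A \<inter> space M) = (\<lambda>y. y + \<Psi> x) -` (Pair (rotation \<alpha> x) -` A) \<inter> H"
      using x by (auto simp: S_apply space_M)
    then show "emeasure N (Pair x -` (S -` A \<inter> space M)) = emeasure N (Pair (rotation \<alpha> x) -` A)"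
      using emeasure_translate_vimage[OF \<Psi>_in_H section_sets[OF A]] by simp
  qed
  also have "\<dots> = (\<integral>\<^sup>+ x. emeasure N (Pair x -` A) \<partial>distr circle circle (rotation \<alpha>))"
    using m by (subst nn_integral_distr) auto
  also have "\<dots> = emeasure M A" unfolding distr_rotation by (rule N.emeasure_pair_measure_alt[symmetric, OF A])
  finally show "emeasure (distr M M S) A = emeasure M A" .
qed simp

text \<open>The shift by \<open>f x\<close> undoes the passage from \<open>\<Phi>\<close> to \<open>\<Psi>\<close>: a smoothed \<open>\<Psi>\<close>-invariant set is an
  observable for \<open>\<Phi>\<close>, with second argument ranging over the whole space instead of \<open>H\<close>.\<close>
definition smoothing :: "(real \<times> (real ^ 'm)) set \<Rightarrow> (real ^ 'm \<Rightarrow> real) \<Rightarrow> real \<Rightarrow> real ^ 'm \<Rightarrow> real" where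
  "smoothing A \<phi> x w = (\<integral>y. indicator A (frac x, y) * \<phi> (y - w - f x) \<partial>N)"

lemma A_invariant:
  assumes inv: "S -` A \<inter> space M = A" and y: "y \<in> H"
  shows "(frac (x + \<alpha>), y + \<Psi> x) \<in> A \<longleftrightarrow> (frac x, y) \<in> A"
proof -
  have "(frac x, y) \<in> space M" using y by (simp add: space_M frac_lt_1)
  then have "(frac x, y) \<in> A \<longleftrightarrow> S (frac x, y) \<in> A" using inv by blast
  moreover have "S (frac x, y) = (frac (x + \<alpha>), y + \<Psi> x)"
    unfolding S_apply rotation_def using periodic_fun_frac[of \<Psi> x] \<Psi>_periodic by simp
  ultimately show ?thesis by simp
qed

lemma smoothing_integrable:
  fixes \<phi> :: "real ^ 'm \<Rightarrow> real"
  assumes A: "A \<in> sets M" and \<phi>: "\<phi> \<in> borel_measurable borel" "\<And>u. 0 \<le> \<phi> u \<and> \<phi> u \<le> 1" "\<And>u. norm u > R \<Longrightarrow> \<phi> u = 0"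
  shows "integrable N (\<lambda>y. indicator A (frac x, y) * \<phi> (y + z))"
proof (rule integrableI_bounded_set[where A = "H \<inter> cball (- z) R" and B = 1])
  show "H \<inter> cball (- z) R \<in> sets N" using closed_H by (auto simp: sets_N_iff)
  have i: "(\<lambda>y. indicator A (frac x, y) :: real) \<in> borel_measurable N"
  proof -
    have "(\<lambda>y. indicator (Pair (frac x) -` A) y :: real) \<in> borel_measurable N"
      using section_sets[OF A] by (rule borel_measurable_indicator)
    moreover have "(\<lambda>y. indicator (Pair (frac x) -` A) y :: real) = (\<lambda>y. indicator A (frac x, y))"
      by (auto simp: indicator_def)
    ultimately show ?thesis by simp
  qed
  have "(\<lambda>y. \<phi> (y + z)) \<in> borel_measurable N"
    by (rule measurable_compose[OF _ \<phi>(1)]) measurable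
  then show "(\<lambda>y. indicator A (frac x, y) * \<phi> (y + z)) \<in> borel_measurable N"
    using i by measurable
  show "emeasure N (H \<inter> cball (- z) R) < \<infinity>" by (rule emeasure_ball_finite)
  show "AE y in N. y \<in> H \<inter> cball (- z) R \<longrightarrow> norm (indicator A (frac x, y) * \<phi> (y + z)) \<le> 1"
    using \<phi>(2) by (auto simp: abs_mult split: split_indicator)
  show "AE y in N. y \<notin> H \<inter> cball (- z) R \<longrightarrow> indicator A (frac x, y) * \<phi> (y + z) = 0"
  proof (rule AE_I2, rule impI)
    fix y assume y: "y \<in> space N" "y \<notin> H \<inter> cball (- z) R"
    have "dist (- z) y = norm (y + z)" using norm_minus_commute[of "- z" y] by (simp add: dist_norm)
    then have "norm (y + z) > R" using y by auto
    then show "indicator A (frac x, y) * \<phi> (y + z) = 0" using \<phi>(3) by simp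
  qed
qed

text \<open>Substituting \<open>y + \<Psi> x\<close> for \<open>y\<close> preserves
  \<open>N\<close>, and invariance of \<open>A\<close> turns the fibre over
  \<open>x + \<alpha>\<close> into that over \<open>x\<close>; \<open>cobounding\<close> then
  matches the arguments of \<open>\<phi>\<close>. For the Lipschitz bound, the two integrands differ
  only on two balls of radius \<open>R\<close>, whose measure is bounded independently of their
  centres.\<close>

lemma smoothing_invariant_observable:
  assumes A: "A \<in> sets M" and inv: "S -` A \<inter> space M = A"
    and \<phi>: "\<phi> \<in> borel_measurable borel" "\<And>u. 0 \<le> \<phi> u \<and> \<phi> u \<le> 1" "\<And>u. norm u > R \<Longrightarrow> \<phi> u = 0"
    and lip: "\<And>u v. \<bar>\<phi> u - \<phi> v\<bar> \<le> K * dist u v" and K: "K \<ge> 0"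
  shows "\<exists>L. invariant_observable \<alpha> \<Phi> (smoothing A \<phi>) L"
proof -
  define C where "C = measure N (H \<inter> cball 0 (2 * R))"
  have C: "measure N (H \<inter> cball z R) \<le> C" for z
    unfolding C_def measure_def using emeasure_ball_le[of z R] emeasure_ball_finite[of 0 "2 * R"]
    by (intro enn2real_mono) auto
  have C0: "C \<ge> 0" unfolding C_def by simp
  \<comment> \<open>The summand 1 keeps \<open>L\<close> positive when \<open>K\<close> or
    \<open>C\<close> is 0.\<close>
  define L where "L = K * (2 * C) + 1"
  have "invariant_observable \<alpha> \<Phi> (smoothing A \<phi>) L"
  proof
    show "\<alpha> \<notin> \<rat>" by (rule irrational)
    show "smoothing A \<phi> (x + 1) w = smoothing A \<phi> x w" for x w
      unfolding smoothing_def by (simp add: frac_1_eq f_periodic)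
    show "smoothing A \<phi> (x + \<alpha>) (w + \<Phi> x) = smoothing A \<phi> x w" for x w
    proof -
      let ?F = "\<lambda>y. indicator A (frac (x + \<alpha>), y) * \<phi> (y - (w + \<Phi> x) - f (x + \<alpha>))"
      have "?F = (\<lambda>y. indicator A (frac (x + \<alpha>), y) * \<phi> (y + (- f (x + \<alpha>) - (w + \<Phi> x))))" by (simp add: algebra_simps)
      then have Fm: "?F \<in> borel_measurable N"
        using borel_measurable_integrable[OF smoothing_integrable[OF A \<phi>]] by simp
      have "smoothing A \<phi> (x + \<alpha>) (w + \<Phi> x) = integral\<^sup>L (distr N N (\<lambda>y. y + \<Psi> x)) ?F"
        unfolding smoothing_def distr_translate[OF \<Psi>_in_H] ..
      also have "\<dots> = (\<integral>y. ?F (y + \<Psi> x) \<partial>N)"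
        by (rule integral_distr) (use Fm translate_measurable[OF \<Psi>_in_H] in auto)
      also have "\<dots> = smoothing A \<phi> x w" unfolding smoothing_def
      proof (rule Bochner_Integration.integral_cong[OF refl])
        fix y assume y: "y \<in> space N"
        have e1: "y + \<Psi> x - (w + \<Phi> x) - f (x + \<alpha>) = y - w - f x" using cobounding[of x] by (simp add: algebra_simps)
        have e2: "indicator A (frac (x + \<alpha>), y + \<Psi> x) = (indicator A (frac x, y) :: real)"
          using A_invariant[OF inv, of y x] y by (auto simp: indicator_def)
        show "?F (y + \<Psi> x) = indicator A (frac x, y) * \<phi> (y - w - f x)" by (simp only: e1 e2)
      qed
      finally show ?thesis .
    qed
    show "(\<lambda>x. smoothing A \<phi> x w) \<in> borel_measurable borel" for w
      unfolding smoothing_def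
    proof (rule N.borel_measurable_lebesgue_integral)
      have snd: "snd \<in> borel \<Otimes>\<^sub>M N \<rightarrow>\<^sub>M borel" using measurable_compose[OF measurable_snd measurable_N_id, of borel] by simp
      have "(\<lambda>z. (frac (fst z), snd z)) \<in> borel \<Otimes>\<^sub>M N \<rightarrow>\<^sub>M M"
        by (intro measurable_Pair measurable_compose[OF measurable_fst frac_measurable_circle]) measurable
      then have 1: "(\<lambda>z. indicator A (frac (fst z), snd z) :: real) \<in> borel_measurable (borel \<Otimes>\<^sub>M N)"
        by (rule measurable_compose) (use A in measurable)
      have "(\<lambda>z. f (fst z)) \<in> borel \<Otimes>\<^sub>M N \<rightarrow>\<^sub>M borel" by (rule measurable_compose[OF measurable_fst f_borel])
      then have "(\<lambda>z. snd z - w - f (fst z)) \<in> borel \<Otimes>\<^sub>M N \<rightarrow>\<^sub>M borel" using snd by measurable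
      then have "(\<lambda>z. \<phi> (snd z - w - f (fst z))) \<in> borel_measurable (borel \<Otimes>\<^sub>M N)"
        by (rule measurable_compose) (rule \<phi>(1))
      then show "(\<lambda>(x, y). indicator A (frac x, y) * \<phi> (y - w - f x)) \<in> borel_measurable (borel \<Otimes>\<^sub>M N)"
        unfolding case_prod_beta' using 1 by measurable
    qed
    show "L > 0" unfolding L_def using K C0 by (simp add: add_nonneg_pos)
    show "\<bar>smoothing A \<phi> x w - smoothing A \<phi> x w'\<bar> \<le> L * dist w w'" for x w w'
    proof -
      let ?G = "\<lambda>w y. indicator A (frac x, y) * \<phi> (y - w - f x)"
      let ?B = "\<lambda>w. H \<inter> cball (w + f x) R"
      have G: "integrable N (?G w)" for w
        using smoothing_integrable[OF A \<phi>, where x = x and z = "- f x - w"] by (simp add: algebra_simps)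
      have Bs: "?B w \<in> sets N" for w using closed_H by (auto simp: sets_N_iff)
      have Bi: "integrable N (indicator (?B w) :: _ \<Rightarrow> real)" for w
        using Bs emeasure_ball_finite by (intro integrable_real_indicator) auto
      have "\<bar>smoothing A \<phi> x w - smoothing A \<phi> x w'\<bar> = \<bar>\<integral>y. ?G w y - ?G w' y \<partial>N\<bar>"
        unfolding smoothing_def using G by (subst Bochner_Integration.integral_diff) auto
      also have "\<dots> \<le> (\<integral>y. \<bar>?G w y - ?G w' y\<bar> \<partial>N)" by (rule integral_abs_bound)
      also have "\<dots> \<le> (\<integral>y. K * dist w w' * (indicator (?B w) y + indicator (?B w') y) \<partial>N)"
      proof (rule integral_mono)
        show "integrable N (\<lambda>y. \<bar>?G w y - ?G w' y\<bar>)" using G by auto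
        show "integrable N (\<lambda>y. K * dist w w' * (indicator (?B w) y + indicator (?B w') y))" using Bi by auto
        fix y assume y: "y \<in> space N"
        have sup: "\<phi> (y - w - f x) = 0" if "y \<notin> ?B w" for w
        proof -
          have "dist (w + f x) y = norm (y - w - f x)" using norm_minus_commute[of "w + f x" y] by (simp add: dist_norm algebra_simps)
          then show ?thesis using that y \<phi>(3) by auto
        qed
        have "\<bar>?G w y - ?G w' y\<bar> \<le> \<bar>\<phi> (y - w - f x) - \<phi> (y - w' - f x)\<bar>" by (simp split: split_indicator)
        also have "\<dots> \<le> K * dist w w' * (indicator (?B w) y + indicator (?B w') y)"
        proof (cases "y \<in> ?B w \<or> y \<in> ?B w'")
          case True
          have "\<bar>\<phi> (y - w - f x) - \<phi> (y - w' - f x)\<bar> \<le> K * dist (y - w - f x) (y - w' - f x)" by (rule lip)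
          also have "dist (y - w - f x) (y - w' - f x) = dist w w'"
            using norm_minus_commute[of w w'] by (simp add: dist_norm)
          also have "K * dist w w' \<le> K * dist w w' * (indicator (?B w) y + indicator (?B w') y)"
          proof -
            have "1 \<le> indicator (?B w) y + (indicator (?B w') y :: real)" using True by (auto split: split_indicator)
            moreover have "0 \<le> K * dist w w'" using K by simp
            ultimately show ?thesis using mult_left_mono by fastforce
          qed
          finally show ?thesis .
        next
          case False
          then show ?thesis using sup[of w] sup[of w'] by simp
        qed
        finally show "\<bar>?G w y - ?G w' y\<bar> \<le> K * dist w w' * (indicator (?B w) y + indicator (?B w') y)" .
      qed
      also have "\<dots> = K * dist w w' * (measure N (?B w) + measure N (?B w'))"
        using Bi Bs Int_absorb2[of "?B _" H] by (simp add: Bochner_Integration.integral_add)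
      also have "\<dots> \<le> K * dist w w' * (2 * C)"
        using C[of "w + f x"] C[of "w' + f x"] K by (intro mult_left_mono) auto
      also have "\<dots> \<le> L * dist w w'" unfolding L_def by (simp add: algebra_simps)
      finally show ?thesis .
    qed
  qed
  then show ?thesis by blast
qed

end

context skew_extension
begin

lemma smoothing_shift_dense:
  assumes obs: "invariant_observable \<alpha> \<Phi> g L" and h: "h \<in> closure D"
    and D: "\<And>d w. d \<in> D \<Longrightarrow> g x (w + d) = g x w"
  shows "g x (w + h) = g x w"
proof (rule ccontr)
  interpret invariant_observable \<alpha> \<Phi> g L by (rule obs)
  assume "g x (w + h) \<noteq> g x w"
  then have e: "\<bar>g x (w + h) - g x w\<bar> / L > 0" using L_pos by simp
  obtain d where d: "d \<in> D" "dist d h < \<bar>g x (w + h) - g x w\<bar> / L"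
    using h e closure_approachable by blast
  have "\<bar>g x (w + h) - g x (w + d)\<bar> \<le> L * dist (w + h) (w + d)" by (rule lipschitz)
  also have "\<dots> = L * dist d h" by (simp add: dist_norm norm_minus_commute)
  also have "\<dots> < \<bar>g x (w + h) - g x w\<bar>" using d(2) L_pos by (simp add: field_simps)
  finally show False using D[OF d(1)] by simp
qed

text \<open>Countably many cutoffs and a countable dense set of shifts in \<open>H\<close> give one
  null set of exceptional \<open>x\<close>; the Lipschitz bound passes from the dense set to
  \<open>H\<close>. Over the remaining \<open>x\<close>, the cutoffs cannot distinguish the fibre of
  \<open>A\<close> from its translates.\<close>

theorem ergodic_if_periods:
  assumes per: "\<And>g L h. invariant_observable \<alpha> \<Phi> g L \<Longrightarrow> h \<in> H \<Longrightarrow> AE x in lborel. \<forall>w. g x (w + h) = g x w"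
  shows "ergodic M S"
  unfolding ergodic_def
proof (intro conjI ballI impI)
  fix A assume A: "A \<in> sets M" and inv: "S -` A \<inter> space M = A"
  obtain \<U> :: "(real ^ 'm) set set" where \<U>: "countable \<U>" "\<And>U. U \<in> \<U> \<Longrightarrow> open U \<and> bounded U"
    "Int_stable \<U>" "sets borel = sigma_sets UNIV \<U>" "\<Union>\<U> = UNIV"
    using countable_bounded_Int_stable_basis by blast
  obtain D where D: "countable D" "D \<subseteq> H" "H \<subseteq> closure D" using separable[of H] by blast
  define \<phi> :: "(real ^ 'm) set \<Rightarrow> nat \<Rightarrow> real ^ 'm \<Rightarrow> real"
    where "\<phi> U n y = min 1 (real n * infdist y (- U))" for U n y
  have \<phi>01: "0 \<le> \<phi> U n u \<and> \<phi> U n u \<le> 1" for U n u unfolding \<phi>_def by (simp add: infdist_nonneg)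
  have \<phi>b: "\<phi> U n \<in> borel_measurable borel" for U n
    unfolding \<phi>_def[abs_def] by (intro borel_measurable_continuous_onI continuous_intros)
  have supp: "\<exists>R. \<forall>u. norm u > R \<longrightarrow> \<phi> U n u = 0" if U: "U \<in> \<U>" for U n
  proof -
    obtain R where "\<forall>y\<in>U. norm y \<le> R" using \<U>(2)[OF U] bounded_iff by metis
    then have "u \<in> - U" if "norm u > R" for u using that by fastforce
    then show ?thesis unfolding \<phi>_def by (intro exI[of _ R]) auto
  qed
  have obs: "\<exists>L. invariant_observable \<alpha> \<Phi> (smoothing A (\<phi> U n)) L" if U: "U \<in> \<U>" for U n
  proof -
    obtain R where R: "\<And>u. norm u > R \<Longrightarrow> \<phi> U n u = 0" using supp[OF U] by blast
    show ?thesis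
      by (rule smoothing_invariant_observable[OF A inv \<phi>b \<phi>01 R, where K = "real n"])
        (auto simp: \<phi>_def open_cutoff_lipschitz)
  qed
  have "AE x in lborel. \<forall>U\<in>\<U>. \<forall>n. \<forall>h\<in>D. \<forall>w. smoothing A (\<phi> U n) x (w + h) = smoothing A (\<phi> U n) x w"
    unfolding AE_ball_countable[OF \<U>(1)] AE_all_countable AE_ball_countable[OF D(1)]
    using per obs D(2) by blast
  then have good: "AE x in lborel. emeasure N (Pair (frac x) -` A) = 0 \<or> emeasure N (H - Pair (frac x) -` A) = 0"
  proof eventually_elim
    case (elim x)
    show ?case
    proof (rule null_or_conull_if_cutoffs[OF \<U>(2-5,1) section_sets[OF A]])
      fix h U n assume h: "h \<in> H" and U: "U \<in> \<U>"
      obtain R where R: "\<And>u. norm u > R \<Longrightarrow> \<phi> U n u = 0" using supp[OF U] by blast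
      \<comment> \<open>The second argument \<open>- f x - z\<close> cancels the shift by
        \<open>f x\<close> in the smoothing, which becomes an integral over the fibre
        itself.\<close>
      have nn: "(\<integral>\<^sup>+ y. indicator (Pair (frac x) -` A) y * ennreal (\<phi> U n (y + z)) \<partial>N)
          = ennreal (smoothing A (\<phi> U n) x (- f x + - z))" for z
      proof -
        have "(\<integral>\<^sup>+ y. indicator (Pair (frac x) -` A) y * ennreal (\<phi> U n (y + z)) \<partial>N)
            = (\<integral>\<^sup>+ y. ennreal (indicator A (frac x, y) * \<phi> U n (y + z)) \<partial>N)"
          by (rule nn_integral_cong) (auto simp: indicator_def)
        also have "\<dots> = ennreal (\<integral>y. indicator A (frac x, y) * \<phi> U n (y + z) \<partial>N)"
          by (rule nn_integral_eq_integral[OF smoothing_integrable[OF A \<phi>b \<phi>01 R]]) (use \<phi>01 in auto)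
        finally show ?thesis unfolding smoothing_def by simp
      qed
      obtain L where L: "invariant_observable \<alpha> \<Phi> (smoothing A (\<phi> U n)) L" using obs[OF U] by blast
      have "smoothing A (\<phi> U n) x (- f x + - h) = smoothing A (\<phi> U n) x (- f x)"
        by (rule smoothing_shift_dense[OF L, of _ D]) (use minus_H[OF h] D(3) elim U in auto)
      then show "(\<integral>\<^sup>+ y. indicator (Pair (frac x) -` A) y * ennreal (min 1 (real n * infdist (y + h) (- U))) \<partial>N)
        = (\<integral>\<^sup>+ y. indicator (Pair (frac x) -` A) y * ennreal (min 1 (real n * infdist y (- U))) \<partial>N)"
        using nn[of h] nn[of 0] unfolding \<phi>_def by simp
    qed
  qed
  \<comment> \<open>The skew product translates the fibre over \<open>x\<close> onto the fibre over
    \<open>x + \<alpha>\<close>, so having a null fibre is a rotation-invariant property.\<close>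
  define X where "X = {x. emeasure N (Pair (frac x) -` A) = 0}"
  have "(\<lambda>x. emeasure N (Pair (frac x) -` A)) \<in> borel_measurable borel"
    by (rule measurable_compose[OF frac_measurable_circle N.measurable_emeasure_Pair[OF A]])
  then have X: "X \<in> sets borel" unfolding X_def by measurable
  have pX: "periodic_set X" unfolding periodic_set_def X_def by (simp add: frac_1_eq)
  have "x + \<alpha> \<in> X \<longleftrightarrow> x \<in> X" for x
  proof -
    have "Pair (frac x) -` A = (\<lambda>y. y + \<Psi> x) -` (Pair (frac (x + \<alpha>)) -` A) \<inter> H"
    proof -
      have "y \<in> H" if "(frac x, y) \<in> A" for y
        using section_sets[OF A, of "frac x"] that unfolding sets_N_iff by blast
      then show ?thesis using A_invariant[OF inv, of _ x] by blast
    qed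
    then show ?thesis unfolding X_def mem_Collect_eq
      using emeasure_translate_vimage[OF \<Psi>_in_H section_sets[OF A]] by simp
  qed
  then consider "mu X = 1" | "mu X = 0"
    using rotation_zero_one[OF X pX irrational] by blast
  then show "emeasure M A = 0 \<or> emeasure M (space M - A) = 0"
  proof cases
    case 1
    have "AE x in lborel. x \<notin> - X"
      by (rule AE_periodic) (use X pX mu_Compl[OF X] 1 in \<open>auto simp: periodic_set_def\<close>)
    then have "AE x in circle. x \<in> X" using AE_circle by force
    then have "AE x in circle. emeasure N (Pair x -` A) = 0"
      by (rule AE_mp) (auto simp: X_def)
    then have "emeasure M A = 0"
      unfolding N.emeasure_pair_measure_alt[OF A]
      by (subst nn_integral_0_iff_AE) (auto intro: N.measurable_emeasure_Pair[OF A])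
    then show ?thesis ..
  next
    case 2
    have "AE x in lborel. x \<notin> X" by (rule AE_periodic[OF X pX 2])
    with good have "AE x in lborel. emeasure N (H - Pair (frac x) -` A) = 0"
      by eventually_elim (auto simp: X_def)
    then have "AE x in circle. emeasure N (H - Pair (frac x) -` A) = 0" by (rule AE_circle)
    then have ae: "AE x in circle. emeasure N (Pair x -` (space M - A)) = 0"
    proof (rule AE_mp, intro AE_I2 impI)
      fix x assume x: "x \<in> space circle" and "emeasure N (H - Pair (frac x) -` A) = 0"
      moreover have "Pair x -` (space M - A) = H - Pair (frac x) -` A" using x by (auto simp: space_M)
      ultimately show "emeasure N (Pair x -` (space M - A)) = 0" by simp
    qed
    have cA: "space M - A \<in> sets M" using A by (rule sets.compl_sets)
    have "emeasure M (space M - A) = 0"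
      unfolding N.emeasure_pair_measure_alt[OF cA]
      using ae by (subst nn_integral_0_iff_AE) (auto intro: N.measurable_emeasure_Pair[OF cA])
    then show ?thesis ..
  qed
qed (rule S_measurable, rule distr_S)

end

section \<open>Regularity\<close>

lemma Psi2_vec2: "Psi2 \<beta> x = vec2 (psi x) (psi (x + \<beta>))"
  unfolding Psi2_def vec2_def ..

lemma psi_borel [measurable]: "psi \<in> borel_measurable borel"
  unfolding psi_def[abs_def] by measurable

lemma psi_add_1: "psi (x + 1) = psi x"
  unfolding psi_def by (simp add: frac_1_eq)

lemma vec2_borel [measurable]:
  assumes "f \<in> borel_measurable M" "g \<in> borel_measurable M"
  shows "(\<lambda>x. vec2 (f x) (g x)) \<in> borel_measurable M"
proof -
  have "vec2 a b = a *\<^sub>R axis 1 1 + b *\<^sub>R axis 2 1" for a b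
    by (simp add: vec_eq_iff forall_2 axis_def)
  then show ?thesis using assms by simp
qed

lemma Psi2_borel: "Psi2 \<beta> \<in> borel_measurable borel"
  unfolding Psi2_vec2[abs_def] by measurable

lemma Psi2_periodic: "Psi2 \<beta> (x + 1) = Psi2 \<beta> x"
  unfolding Psi2_vec2 using psi_add_1[of x] psi_add_1[of "x + \<beta>"] by (simp add: add_ac)

lemma regular_if_periods:
  assumes ext: "skew_extension H N \<alpha> \<Phi> \<Psi> f" and \<Phi>: "\<Phi> \<in> borel_measurable borel"
    and per: "\<And>g L h. invariant_observable \<alpha> \<Phi> g L \<Longrightarrow> h \<in> H \<Longrightarrow> AE x in lborel. \<forall>w. g x (w + h) = g x w"
  shows "regular_cocycle (rotation \<alpha>) \<Phi>"
proof -
  interpret skew_extension H N \<alpha> \<Phi> \<Psi> f by (rule ext)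
  have "cohomologous (rotation \<alpha>) \<Phi> \<Psi>"
    unfolding cohomologous_def cocycle_def
  proof (intro conjI bexI[of _ f])
    have "\<Phi> x - \<Psi> x = f x - f (rotation \<alpha> x)" for x
      unfolding rotation_def using cobounding[of x] periodic_fun_frac[of f "x + \<alpha>", OF f_periodic] by simp
    then show "AE x in circle. \<Phi> x - \<Psi> x = f x - f (rotation \<alpha> x)" by simp
  qed (use \<Phi> \<Psi>_borel f_borel measurable_circle_borel in auto)
  moreover have "ergodic (circle \<Otimes>\<^sub>M N) (skew_product (rotation \<alpha>) \<Psi>)"
    using per by (rule ergodic_if_periods)
  ultimately show ?thesis unfolding regular_cocycle_def using subgroup haar \<Psi>_in_H by blast
qed

text \<open>A union of lines parallel to the diagonal, with vertical offsets in \<open>D\<close>.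
  The offsets {0} and (1/j)Z give the two proper subgroups that occur.\<close>

definition oblique :: "real set \<Rightarrow> (real ^ 2) set" where
  "oblique D = {v. v $ 2 - v $ 1 \<in> D}"

lemma haar_measure_on_UNIV: "haar_measure_on UNIV (lborel :: (real ^ 'm) measure)"
  unfolding haar_measure_on_def
proof (intro conjI ballI allI impI)
  fix h :: "real ^ 'm" and A :: "(real ^ 'm) set" assume "A \<in> sets lborel"
  then have A: "A \<in> sets borel" by simp
  have "(\<lambda>y. h + y) ` A = (+) (- h) -` A"
    by (auto intro!: image_eqI[of _ _ "_ - h"])
  moreover have "emeasure lborel A = emeasure (distr lborel borel ((+) (- h))) A"
    by (simp add: lborel_distr_plus)
  moreover have "\<dots> = emeasure lborel ((+) (- h) -` A)"
    using A by (subst emeasure_distr) auto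
  ultimately show "emeasure lborel ((\<lambda>y. h + y) ` A) = emeasure lborel A" by simp
next
  fix K :: "(real ^ 'm) set" assume "compact K \<and> K \<subseteq> UNIV"
  then show "emeasure lborel K < \<infinity>" using emeasure_compact_finite by blast
qed auto

text \<open>The coordinates (t, s) -> (s, s + t) identify the group with the product of
  \<open>D\<close> and the line, and Haar measure is the image of counting measure times Lebesgue
  measure. Local finiteness of \<open>D\<close> makes compact sets meet only finitely many of the
  lines.\<close>

lemma ex_haar_measure_on_oblique:
  fixes D :: "real set"
  assumes D: "closed D" "countable D" "0 \<in> D" "\<And>s t. s \<in> D \<Longrightarrow> t \<in> D \<Longrightarrow> s + t \<in> D" "\<And>t. t \<in> D \<Longrightarrow> - t \<in> D"
    and fin: "\<And>R. finite (D \<inter> {-R..R})"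
  shows "closed_subgroup (oblique D)" "\<exists>N. haar_measure_on (oblique D) N"
proof -
  have cl: "closed (oblique D)"
  proof -
    have "oblique D = (\<lambda>v. v $ 2 - v $ 1) -` D" unfolding oblique_def by auto
    then show ?thesis using D(1) by (auto intro!: closed_vimage continuous_intros)
  qed
  show "closed_subgroup (oblique D)"
    unfolding closed_subgroup_def
  proof (intro conjI ballI)
    fix g h assume "g \<in> oblique D" "h \<in> oblique D"
    then have "(g $ 2 - g $ 1) + (h $ 2 - h $ 1) \<in> D" unfolding oblique_def using D(4) by blast
    moreover have e: "(g + h) $ 2 - (g + h) $ 1 = (g $ 2 - g $ 1) + (h $ 2 - h $ 1)" by simp
    ultimately show "g + h \<in> oblique D" unfolding oblique_def mem_Collect_eq e by blast
  next
    fix h assume "h \<in> oblique D"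
    then show "- h \<in> oblique D" unfolding oblique_def using D(5)[of "h $ 2 - h $ 1"] by simp
  qed (use cl D(3) in \<open>auto simp: oblique_def\<close>)
  define R where "R = restrict_space borel (oblique D)"
  define C where "C = count_space D"
  define p :: "real \<times> real \<Rightarrow> real ^ 2" where "p = (\<lambda>(t, s). vec2 s (s + t))"
  define N where "N = distr (C \<Otimes>\<^sub>M lborel) R p"
  have setsR: "A \<in> sets R \<longleftrightarrow> A \<subseteq> oblique D \<and> A \<in> sets borel" for A
    unfolding R_def using cl by (subst sets_restrict_space_iff) auto
  have spC: "space (C \<Otimes>\<^sub>M lborel) = D \<times> UNIV" unfolding C_def by (simp add: space_pair_measure)
  have p: "p \<in> C \<Otimes>\<^sub>M lborel \<rightarrow>\<^sub>M R" unfolding R_def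
  proof (rule measurable_restrict_space2)
    show "p \<in> space (C \<Otimes>\<^sub>M lborel) \<rightarrow> oblique D"
      unfolding spC p_def oblique_def by auto
    have "(\<lambda>t. t) \<in> C \<rightarrow>\<^sub>M borel" unfolding C_def by simp
    then have "fst \<in> C \<Otimes>\<^sub>M lborel \<rightarrow>\<^sub>M (borel :: real measure)"
      using measurable_compose[OF measurable_fst, of "\<lambda>t. t" C borel lborel] by simp
    moreover have "snd \<in> C \<Otimes>\<^sub>M lborel \<rightarrow>\<^sub>M (borel :: real measure)"
      using measurable_snd[of C lborel] by simp
    ultimately show "p \<in> borel_measurable (C \<Otimes>\<^sub>M lborel)"
      unfolding p_def case_prod_beta' by measurable
  qed
  have em: "emeasure N A = (\<integral>\<^sup>+ t. emeasure lborel {s. vec2 s (s + t) \<in> A} \<partial>C)" if A: "A \<in> sets R" for A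
  proof -
    have "emeasure N A = emeasure (C \<Otimes>\<^sub>M lborel) (p -` A \<inter> space (C \<Otimes>\<^sub>M lborel))"
      unfolding N_def by (rule emeasure_distr[OF p A])
    also have "\<dots> = (\<integral>\<^sup>+ t. emeasure lborel (Pair t -` (p -` A \<inter> space (C \<Otimes>\<^sub>M lborel))) \<partial>C)"
      by (rule lborel.emeasure_pair_measure_alt[OF measurable_sets[OF p A]])
    also have "\<dots> = (\<integral>\<^sup>+ t. emeasure lborel {s. vec2 s (s + t) \<in> A} \<partial>C)"
      by (rule nn_integral_cong) (auto simp: C_def p_def spC[unfolded C_def] vimage_def)
    finally show ?thesis .
  qed
  have vb: "{s. vec2 s (s + t) \<in> A} \<in> sets borel" if "A \<in> sets borel" for A t
  proof -
    have "(\<lambda>s. vec2 s (s + t)) \<in> borel_measurable borel" by measurable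
    from borel_vimage[OF this that] show ?thesis by (simp add: vimage_def)
  qed
  have "haar_measure_on (oblique D) N"
    unfolding haar_measure_on_def
  proof (intro conjI ballI allI impI)
    show "space N = oblique D" unfolding N_def R_def by (simp add: space_restrict_space)
    show "sets N = sets (restrict_space borel (oblique D))" unfolding N_def R_def by simp
  next
    fix h A assume h: "h \<in> oblique D" and "A \<in> sets N"
    then have A: "A \<in> sets R" unfolding N_def by simp
    define a \<tau> where "a = h $ 1" and "\<tau> = h $ 2 - h $ 1"
    have h_eq: "h = vec2 a (a + \<tau>)" unfolding a_def \<tau>_def by (rule vec2_eqI) auto
    have "\<tau> \<in> D" using h unfolding oblique_def \<tau>_def by simp
    with D(5) have \<tau>: "\<tau> \<in> D" "- \<tau> \<in> D" by blast+
    have img: "(\<lambda>y. h + y) ` A = (\<lambda>y. y - h) -` A" by (auto intro!: image_eqI[of _ _ "_ - h"])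
    have img_iff: "vec2 s (s + t) \<in> (\<lambda>y. h + y) ` A \<longleftrightarrow> vec2 (s + - a) (s + - a + (t - \<tau>)) \<in> A" for s t
    proof -
      have "vec2 s (s + t) - h = vec2 (s + - a) (s + - a + (t - \<tau>))"
        by (subst h_eq) (simp add: vec2_arith algebra_simps)
      then show ?thesis unfolding img vimage_eq by simp
    qed
    have imgR: "(\<lambda>y. h + y) ` A \<in> sets R"
      unfolding setsR
    proof
      have "(\<lambda>y. y - h) \<in> borel_measurable borel" by simp
      moreover have "A \<in> sets borel" using A setsR by blast
      ultimately show "(\<lambda>y. h + y) ` A \<in> sets borel" unfolding img
        using measurable_sets_borel[of "\<lambda>y. y - h" borel A] by simp
      have "closed_subgroup (oblique D)" by fact
      then show "(\<lambda>y. h + y) ` A \<subseteq> oblique D"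
        using A h unfolding setsR closed_subgroup_def by blast
    qed
    let ?F = "\<lambda>t. emeasure lborel {s. vec2 s (s + t) \<in> A}"
    have "emeasure N ((\<lambda>y. h + y) ` A) = (\<integral>\<^sup>+ t. ?F (t - \<tau>) \<partial>C)"
      unfolding em[OF imgR]
    proof (rule nn_integral_cong)
      fix t
      have Ab: "A \<in> sets borel" using A setsR by blast
      have eq: "{s. vec2 s (s + t) \<in> (\<lambda>y. h + y) ` A} = (\<lambda>s. s + - a) -` {s. vec2 s (s + (t - \<tau>)) \<in> A}"
        unfolding img_iff by auto
      show "emeasure lborel {s. vec2 s (s + t) \<in> (\<lambda>y. h + y) ` A} = ?F (t - \<tau>)"
        unfolding eq by (rule emeasure_lborel_translate[OF vb[OF Ab]])
    qed
    also have "\<dots> = (\<integral>\<^sup>+ t. ?F t \<partial>C)"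
    proof -
      have "bij_betw (\<lambda>t. t - \<tau>) D D"
        by (rule bij_betwI[of _ _ _ "\<lambda>t. t + \<tau>"]) (use D(4) \<tau> in \<open>force+\<close>)
      then show ?thesis unfolding C_def by (rule nn_integral_bij_count_space)
    qed
    finally show "emeasure N ((\<lambda>y. h + y) ` A) = emeasure N A" unfolding em[OF A] .
  next
    fix K assume K: "compact K \<and> K \<subseteq> oblique D"
    then obtain r where r: "\<And>v. v \<in> K \<Longrightarrow> norm v \<le> r" using compact_imp_bounded bounded_iff by metis
    have KR: "K \<in> sets R" unfolding setsR using K borel_closed[OF compact_imp_closed] by blast
    have comp: "\<bar>s\<bar> \<le> r" "\<bar>t\<bar> \<le> 2 * r" if v: "vec2 s (s + t) \<in> K" for s t
    proof -
      have "\<bar>vec2 s (s + t) $ 1\<bar> \<le> r" "\<bar>vec2 s (s + t) $ 2\<bar> \<le> r"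
        using component_le_norm_cart order_trans r[OF v] by blast+
      then show "\<bar>s\<bar> \<le> r" "\<bar>t\<bar> \<le> 2 * r" by auto
    qed
    have "emeasure N K \<le> (\<integral>\<^sup>+ t. emeasure lborel {-r..r} * indicator (D \<inter> {-(2*r)..2*r}) t \<partial>C)"
      unfolding em[OF KR]
    proof (rule nn_integral_mono)
      fix t assume t: "t \<in> space C"
      show "emeasure lborel {s. vec2 s (s + t) \<in> K} \<le> emeasure lborel {-r..r} * indicator (D \<inter> {-(2*r)..2*r}) t"
      proof (cases "t \<in> {-(2*r)..2*r}")
        case True
        then have "indicator (D \<inter> {-(2*r)..2*r}) t = (1::ennreal)" using t unfolding C_def by simp
        moreover have "emeasure lborel {s. vec2 s (s + t) \<in> K} \<le> emeasure lborel {-r..r}"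
          by (rule emeasure_mono) (use comp in force)+
        ultimately show ?thesis by simp
      next
        case False
        then have "{s. vec2 s (s + t) \<in> K} = {}" using comp by force
        then show ?thesis by simp
      qed
    qed
    also have "\<dots> = emeasure lborel {-r..r} * emeasure C (D \<inter> {-(2*r)..2*r})"
      unfolding C_def by (rule nn_integral_cmult_indicator) simp
    also have "\<dots> < \<infinity>"
    proof -
      have "emeasure C (D \<inter> {-(2*r)..2*r}) < \<infinity>" unfolding C_def using fin[of "2 * r"] by (simp add: of_nat_less_top)
      moreover have "emeasure lborel {-r..r} < \<infinity>" by (rule emeasure_compact_finite) simp
      ultimately show ?thesis by (simp add: ennreal_mult_less_top)
    qed
    finally show "emeasure N K < \<infinity>" .
  next
    have full: "{s. vec2 s (s + t) \<in> oblique D} = UNIV" if "t \<in> D" for t using that unfolding oblique_def by simp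
    have "oblique D \<in> sets R" using cl by (simp add: setsR)
    then have "emeasure N (oblique D) = (\<integral>\<^sup>+ t. emeasure lborel {s. vec2 s (s + t) \<in> oblique D} \<partial>C)"
      by (rule em)
    also have "\<dots> = (\<integral>\<^sup>+ t. \<infinity> \<partial>C)"
      by (rule nn_integral_cong) (simp add: C_def full)
    also have "\<dots> \<noteq> 0" unfolding C_def using D(3) by (auto simp: emeasure_count_space_eq_0)
    finally show "emeasure N (oblique D) \<noteq> 0" .
  qed
  then show "\<exists>N. haar_measure_on (oblique D) N" by blast
qed

section \<open>The three arithmetic cases of beta\<close>

lemma AE_period_if_period:
  "invariant_observable \<alpha> \<Phi> g L \<Longrightarrow> invariant_observable.period g h \<Longrightarrow> AE x in lborel. \<forall>w. g x (w + h) = g x w"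
  by (simp add: invariant_observable.period_def)

lemma in_oblique: "v \<in> oblique D \<Longrightarrow> v = vec2 (v $ 1) (v $ 1 + (v $ 2 - v $ 1)) \<and> v $ 2 - v $ 1 \<in> D"
  unfolding oblique_def by (auto intro: vec2_eqI)

lemma birkhoff_psi_borel [measurable]: "psi_sum \<alpha> n \<in> borel_measurable borel"
  unfolding birkhoff_sum_def[abs_def] by measurable

lemma birkhoff_psi_periodic: "psi_sum \<alpha> n (x + 1) = psi_sum \<alpha> n x"
  using birkhoff_psi_add_int[of \<alpha> n x 1] by simp

text \<open>The difference psi(x + k alpha) - psi(x) telescopes into a coboundary whose transfer
  function \<open>S\<close> is, up to sign, a sum of |k| terms. Removing it leaves a cocycle on the
  diagonal, where all vectors are periods.\<close>

lemma regular_if_orbit: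
  assumes \<alpha>: "\<alpha> \<notin> \<rat>" and k: "\<beta> - of_int k * \<alpha> \<in> \<int>"
  shows "regular_cocycle (rotation \<alpha>) (Psi2 \<beta>)"
proof -
  obtain l :: int where l: "\<beta> = of_int k * \<alpha> + of_int l" using k by (auto elim!: Ints_cases simp: algebra_simps)
  define S where "S x = (if k \<ge> 0 then - psi_sum \<alpha> (nat k) x
    else psi_sum \<alpha> (nat (- k)) (x + of_int k * \<alpha>))" for x
  have Sb: "S \<in> borel_measurable borel" unfolding S_def[abs_def]
    using measurable_compose[of "\<lambda>x. x + of_int k * \<alpha>" borel borel "psi_sum \<alpha> (nat (- k))"] by auto
  have Sp: "S (x + 1) = S x" for x
    using birkhoff_psi_periodic[of \<alpha> "nat (- k)" "x + of_int k * \<alpha>"] birkhoff_psi_periodic[of \<alpha> "nat k" x]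
    unfolding S_def by (simp add: add_ac)
  have one: "psi_sum \<alpha> n (y + \<alpha>) - psi_sum \<alpha> n y = psi (y + real n * \<alpha>) - psi y" for n y
    using birkhoff_psi_orbit_shift[of \<alpha> n y 1] by (simp add: birkhoff_sum_def)
  have cob: "psi (x + \<beta>) - psi x = S x - S (x + \<alpha>)" for x
  proof -
    have "psi (x + \<beta>) = psi (x + of_int k * \<alpha>)" unfolding l using psi_add_int[of "x + of_int k * \<alpha>" l] by (simp add: add_ac)
    then show ?thesis
      using one[of "nat k" x] one[of "nat (- k)" "x + of_int k * \<alpha>"] unfolding S_def by (cases "k \<ge> 0") (auto simp: add_ac)
  qed
  have D: "closed_subgroup (oblique {0})" "\<exists>N. haar_measure_on (oblique {0}) N"
    using ex_haar_measure_on_oblique[of "{0}"] by auto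
  then obtain N where N: "haar_measure_on (oblique {0}) N" by blast
  have ext: "skew_extension (oblique {0}) N \<alpha> (Psi2 \<beta>) (\<lambda>x. vec2 (psi x) (psi x)) (\<lambda>x. vec2 0 (S x))"
  proof
    show "closed_subgroup (oblique {0})" "haar_measure_on (oblique {0}) N" by fact+
    show "\<alpha> \<notin> \<rat>" by fact
    show "(\<lambda>x. vec2 (psi x) (psi x)) \<in> borel_measurable borel" by measurable
    show "(\<lambda>x. vec2 0 (S x)) \<in> borel_measurable borel" using Sb by measurable
    show "Psi2 \<beta> x - vec2 (psi x) (psi x) = vec2 0 (S x) - vec2 0 (S (x + \<alpha>))" for x
      unfolding Psi2_vec2 vec2_arith using cob by simp
  qed (auto simp: psi_add_1 Sp Psi2_periodic oblique_def)
  show ?thesis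
  proof (rule regular_if_periods[OF ext Psi2_borel], goal_cases)
    case (1 g L h)
    note obs = 1(1) and h = 1(2)
    interpret Psi2_observable \<alpha> \<beta> g L unfolding Psi2_observable_def by (rule obs)
    have "h = vec2 (h $ 1) (h $ 1)" using in_oblique[OF h] by (intro vec2_eqI) auto
    then have "period h" using diagonal_period by metis
    then show ?case by (rule AE_period_if_period[OF obs])
  qed
qed

lemma locally_finite_scaled_Ints:
  fixes j :: nat assumes j: "j > 0"
  shows "finite ({t. real j * t \<in> \<int>} \<inter> {-R..R})"
proof (rule finite_subset)
  show "{t. real j * t \<in> \<int>} \<inter> {-R..R} \<subseteq> (\<lambda>i. of_int i / real j) ` {\<lfloor>- real j * R\<rfloor>..\<lceil>real j * R\<rceil>}"
  proof
    fix t assume t: "t \<in> {t. real j * t \<in> \<int>} \<inter> {-R..R}"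
    then obtain i where i: "real j * t = of_int i" by (auto elim: Ints_cases)
    have "real j * - R \<le> real j * t" "real j * t \<le> real j * R" using t by (intro mult_left_mono; simp)+
    then have "- real j * R \<le> of_int i" "of_int i \<le> real j * R" unfolding i by auto
    then have "i \<in> {\<lfloor>- real j * R\<rfloor>..\<lceil>real j * R\<rceil>}" by (auto simp: floor_le_iff le_ceiling_iff)
    moreover have "t = of_int i / real j" using i j by (simp add: field_simps)
    ultimately show "t \<in> (\<lambda>i. of_int i / real j) ` {\<lfloor>- real j * R\<rfloor>..\<lceil>real j * R\<rceil>}" by blast
  qed
qed simp

text \<open>By minimality of \<open>j\<close>, the numbers \<open>k\<close>, \<open>l\<close>, \<open>j\<close> are jointly coprime; Bezout then prescribes
  residues modulo \<open>j\<close> for an approximate period of the rotation by \<open>\<alpha>\<close>.\<close>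
lemma simultaneous_if_minimal_relation:
  fixes j :: nat and k l :: int
  assumes \<alpha>: "\<alpha> \<notin> \<rat>" and j: "j > 0" and rel: "real j * \<beta> = of_int k * \<alpha> + of_int l"
    and min: "\<And>j' k' l'. 0 < j' \<Longrightarrow> j' < j \<Longrightarrow> real j' * \<beta> \<noteq> of_int k' * \<alpha> + of_int l'"
    and \<tau>: "\<tau> > 0"
  shows "\<exists>(n::int) (m::int) (m'::int). \<bar>of_int n * \<alpha> - of_int m\<bar> < \<tau> \<and> \<bar>of_int n * \<beta> - of_int m' - 1 / real j\<bar> < \<tau>"
proof -
  define g where "g = gcd (gcd k l) (int j)"
  have g: "g > 0" unfolding g_def using j by simp
  have "g = 1"
  proof (rule ccontr)
    assume "g \<noteq> 1"
    then have g1: "g > 1" using g by linarith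
    obtain k' l' j' where d: "k = g * k'" "l = g * l'" "int j = g * j'"
      unfolding g_def by (metis dvdE gcd_dvd1 gcd_dvd2 dvd_trans)
    have j'0: "j' > 0" using d(3) j g by (metis of_nat_0_less_iff zero_less_mult_pos)
    have j'j: "j' < int j" unfolding d(3) using g1 j'0 by simp
    have "of_int g * (of_int j' * \<beta>) = of_int g * (of_int k' * \<alpha> + of_int l')"
    proof -
      have "of_int (int j) * \<beta> = of_int k * \<alpha> + of_int l" using rel by simp
      then show ?thesis unfolding d by (simp add: algebra_simps)
    qed
    then have "of_int j' * \<beta> = of_int k' * \<alpha> + of_int l'" using g by simp
    moreover have "0 < nat j'" "nat j' < j" using j'0 j'j by linarith+
    ultimately show False using min[of "nat j'" k' l'] j'0 by simp
  qed
  obtain u v where uv: "u * gcd k l + v * int j = 1"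
    using bezout_int[of "gcd k l" "int j"] \<open>g = 1\<close> unfolding g_def by auto
  obtain u1 v1 where uv1: "u1 * k + v1 * l = gcd k l" using bezout_int[of k l] by auto
  \<comment> \<open>With n = a and m = b mod j, an approximation n alpha ~ m gives j n beta ~ k m +
    l n, which is k b + l a = 1 mod j; so n beta is close to 1/j mod 1.\<close>
  define a b where "a = u * v1" and "b = u * u1"
  have bez: "k * b + l * a = 1 - v * int j"
  proof -
    have "k * b + l * a = u * (u1 * k + v1 * l)" unfolding a_def b_def by (simp add: algebra_simps)
    then show ?thesis using uv uv1 by simp
  qed
  \<comment> \<open>The error of the density argument is multiplied by \<open>j\<close> for alpha
    and by \<open>k\<close> for beta; the summand 1 makes both bounds strict.\<close>
  define e where "e = \<tau> / (real j + \<bar>of_int k\<bar> + 1)"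
  have e: "e > 0" unfolding e_def using \<tau> by (intro divide_pos_pos) auto
  have e_le: "real j * e < \<tau>" "\<bar>of_int k\<bar> * e < \<tau>"
  proof -
    have "\<tau> = e * (real j + \<bar>of_int k\<bar> + 1)" unfolding e_def by (simp add: add_nonneg_pos less_imp_neq[symmetric])
    then have "\<tau> = real j * e + \<bar>of_int k\<bar> * e + e" by (simp add: algebra_simps)
    moreover have "0 \<le> real j * e" "0 \<le> \<bar>of_int k\<bar> * e" using e by auto
    ultimately show "real j * e < \<tau>" "\<bar>of_int k\<bar> * e < \<tau>" using e by linarith+
  qed
  \<comment> \<open>The residues of n and m mod j are fixed, so density is applied to the multiples
    of j that are added to \<open>a\<close> and \<open>b\<close>, after division by
    \<open>j\<close>.\<close>
  obtain p t :: int where pt: "\<bar>of_int t * \<alpha> - of_int p - (of_int b - of_int a * \<alpha>) / real j\<bar> < e"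
    using sequence_of_fractional_parts_is_dense[OF \<alpha> e] by blast
  define n m where "n = a + int j * t" and "m = b + int j * p"
  define \<eta> where "\<eta> = of_int t * \<alpha> - of_int p - (of_int b - of_int a * \<alpha>) / real j"
  have \<eta>e: "\<bar>\<eta>\<bar> \<le> e" using pt unfolding \<eta>_def by simp
  have n\<alpha>: "of_int n * \<alpha> - of_int m = real j * \<eta>" unfolding n_def m_def \<eta>_def using j by (simp add: field_simps)
  have "\<bar>of_int n * \<alpha> - of_int m\<bar> < \<tau>"
    unfolding n\<alpha> abs_mult using e_le(1) mult_left_mono[OF \<eta>e, of "real j"] by simp
  moreover have "of_int n * \<beta> - of_int (k * p + l * t - v) - 1 / real j = of_int k * \<eta>"
  proof -
    have "real j * (of_int n * \<beta>) = of_int n * (real j * \<beta>)" by simp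
    also have "\<dots> = of_int n * (of_int k * \<alpha> + of_int l)" unfolding rel ..
    also have "\<dots> = of_int k * (of_int n * \<alpha>) + of_int n * of_int l" by (simp add: algebra_simps)
    also have "of_int n * \<alpha> = of_int m + real j * \<eta>" using n\<alpha> by simp
    also have "of_int k * (of_int m + real j * \<eta>) + of_int n * of_int l
      = of_int (k * b + l * a) + real j * of_int (k * p + l * t) + real j * (of_int k * \<eta>)"
      unfolding n_def m_def by (simp add: algebra_simps)
    also have "\<dots> = real j * (1 / real j + of_int (k * p + l * t - v) + of_int k * \<eta>)"
      unfolding bez using j by (simp add: algebra_simps)
    finally have "of_int n * \<beta> = 1 / real j + of_int (k * p + l * t - v) + of_int k * \<eta>" using j by simp
    then show ?thesis by simp
  qed
  moreover have "\<bar>of_int k * \<eta>\<bar> < \<tau>"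
    unfolding abs_mult using e_le(2) mult_left_mono[OF \<eta>e, of "\<bar>of_int k\<bar>"] by simp
  ultimately show ?thesis by metis
qed

text \<open>Subtracting from the second coordinate the coboundary (k/j)(psi(x + alpha) - psi(x))
  makes j times the difference of the coordinates equal to j beta - k alpha = l up to an integer, so
  the new cocycle takes values in the group with offsets (1/j)Z.\<close>

lemma regular_if_torsion:
  fixes j :: nat and k l :: int
  assumes \<alpha>: "\<alpha> \<notin> \<rat>" and j: "j > 0" and rel: "real j * \<beta> = of_int k * \<alpha> + of_int l"
    and min: "\<And>j' k' l'. 0 < j' \<Longrightarrow> j' < j \<Longrightarrow> real j' * \<beta> \<noteq> of_int k' * \<alpha> + of_int l'"
    and nonorbit: "\<And>k. \<beta> - of_int k * \<alpha> \<notin> \<int>"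
  shows "regular_cocycle (rotation \<alpha>) (Psi2 \<beta>)"
proof -
  let ?D = "{t. real j * t \<in> \<int>}"
  have "closed ?D"
  proof -
    have "?D = (\<lambda>t. real j * t) -` \<int>" by auto
    then show ?thesis by (auto intro!: closed_vimage continuous_intros)
  qed
  moreover have "countable ?D"
  proof -
    have "t \<in> (\<lambda>i. i / real j) ` \<int>" if "real j * t \<in> \<int>" for t
    proof (rule image_eqI)
      show "t = real j * t / real j" using j by simp
    qed (rule that)
    then have "?D \<subseteq> (\<lambda>i. i / real j) ` \<int>" by blast
    then show ?thesis using countable_int by (rule countable_subset[OF _ countable_image])
  qed
  ultimately have D: "closed_subgroup (oblique ?D)" "\<exists>N. haar_measure_on (oblique ?D) N"
    using ex_haar_measure_on_oblique[of ?D] locally_finite_scaled_Ints[OF j]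
    by (simp_all add: distrib_left)
  then obtain N where N: "haar_measure_on (oblique ?D) N" by blast
  define c where "c = of_int k / real j"
  define \<Psi> where "\<Psi> x = vec2 (psi x) (psi (x + \<beta>) - c * (psi (x + \<alpha>) - psi x))" for x
  define f where "f x = vec2 0 (- c * psi x)" for x
  have p1: "psi (x + 1 + y) = psi (x + y)" for x y using psi_add_1[of "x + y"] by (simp add: add_ac)
  have ext: "skew_extension (oblique ?D) N \<alpha> (Psi2 \<beta>) \<Psi> f"
  proof
    show "closed_subgroup (oblique ?D)" "haar_measure_on (oblique ?D) N" by fact+
    show "\<alpha> \<notin> \<rat>" by fact
    show "\<Psi> \<in> borel_measurable borel" unfolding \<Psi>_def[abs_def] by measurable
    show "f \<in> borel_measurable borel" unfolding f_def[abs_def] by measurable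
    show "Psi2 \<beta> x - \<Psi> x = f x - f (x + \<alpha>)" for x
      unfolding Psi2_vec2 \<Psi>_def f_def vec2_arith by (simp add: algebra_simps)
    show "\<Psi> x \<in> oblique ?D" for x
    proof -
      have "real j * (\<Psi> x $ 2 - \<Psi> x $ 1)
          = real j * (psi (x + \<beta>) - psi x) - of_int k * (psi (x + \<alpha>) - psi x)"
        unfolding \<Psi>_def c_def using j by (simp add: field_simps)
      also have "\<dots> = (real j * \<beta> - of_int k * \<alpha>)
          - real j * (of_int \<lfloor>x + \<beta>\<rfloor> - of_int \<lfloor>x\<rfloor>) + of_int k * (of_int \<lfloor>x + \<alpha>\<rfloor> - of_int \<lfloor>x\<rfloor>)"
        unfolding psi_def frac_def by (simp add: algebra_simps)
      also have "real j * \<beta> - of_int k * \<alpha> = of_int l" using rel by simp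
      also have "of_int l - real j * (of_int \<lfloor>x + \<beta>\<rfloor> - of_int \<lfloor>x\<rfloor>) + of_int k * (of_int \<lfloor>x + \<alpha>\<rfloor> - of_int \<lfloor>x\<rfloor>) \<in> \<int>"
        by (intro Ints_add Ints_diff Ints_mult) auto
      finally show ?thesis unfolding oblique_def by simp
    qed
  qed (auto simp: \<Psi>_def f_def psi_add_1 p1 Psi2_periodic)
  show ?thesis
  proof (rule regular_if_periods[OF ext Psi2_borel], goal_cases)
    case (1 g L h)
    note obs = 1(1) and h = 1(2)
    interpret Psi2_observable \<alpha> \<beta> g L unfolding Psi2_observable_def by (rule obs)
    have "period (vec2 0 1)" by (rule unit_period) (use nonorbit in \<open>auto simp: idist_eq_0\<close>)
    then have pj: "period (vec2 0 (1 / real j))"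
      using simultaneous_if_minimal_relation[OF \<alpha> j rel min] by (rule vertical_period_if_simultaneous)
    obtain i where i: "real j * (h $ 2 - h $ 1) = of_int i" using in_oblique[OF h] by (auto elim: Ints_cases)
    have "vec2 0 (h $ 2 - h $ 1) = of_int i *\<^sub>R vec2 0 (1 / real j)"
      unfolding vec2_arith i[symmetric] using j by simp
    then have "period (vec2 0 (h $ 2 - h $ 1))" using period_scale_int[OF pj, of i] by simp
    then have "period h" using period_modulo_diagonal[of "h $ 1" "h $ 2"] vec2_eqI[of h "h $ 1" "h $ 2"] by simp
    then show ?case by (rule AE_period_if_period[OF obs])
  qed
qed

text \<open>Kronecker's theorem for alpha, beta and 1, with targets 0 and \<open>v\<close>; the
  entry 1 comes last in \<open>\<theta>\<close>, as the theorem demands.\<close>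

lemma simultaneous_if_independent:
  fixes \<alpha> \<beta> :: real
  assumes ind: "\<And>a b c :: int. of_int a * \<alpha> + of_int b * \<beta> + of_int c = 0 \<Longrightarrow> a = 0 \<and> b = 0 \<and> c = 0"
    and \<tau>: "\<tau> > 0"
  shows "\<exists>(n::int) (m::int) (m'::int). \<bar>of_int n * \<alpha> - of_int m\<bar> < \<tau> \<and> \<bar>of_int n * \<beta> - of_int m' - v\<bar> < \<tau>"
proof -
  define \<theta> :: "nat \<Rightarrow> real" where "\<theta> i = (if i = 0 then \<alpha> else if i = 1 then \<beta> else 1)" for i
  have neq: "\<alpha> \<noteq> \<beta>" "\<alpha> \<noteq> 1" "\<beta> \<noteq> 1"
    using ind[of 1 "-1" 0] ind[of 1 0 "-1"] ind[of 0 1 "-1"] by auto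
  have img: "\<theta> ` {..2} = {\<alpha>, \<beta>, 1}"
  proof -
    have "{..2::nat} = {0, 1, 2}" by auto
    then show ?thesis unfolding \<theta>_def by auto
  qed
  have inj: "inj_on \<theta> {..2}" using neq unfolding inj_on_def \<theta>_def by auto
  interpret Modules.module "\<lambda>r. (*) (real_of_int r)"
    by (simp add: Modules.module.intro distrib_left mult.commute)
  have indep: "independent {\<alpha>, \<beta>, 1}"
    unfolding independent_explicit_module
  proof (intro allI impI)
    fix t u v assume t: "finite t" "t \<subseteq> {\<alpha>, \<beta>, 1}" "(\<Sum>v\<in>t. of_int (u v) * v) = 0" "v \<in> t"
    \<comment> \<open>Coefficients extended by 0 from \<open>t\<close> to all three numbers, so that
      the hypothesis on integer relations applies.\<close>
    define u' where "u' v = (if v \<in> t then u v else 0)" for v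
    have "(\<Sum>v\<in>t. of_int (u v) * v) = (\<Sum>v\<in>{\<alpha>, \<beta>, 1}. of_int (u' v) * v)"
      by (rule sum.mono_neutral_cong_left) (use t in \<open>auto simp: u'_def\<close>)
    also have "\<dots> = of_int (u' \<alpha>) * \<alpha> + of_int (u' \<beta>) * \<beta> + of_int (u' 1)"
      using neq by simp
    finally have "u' \<alpha> = 0 \<and> u' \<beta> = 0 \<and> u' 1 = 0" using ind t(3) by simp
    then have "u' v = 0" using t(2,4) by blast
    then show "u v = 0" using t(4) unfolding u'_def by simp
  qed
  have "\<theta> 2 = 1" unfolding \<theta>_def by simp
  from Kronecker_thm_2[OF indep[folded img] inj this \<tau>, of "\<lambda>i. if i = 0 then 0 else v"]
  obtain n m where nm: "\<And>i. i < 2 \<Longrightarrow> \<bar>of_int n * \<theta> i - of_int (m i) - (if i = 0 then 0 else v)\<bar> < \<tau>" by blast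
  have "\<bar>of_int n * \<alpha> - of_int (m 0)\<bar> < \<tau>" "\<bar>of_int n * \<beta> - of_int (m 1) - v\<bar> < \<tau>"
    using nm[of 0] nm[of 1] unfolding \<theta>_def by auto
  then show ?thesis by blast
qed

lemma regular_if_independent:
  assumes \<alpha>: "\<alpha> \<notin> \<rat>"
    and ind: "\<And>a b c :: int. of_int a * \<alpha> + of_int b * \<beta> + of_int c = 0 \<Longrightarrow> a = 0 \<and> b = 0 \<and> c = 0"
  shows "regular_cocycle (rotation \<alpha>) (Psi2 \<beta>)"
proof -
  have ext: "skew_extension UNIV lborel \<alpha> (Psi2 \<beta>) (Psi2 \<beta>) (\<lambda>x. 0)"
    by unfold_locales
      (auto simp: \<alpha> closed_subgroup_def haar_measure_on_UNIV Psi2_borel Psi2_periodic)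
  show ?thesis
  proof (rule regular_if_periods[OF ext Psi2_borel], goal_cases)
    case (1 g L h)
    note obs = 1(1)
    interpret Psi2_observable \<alpha> \<beta> g L unfolding Psi2_observable_def by (rule obs)
    have "idist (\<beta> - of_int k * \<alpha>) \<noteq> 0" for k
    proof
      assume "idist (\<beta> - of_int k * \<alpha>) = 0"
      then obtain c where "\<beta> - of_int k * \<alpha> = of_int c" unfolding idist_eq_0 by (auto elim: Ints_cases)
      then show False using ind[of "- k" 1 "- c"] by simp
    qed
    then have "period (vec2 0 1)" by (rule unit_period)
    then have "period (vec2 0 (h $ 2 - h $ 1))"
      using simultaneous_if_independent[OF ind] by (rule vertical_period_if_simultaneous)
    then have "period h" using period_modulo_diagonal[of "h $ 1" "h $ 2"] vec2_eqI[of h "h $ 1" "h $ 2"] by simp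
    then show ?case by (rule AE_period_if_period[OF obs])
  qed
qed

theorem mainTheorem1:
  fixes \<alpha> \<beta> :: real
  assumes "0 < \<alpha>" "\<alpha> < 1" "\<alpha> \<notin> \<rat>"
    and "0 \<le> \<beta>" "\<beta> < 1"
  shows "regular_cocycle (rotation \<alpha>) (Psi2 \<beta>)"
proof (cases "\<exists>j>0. \<exists>k l :: int. real j * \<beta> = of_int k * \<alpha> + of_int l")
  case True
  define j where "j = (LEAST j. j > 0 \<and> (\<exists>k l :: int. real j * \<beta> = of_int k * \<alpha> + of_int l))"
  have "j > 0 \<and> (\<exists>k l :: int. real j * \<beta> = of_int k * \<alpha> + of_int l)"
    unfolding j_def by (rule LeastI_ex) (use True in blast)
  then obtain k l :: int where j: "j > 0" "real j * \<beta> = of_int k * \<alpha> + of_int l" by blast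
  have min: "real j' * \<beta> \<noteq> of_int k' * \<alpha> + of_int l'" if "0 < j'" "j' < j" for j' and k' l' :: int
    using not_less_Least[OF that(2)[unfolded j_def]] that(1) by blast
  show ?thesis
  proof (cases "\<exists>k. \<beta> - of_int k * \<alpha> \<in> \<int>")
    case True
    then show ?thesis using regular_if_orbit[OF assms(3)] by blast
  next
    case False
    then show ?thesis using regular_if_torsion[OF assms(3) j min] by blast
  qed
next
  case False
  show ?thesis
  proof (rule regular_if_independent[OF assms(3)])
    fix a b c :: int assume 0: "of_int a * \<alpha> + of_int b * \<beta> + of_int c = 0"
    have b: "b = 0"
    proof (rule ccontr)
      assume "b \<noteq> 0"
      then consider "b > 0" | "b < 0" by linarith
      then show False
      proof cases
        case 1
        then have "real (nat b) * \<beta> = of_int (- a) * \<alpha> + of_int (- c)" "nat b > 0" using 0 by auto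
        then show False using False by blast
      next
        case 2
        then have "real (nat (- b)) * \<beta> = of_int a * \<alpha> + of_int c" "nat (- b) > 0" using 0 by auto
        then show False using False by blast
      qed
    qed
    moreover have "a = 0"
    proof (rule ccontr)
      assume "a \<noteq> 0"
      then have "\<alpha> = of_int (- c) / of_int a" using 0 b by (simp add: field_simps)
      then show False using assms(3) by auto
    qed
    ultimately show "a = 0 \<and> b = 0 \<and> c = 0" using 0 by simp
  qed
qed

end
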